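(* Suppose that $q$ is large and $\exp\left((\log q)^{1/2}\right)\le x\le q/\exp\left((\log q)^{1/2}\right)$. Then there exist fundamental discriminants $D$ in the range $q\le|D|\le2q$ with $$\frac{1}{\sqrt{x}}\sum_{n\le x}\left(\frac{D}{n}\right)\gg\exp\left((1+o(1))\frac{\sqrt{\log q}}{\log\log q}\right).$$
   Context: $\left(\frac{D}{n}\right)$ is the Kronecker symbol associated with the fundamental discriminant $D$; $o(1)$ refers to $q\to\infty$. *)

theory Defs
  imports "HOL-Number_Theory.Number_Theory" "HOL-Computational_Algebra.Squarefree"
begin

definition fundamental_discriminant :: "int \<Rightarrow> bool" where
  "fundamental_discriminant D \<longleftrightarrow>
     (D mod 4 = 1 \<and> squarefree D) \<or>
     (4 dvd D \<and> (D div 4) mod 4 \<in> {2, 3} \<and> squarefree (D div 4))"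

(* The library's Legendre symbol is meaningful only for an odd prime modulus;
   p = 2 needs the supplementary value. *)
definition kronecker_prime :: "int \<Rightarrow> nat \<Rightarrow> int" where
  "kronecker_prime D p =
     (if p = 2
      then (if even D then 0 else if D mod 8 \<in> {1, 7} then 1 else -1)
      else Legendre D (int p))"

definition kronecker :: "int \<Rightarrow> nat \<Rightarrow> int" where
  "kronecker D n =
     (if n = 0 then (if \<bar>D\<bar> = 1 then 1 else 0)
      else (\<Prod>p\<in>prime_factors n. kronecker_prime D p ^ multiplicity p n))"

end

(* Take D = -N with N = 7 (mod 16) squarefree, so that (D/n) = (n/N) by reciprocity and (2/N) = 1.
   A resonator R(N) = sum r(m) (m/N), supported on products m of k and of k - i primes with
   L^3 < p <= L^12, L = sqrt(log q), is applied to the nonnegative weight R(N)^2. Expanding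
   R(N)^2 sum_n f(n) (n/N) over squarefree N, the terms whose argument is a square or twice a square
   are nonnegative and contribute at least exp(2 L / log log q) times the trivial size sqrt x, up to a
   power of log q. The remaining terms are small by the Polya-Vinogradov inequality, used in the
   variable N after sieving for squarefree N. The extra factor 2 in the exponent absorbs all powers of
   log q, so epsilon = 0 and C = 1 suffice.
   For x <= q^0.93 this is done with f = 1. For longer x the sum is first transformed, via the
   Gauss sum sqrt N (S(X) - (X/N)/2) = sum_{2n <= N} (n/N) cot(pi n/N) (1 - cos(2 pi n X/N)),
   into one with nonnegative weights of effective length N/X. The sign of the Gauss sum is
   essential here. *)
theory Submission
  imports Defs "HOL-Analysis.Analysis" "HOL-Real_Asymp.Real_Asymp"
begin

text \<open>\<open>N mod 16 = 7\<close> makes -N congruent to 1 modulo 8, so that -N is a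
  fundamental discriminant once N is squarefree, and (-N | n) = (n | N) for every n >= 1, even n
  included. The modulus is 16, not 8, because N + 1 = 8 m with m odd gives (2 | N) = 1 from
  reciprocity alone. Negative discriminants suit the long range: an odd character transforms into
  weights cot (1 - cos) of one sign, an even one would bring in the sign-changing sin(2 pi n X / N).
  The direct approach fails near q because its error terms save only small powers of X/q. In the
  dual sum the obstacle is the phase cos(2 pi n X / N), whose variation in N spoils partial
  summation when n is large. Averaging over about sqrt X lengths damps it there and changes the
  character sum by O(sqrt X), which the gain absorbs. The exponent 2 can be reached because k is of
  order L^2 / log L and i of order L / log L: then k / i^2 grows like log L, and each of the i
  factors of the gain exceeds any fixed constant.\<close>

section \<open>Jacobi symbols and quadratic reciprocity\<close>

text \<open>For odd \<open>n\<close> this is the Jacobi symbol, the only case of interest.\<close>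
definition jac :: "int \<Rightarrow> nat \<Rightarrow> int" where
  "jac t n = (\<Prod>p\<in>#prime_factorization n. Legendre t (int p))"

lemma Legendre_cases: "Legendre a p = 0 \<or> Legendre a p = 1 \<or> Legendre a p = -1"
  by (auto simp: Legendre_def)

lemma Legendre_cong: "[a = b] (mod p) \<Longrightarrow> Legendre a p = Legendre b p"
proof -
  assume *: "[a = b] (mod p)"
  have "[a = 0] (mod p) \<longleftrightarrow> [b = 0] (mod p)" using * cong_sym cong_trans by blast
  moreover have "[y\<^sup>2 = a] (mod p) \<longleftrightarrow> [y\<^sup>2 = b] (mod p)" for y using * cong_sym cong_trans by blast
  ultimately show ?thesis by (simp add: Legendre_def QuadRes_def)
qed

lemma dvd_small_int_eq_0: "int p dvd x \<Longrightarrow> \<bar>x\<bar> < int p \<Longrightarrow> x = 0"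
  using dvd_imp_le_int[of x "int p"] by auto

text \<open>Euler's criterion gives the identity modulo p. Both sides lie between -1 and 1, so the
  difference is at most 2 in absolute value, less than the odd prime p, and must vanish.\<close>

lemma Legendre_mult:
  assumes "prime p" "odd (p::nat)"
  shows "Legendre (a * b) (int p) = Legendre a (int p) * Legendre b (int p)"
proof -
  have p: "2 < p" using assms prime_gt_1_nat[of p] by (cases "p = 2") auto
  have "[Legendre (a * b) p = (a * b) ^ ((p - 1) div 2)] (mod p)"
    using euler_criterion assms p by blast
  moreover have "[Legendre a p * Legendre b p = a ^ ((p - 1) div 2) * b ^ ((p - 1) div 2)] (mod p)"
    using euler_criterion assms p by (intro cong_mult) blast+
  ultimately have "[Legendre (a * b) p = Legendre a p * Legendre b p] (mod p)"
    by (metis power_mult_distrib cong_sym cong_trans)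
  then have "int p dvd Legendre (a * b) p - Legendre a p * Legendre b p"
    by (simp add: cong_iff_dvd_diff)
  moreover have le: "\<bar>Legendre (a * b) p - Legendre a p * Legendre b p\<bar> \<le> 2"
    using Legendre_cases[of "a*b" p] Legendre_cases[of a p] Legendre_cases[of b p] by auto
  moreover have "\<bar>Legendre (a * b) p - Legendre a p * Legendre b p\<bar> < int p" using le p by linarith
  ultimately have "Legendre (a * b) p - Legendre a p * Legendre b p = 0" by (intro dvd_small_int_eq_0)
  then show ?thesis by simp
qed

lemma Legendre_eq_0_iff: "Legendre a p = 0 \<longleftrightarrow> p dvd a"
  by (auto simp: Legendre_def cong_0_iff)

lemma jac_1_right [simp]: "jac t 1 = 1" "jac t (Suc 0) = 1"
  by (auto simp: jac_def)

lemma jac_mult_right: "m > 0 \<Longrightarrow> n > 0 \<Longrightarrow> jac t (m * n) = jac t m * jac t n"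
  by (simp add: jac_def prime_factorization_mult)

lemma jac_prime: "prime p \<Longrightarrow> jac t p = Legendre t (int p)"
  by (simp add: jac_def prime_factorization_prime)

lemma jac_mult_left:
  assumes "odd n" shows "jac (s * t) n = jac s n * jac t n"
proof -
  have "jac (s * t) n = (\<Prod>p\<in>#prime_factorization n. Legendre s (int p) * Legendre t (int p))"
    unfolding jac_def
  proof (rule arg_cong[where f = prod_mset], rule image_mset_cong)
    fix p assume "p \<in># prime_factorization n"
    then have "prime p" "odd p" using assms by (auto simp: in_prime_factors_iff intro: dvd_trans)
    then show "Legendre (s * t) (int p) = Legendre s (int p) * Legendre t (int p)"
      by (rule Legendre_mult)
  qed
  then show ?thesis by (simp add: prod_mset.distrib jac_def)
qed

lemma jac_1_left [simp]: "jac 1 n = 1"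
proof -
  have "(\<Prod>p\<in>#prime_factorization n. Legendre 1 (int p)) = (\<Prod>p\<in>#prime_factorization n. 1)"
  proof (rule arg_cong[where f = prod_mset], rule image_mset_cong)
    fix p assume "p \<in># prime_factorization n"
    then have "prime p" by auto
    then have "\<not> [1 = 0] (mod int p)" by (auto simp: cong_0_iff)
    moreover have "QuadRes (int p) 1" unfolding QuadRes_def by (rule exI[of _ 1]) simp
    ultimately show "Legendre 1 (int p) = 1" by (simp add: Legendre_def)
  qed
  then show ?thesis by (simp add: jac_def)
qed

lemma jac_power_left: "odd n \<Longrightarrow> jac (t ^ k) n = jac t n ^ k"
  by (induction k) (auto simp: jac_mult_left)

lemma jac_cong:
  assumes "[s = t] (mod int n)" shows "jac s n = jac t n"
  unfolding jac_def
proof (rule arg_cong[where f = prod_mset], rule image_mset_cong)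
  fix p assume "p \<in># prime_factorization n"
  then have "int p dvd int n" by (auto simp: in_prime_factors_iff)
  then have "[s = t] (mod int p)" using assms cong_dvd_modulus by blast
  then show "Legendre s (int p) = Legendre t (int p)" by (rule Legendre_cong)
qed

lemma jac_mod [simp]: "jac (t mod int n) n = jac t n"
  by (rule jac_cong) simp

lemma jac_eq_0_iff: assumes "n > 0" shows "jac t n = 0 \<longleftrightarrow> \<not> coprime t (int n)"
proof -
  have "jac t n = 0 \<longleftrightarrow> (\<exists>p. prime p \<and> p dvd n \<and> int p dvd t)"
    using assms unfolding jac_def prod_mset_zero_iff
    by (auto simp: in_prime_factors_iff Legendre_eq_0_iff image_iff)
  also have "\<dots> \<longleftrightarrow> \<not> coprime t (int n)"
  proof
    assume "\<exists>p. prime p \<and> p dvd n \<and> int p dvd t"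
    then obtain p where p: "prime p" "p dvd n" "int p dvd t" by blast
    then have "int p dvd int n" by simp
    then show "\<not> coprime t (int n)" using p(1,3)
      using coprime_common_divisor[of t "int n" "int p"] by auto
  next
    assume "\<not> coprime t (int n)"
    then have "gcd t (int n) \<noteq> 1" by (auto simp: coprime_iff_gcd_eq_1)
    then have "nat (gcd t (int n)) \<noteq> 1" by auto
    then obtain p where p: "prime p" "p dvd nat (gcd t (int n))" using prime_factor_nat by blast
    have "int p dvd gcd t (int n)" using p(2)
      by (metis gcd_ge_0_int int_dvd_int_iff int_nat_eq)
    then show "\<exists>p. prime p \<and> p dvd n \<and> int p dvd t" using p(1) by auto
  qed
  finally show ?thesis .
qed

lemma jac_cases: "jac t n = 0 \<or> jac t n = 1 \<or> jac t n = -1"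
proof -
  have "(\<Prod>p\<in>#M. Legendre t (int p)) \<in> {0,1,-1}" for M
  proof (induction M)
    case (add x M)
    then show ?case using Legendre_cases[of t "int x"] by auto
  qed auto
  then show ?thesis unfolding jac_def by blast
qed

lemma jac_abs_le: "\<bar>real_of_int (jac t n)\<bar> \<le> 1"
  using jac_cases[of t n] by auto

lemma jac_square:
  assumes "odd n" shows "jac (t ^ 2) n = (if coprime t (int n) then 1 else 0)"
  using jac_cases[of t n] jac_eq_0_iff[of n t] assms
  by (auto simp: jac_power_left odd_pos)

lemma Legendre_minus_one:
  assumes "prime p" "odd p"
  shows "Legendre (-1) (int p) = (if p mod 4 = 1 then 1 else -1)"
proof -
  have p: "2 < p" using assms prime_gt_1_nat[of p] by (cases "p = 2") auto
  have "[Legendre (-1) p = (-1) ^ ((p - 1) div 2)] (mod p)"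
    using euler_criterion assms p by blast
  moreover have "((-1)::int) ^ ((p - 1) div 2) = (if p mod 4 = 1 then 1 else -1)"
  proof -
    have "p mod 4 = 1 \<or> p mod 4 = 3" using assms by presburger
    moreover have "p mod 4 = 1 \<Longrightarrow> even ((p - 1) div 2)" by presburger
    moreover have "p mod 4 = 3 \<Longrightarrow> odd ((p - 1) div 2)" by presburger
    ultimately show ?thesis by auto
  qed
  ultimately have "int p dvd Legendre (-1) p - (if p mod 4 = 1 then 1 else -1)"
    by (simp add: cong_iff_dvd_diff)
  moreover have le: "\<bar>Legendre (-1) p - (if p mod 4 = 1 then 1 else -1)\<bar> \<le> 2"
    using Legendre_cases[of "-1" p] by auto
  moreover have "\<bar>Legendre (-1) p - (if p mod 4 = 1 then 1 else -1)\<bar> < int p" using le p by linarith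
  ultimately have "Legendre (-1) p - (if p mod 4 = 1 then 1 else -1) = 0" by (intro dvd_small_int_eq_0)
  then show ?thesis by simp
qed

text \<open>The sign (-1)^((m-1)/2 (n-1)/2) of the reciprocity law for odd m and n. Written through
  residues modulo 4, its multiplicativity in each argument is a case check.\<close>

definition rsign :: "nat \<Rightarrow> nat \<Rightarrow> int" where
  "rsign m n = (if m mod 4 = 3 \<and> n mod 4 = 3 then -1 else 1)"

lemma odd_mod4: "odd (n::nat) \<Longrightarrow> n mod 4 = 1 \<or> n mod 4 = 3" by presburger

lemma rsign_mult: 
  assumes "odd a" "odd b" shows "rsign (a * b) n = rsign a n * rsign b n" "rsign n (a * b) = rsign n a * rsign n b"
  using odd_mod4[OF assms(1)] odd_mod4[OF assms(2)]
  by (auto simp: rsign_def mod_mult_eq[of a 4 b, symmetric])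

lemma odd_induct_prime [consumes 1, case_names one mult]:
  assumes "odd (n::nat)" "P 1"
    "\<And>p n. prime p \<Longrightarrow> odd p \<Longrightarrow> odd n \<Longrightarrow> P n \<Longrightarrow> P (p * n)"
  shows "P n"
  using assms(1)
proof (induction n rule: less_induct)
  case (less n)
  show ?case
  proof (cases "n = 1")
    case False
    then obtain p where p: "prime p" "p dvd n" using prime_factor_nat by blast
    then obtain m where m: "n = p * m" by blast
    have "odd p" "odd m" using less.prems m by auto
    moreover have "m < n" using m less.prems p prime_gt_1_nat[of p] by (cases "m = 0") auto
    ultimately show ?thesis using less.IH assms(3) p m by blast
  qed (use assms in auto)
qed

lemma jac_minus_one:
  assumes "odd n" shows "jac (-1) n = (if n mod 4 = 1 then 1 else -1)"
  using assms
proof (induction n rule: odd_induct_prime)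
  case (mult p n)
  then show ?case using odd_mod4[of p] odd_mod4[of n]
    by (auto simp: jac_mult_right jac_prime Legendre_minus_one prime_gt_0_nat odd_pos mod_mult_eq[of p 4 n, symmetric])
qed auto

lemma Legendre_reciprocity:
  assumes "prime p" "odd p" "prime q" "odd q"
  shows "Legendre (int p) (int q) = rsign p q * Legendre (int q) (int p)"
proof (cases "p = q")
  case True
  then show ?thesis by (simp add: Legendre_def cong_0_iff)
next
  case False
  have p2: "2 < p" using assms prime_gt_1_nat[of p] by (cases "p = 2") auto
  have q2: "2 < q" using assms prime_gt_1_nat[of q] by (cases "q = 2") auto
  have *: "Legendre p q * Legendre q p = (-1::int) ^ ((p - 1) div 2 * ((q - 1) div 2))"
    using Quadratic_Reciprocity assms p2 q2 False by blast
  have "(-1::int) ^ ((p - 1) div 2 * ((q - 1) div 2)) = rsign p q"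
  proof -
    have "p mod 4 = 1 \<Longrightarrow> even ((p - 1) div 2)" "p mod 4 = 3 \<Longrightarrow> odd ((p - 1) div 2)" by presburger+
    moreover have "q mod 4 = 1 \<Longrightarrow> even ((q - 1) div 2)" "q mod 4 = 3 \<Longrightarrow> odd ((q - 1) div 2)" by presburger+
    ultimately show ?thesis using odd_mod4[of p] odd_mod4[of q] assms by (auto simp: rsign_def)
  qed
  then have "Legendre p q * Legendre q p = rsign p q" using * by simp
  moreover have "rsign p q = 1 \<or> rsign p q = -1" by (simp add: rsign_def)
  ultimately show ?thesis using Legendre_cases[of p q] Legendre_cases[of q p] by fastforce
qed

text \<open>Both sides are multiplicative in either argument, so the law for primes extends by
  induction on m and, inside it, on n.\<close>

lemma jac_reciprocity:
  assumes "odd m" "odd n" shows "jac (int m) n = rsign m n * jac (int n) m"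
  using assms(1)
proof (induction m rule: odd_induct_prime)
  case one
  then show ?case by (simp add: rsign_def)
next
  case (mult p m)
  have "jac (int p) n = rsign p n * jac (int n) p"
    using assms(2)
  proof (induction n rule: odd_induct_prime)
    case one
    then show ?case by (simp add: rsign_def)
  next
    case (mult q n)
    then show ?case using \<open>prime p\<close> \<open>odd p\<close> Legendre_reciprocity[of p q]
      by (simp add: jac_mult_right prime_gt_0_nat odd_pos rsign_mult jac_prime Legendre_mult)
  qed
  then show ?case using mult assms(2)
    by (simp add: jac_mult_left rsign_mult jac_mult_right prime_gt_0_nat odd_pos)
qed

text \<open>For N = 3 modulo 4 the factor (-1 | n) coincides with the reciprocity sign, and the two
  cancel. This is what lets the symbol be read both as a character of n and as a character of
  N.\<close>

lemma jac_neg_reciprocity: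
  assumes "N mod 4 = 3" "odd n" shows "jac (- int N) n = jac (int n) N"
proof -
  have "odd N" using assms(1) by presburger
  have "jac (- int N) n = jac (-1) n * jac (int N) n"
    using jac_mult_left[OF assms(2), of "-1" "int N"] by simp
  also have "\<dots> = jac (-1) n * (rsign N n * jac (int n) N)"
    using jac_reciprocity[OF \<open>odd N\<close> assms(2)] by simp
  also have "\<dots> = (jac (-1) n * rsign N n) * jac (int n) N" by simp
  also have "jac (-1) n * rsign N n = 1"
    using odd_mod4[OF assms(2)] assms by (auto simp: jac_minus_one rsign_def)
  finally show ?thesis by simp
qed

lemma mod16_7D: "N mod 16 = (7::nat) \<Longrightarrow> odd N" "N mod 16 = (7::nat) \<Longrightarrow> N mod 4 = 3"
proof -
  assume "N mod 16 = (7::nat)"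
  moreover have "N mod 16 mod 4 = N mod 4" "N mod 16 mod 2 = N mod 2" by (simp_all add: mod_mod_cancel)
  ultimately have "N mod 4 = 3" "N mod 2 = 1" by auto
  then show "odd N" "N mod 4 = 3" by (auto simp: odd_iff_mod_2_eq_one)
qed

text \<open>Writing $N + 1 = 8 m$ with $m$ odd, $1 = (N+1 \mid N) = (2 \mid N)^3 (m \mid N)$ and
  $(m \mid N) = (-N \mid m) = (1 \mid m) = 1$, so the second supplementary law is not needed.\<close>
lemma jac_2:
  assumes "N mod 16 = 7" shows "jac 2 N = 1"
proof -
  have o: "odd N" using assms mod16_7D by blast
  define m where "m = 2 * (N div 16) + 1"
  have m: "N + 1 = 8 * m" "odd m" unfolding m_def using assms mult_div_mod_eq[of 16 N] by auto
  have "jac (- int N) m = jac (int m) N"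
    using jac_neg_reciprocity[of N m] mod16_7D[OF assms] m by blast
  moreover have "jac (- int N) m = jac 1 m"
  proof (rule jac_cong)
    have "1 - (- int N) = int m * 8" using m(1) by linarith
    then show "[- int N = 1] (mod int m)" unfolding cong_iff_dvd_diff by (metis dvd_diff_commute dvd_triv_left)
  qed
  ultimately have "jac (int m) N = 1" by simp
  moreover have "jac (8 * int m) N = jac 1 N"
  proof (rule jac_cong)
    have "8 * int m - 1 = int N" using m(1) by linarith
    then show "[8 * int m = 1] (mod int N)" unfolding cong_iff_dvd_diff by simp
  qed
  moreover have "jac 8 N = jac 2 N ^ 3" using jac_power_left[OF o, of 2 3] by simp
  ultimately show ?thesis using jac_cases[of 2 N] by (auto simp: jac_mult_left[OF o])
qed

lemma jac_prod_left:
  assumes "odd N" shows "jac (\<Prod>x\<in>A. f x) N = (\<Prod>x\<in>A. jac (f x) N)"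
  by (induction A rule: infinite_finite_induct) (auto simp: jac_mult_left[OF assms])

text \<open>Only p = 2 differs from \<open>jac_neg_reciprocity\<close>: -N is 1 modulo 8, so the
  Kronecker symbol at 2 is 1, in agreement with (2 | N) = 1.\<close>

lemma kronecker_eq_jac:
  assumes "N mod 16 = 7" "n > 0" shows "kronecker (- int N) n = jac (int n) N"
proof -
  have o: "odd N" using assms mod16_7D by blast
  have k: "kronecker_prime (- int N) p = jac (int p) N" if "p \<in># prime_factorization n" for p
  proof (cases "p = 2")
    case True
    define m where "m = N div 16"
    have "N = 16 * m + 7" using assms(1) mult_div_mod_eq[of 16 N] unfolding m_def by simp
    then have "- int N = 1 + 8 * (- 2 * int m - 1)" by simp
    then have "(- int N) mod 8 = 1" by (simp only: mod_mult_self2) simp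
    then show ?thesis using True o jac_2[OF assms(1)] by (simp add: kronecker_prime_def)
  next
    case False
    have p: "prime p" using that by auto
    then have "odd p" using False primes_dvd_imp_eq[of 2 p] by auto
    moreover have "N mod 4 = 3" using assms mod16_7D by blast
    ultimately show ?thesis using False p jac_neg_reciprocity[of N p]
      by (simp add: kronecker_prime_def jac_prime)
  qed
  have "kronecker (- int N) n = (\<Prod>p\<in>prime_factors n. jac (int p) N ^ multiplicity p n)"
    using assms k by (simp add: kronecker_def)
  moreover have "\<dots> = jac (int (\<Prod>p\<in>prime_factors n. p ^ multiplicity p n)) N"
    by (simp add: jac_prod_left[OF o] jac_power_left[OF o])
  moreover have "(\<Prod>p\<in>prime_factors n. p ^ multiplicity p n) = n"
    using assms prime_factorization_nat[of n] by (auto simp: prime_factors_multiplicity)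
  ultimately show ?thesis by simp
qed

section \<open>Gauss sums\<close>

definition ee :: "nat \<Rightarrow> int \<Rightarrow> complex" where
  "ee n a = cis (2 * pi * real_of_int a / real n)"

lemma ee_0 [simp]: "ee n 0 = 1" by (simp add: ee_def)

lemma ee_add: "ee n (a + b) = ee n a * ee n b"
  by (simp add: ee_def cis_mult[symmetric] add_divide_distrib ring_distribs)

lemma norm_ee [simp]: "norm (ee n a) = 1" by (simp add: ee_def)

lemma cnj_ee: "cnj (ee n a) = ee n (- a)" by (simp add: ee_def cis_cnj)

lemma ee_multiple: assumes "n > 0" shows "ee n (int n * k) = 1"
proof -
  have "2 * pi * real_of_int (int n * k) / real n = 2 * pi * real_of_int k" using assms by simp
  then show ?thesis by (simp add: ee_def cis_multiple_2pi)
qed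

lemma ee_cong: assumes "n > 0" "[a = b] (mod int n)" shows "ee n a = ee n b"
proof -
  obtain k where "a = b + int n * k" using assms(2)
    by (metis cong_iff_lin cong_sym)
  then show ?thesis by (simp add: ee_add ee_multiple[OF assms(1)])
qed

lemma ee_scale: "k > 0 \<Longrightarrow> ee (n * k) (a * int k) = ee n a"
  by (cases "n = 0") (simp_all add: ee_def mult.assoc)

lemma ee_eq_1_iff: assumes "n > 0" shows "ee n a = 1 \<longleftrightarrow> int n dvd a"
proof
  assume "ee n a = 1"
  then have "cos (2 * pi * real_of_int a / real n) = 1" by (simp add: ee_def complex_eq_iff)
  then obtain k :: int where "2 * pi * real_of_int a / real n = of_int k * 2 * pi"
    by (metis cos_one_2pi_int)
  then have "real_of_int a = real_of_int (k * int n)" using assms by (simp add: field_simps)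
  then have "a = k * int n" by (simp only: of_int_eq_iff)
  then show "int n dvd a" by simp
next
  assume "int n dvd a"
  then show "ee n a = 1" using assms ee_multiple by blast
qed

lemma ee_power: "ee n (a * int k) = ee n a ^ k"
  by (simp add: ee_def Complex.DeMoivre mult_ac)

lemma sum_ee:
  assumes "n > 0"
  shows "(\<Sum>t\<in>{0..<int n}. ee n (a * t)) = (if int n dvd a then of_nat n else 0)"
proof -
  have "(\<Sum>t\<in>{0..<int n}. ee n (a * t)) = (\<Sum>k<n. ee n a ^ k)"
    by (rule sum.reindex_bij_witness[of _ int nat]) (auto simp: ee_power[symmetric])
  also have "\<dots> = (if int n dvd a then of_nat n else 0)"
  proof (cases "int n dvd a")
    case True
    then have "ee n a = 1" using ee_eq_1_iff[OF assms] by simp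
    then show ?thesis using True by simp
  next
    case False
    then have "ee n a \<noteq> 1" using ee_eq_1_iff[OF assms] by simp
    moreover have "ee n a ^ n = 1" using ee_power[of n a n] ee_multiple[OF assms, of a]
      by (simp add: mult.commute)
    ultimately show ?thesis using False by (simp add: geometric_sum)
  qed
  finally show ?thesis .
qed

lemma sum_residues_mult:
  fixes F :: "int \<Rightarrow> complex"
  assumes "n > 0" "coprime b (int n)" "\<And>a b. [a = b] (mod int n) \<Longrightarrow> F a = F b"
  shows "(\<Sum>t\<in>{0..<int n}. F (b * t)) = (\<Sum>t\<in>{0..<int n}. F t)"
proof -
  have inj: "inj_on (\<lambda>t. (b * t) mod int n) {0..<int n}"
  proof (rule inj_onI)
    fix s t assume st: "s \<in> {0..<int n}" "t \<in> {0..<int n}" "(b * s) mod int n = (b * t) mod int n"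
    then have "[b * s = b * t] (mod int n)" by (simp add: Cong.cong_def)
    then have "[s = t] (mod int n)" using assms(2) by (simp add: cong_mult_lcancel)
    then show "s = t" using st cong_less_imp_eq_int by auto
  qed
  moreover have "(\<lambda>t. (b * t) mod int n) ` {0..<int n} \<subseteq> {0..<int n}" using assms(1) by auto
  ultimately have "bij_betw (\<lambda>t. (b * t) mod int n) {0..<int n} {0..<int n}"
    by (simp add: bij_betw_def endo_inj_surj)
  then have "(\<Sum>t\<in>{0..<int n}. F ((b * t) mod int n)) = (\<Sum>t\<in>{0..<int n}. F t)"
    by (rule sum.reindex_bij_betw)
  moreover have "F ((b * t) mod int n) = F (b * t)" for t by (rule assms(3)) simp
  ultimately show ?thesis by simp
qed

text \<open>The representation s m + t p, without inverses, is chosen because a linear phase modulo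
  p m then splits into a phase s / p plus a phase t / m.\<close>

lemma sum_residues_crt:
  fixes F :: "int \<Rightarrow> complex"
  assumes "p > 0" "m > 0" "coprime p m" "\<And>a b. [a = b] (mod int (p * m)) \<Longrightarrow> F a = F b"
  shows "(\<Sum>t\<in>{0..<int (p * m)}. F t) = (\<Sum>s\<in>{0..<int p}. \<Sum>t\<in>{0..<int m}. F (s * int m + t * int p))"
proof -
  let ?g = "\<lambda>(s,t). (s * int m + t * int p) mod int (p * m)"
  have cop: "coprime (int p) (int m)" using assms(3) by simp
  have pos: "int (p * m) > 0" using assms by simp
  have inj: "inj_on ?g ({0..<int p} \<times> {0..<int m})"
  proof (rule inj_onI, clarify)
    fix s t s' t' assume st: "s \<in> {0..<int p}" "t \<in> {0..<int m}" "s' \<in> {0..<int p}" "t' \<in> {0..<int m}"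
      "(s * int m + t * int p) mod int (p * m) = (s' * int m + t' * int p) mod int (p * m)"
    then have c: "[s * int m + t * int p = s' * int m + t' * int p] (mod int (p * m))" by (simp add: Cong.cong_def)
    have "int p dvd (s - s') * int m + int p * (t - t')" "int m dvd (t - t') * int p + int m * (s - s')"
      using cong_dvd_modulus[OF c, of "int p"] cong_dvd_modulus[OF c, of "int m"]
      by (auto simp: cong_iff_dvd_diff algebra_simps)
    then have "int p dvd (s - s') * int m" "int m dvd (t - t') * int p"
      by (simp_all add: dvd_add_left_iff)
    then have "int p dvd s - s'" "int m dvd t - t'"
      using cop by (simp_all add: coprime_dvd_mult_left_iff coprime_commute)
    then have "[s = s'] (mod int p)" "[t = t'] (mod int m)" by (simp_all add: cong_iff_dvd_diff)
    then show "s = s' \<and> t = t'" using st cong_less_imp_eq_int by auto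
  qed
  have sub: "?g ` ({0..<int p} \<times> {0..<int m}) \<subseteq> {0..<int (p * m)}" using pos by auto
  have "bij_betw ?g ({0..<int p} \<times> {0..<int m}) {0..<int (p * m)}"
    unfolding bij_betw_def
  proof (intro conjI inj card_subset_eq sub)
    show "card (?g ` ({0..<int p} \<times> {0..<int m})) = card {0..<int (p * m)}"
      using inj by (simp add: card_image card_cartesian_product nat_mult_distrib)
  qed simp
  then have "(\<Sum>x\<in>{0..<int p} \<times> {0..<int m}. F (?g x)) = (\<Sum>t\<in>{0..<int (p * m)}. F t)"
    by (rule sum.reindex_bij_betw)
  moreover have "F (?g x) = F (fst x * int m + snd x * int p)" for x
    by (cases x) (auto intro!: assms(4))
  ultimately show ?thesis by (simp add: sum.cartesian_product case_prod_beta)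
qed

definition gauss_sum :: "int \<Rightarrow> nat \<Rightarrow> complex" where
  "gauss_sum a n = (\<Sum>t\<in>{0..<int n}. of_int (jac t n) * ee n (a * t))"

lemma gauss_sum_cong: "n > 0 \<Longrightarrow> [a = b] (mod int n) \<Longrightarrow> gauss_sum a n = gauss_sum b n"
  unfolding gauss_sum_def by (intro sum.cong refl arg_cong2[where f = times] ee_cong cong_mult) auto

lemma gauss_sum_twist:
  assumes "odd n" "coprime b (int n)" shows "gauss_sum a n = of_int (jac b n) * gauss_sum (a * b) n"
proof -
  have n: "n > 0" using assms(1) odd_pos by blast
  have "(\<Sum>t\<in>{0..<int n}. of_int (jac (b * t) n) * ee n (a * (b * t))) = gauss_sum a n"
    unfolding gauss_sum_def
  proof (rule sum_residues_mult[OF n assms(2)])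
    fix s t assume "[s = t] (mod int n)"
    then show "of_int (jac s n) * ee n (a * s) = of_int (jac t n) * ee n (a * t)"
      using jac_cong ee_cong[OF n] cong_scalar_left by metis
  qed
  then show ?thesis
    by (simp add: gauss_sum_def jac_mult_left[OF assms(1)] sum_distrib_left mult_ac)
qed

lemma jac_sq_1: "n > 0 \<Longrightarrow> coprime b (int n) \<Longrightarrow> jac b n * jac b n = 1"
  using jac_cases[of b n] jac_eq_0_iff[of n b] by auto

lemma gauss_sum_mult:
  assumes "odd n" "coprime b (int n)" shows "gauss_sum (a * b) n = of_int (jac b n) * gauss_sum a n"
proof -
  have "of_int (jac b n) * gauss_sum a n = of_int (jac b n * jac b n) * gauss_sum (a * b) n"
    by (subst gauss_sum_twist[OF assms, of a]) (simp add: mult_ac)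
  then show ?thesis using jac_sq_1[of n b] assms odd_pos by simp
qed

text \<open>If every unit were a square, squaring would map the residues onto themselves and hence
  be injective, but 1 and p - 1 have the same square.\<close>

lemma exists_nonresidue:
  assumes "prime p" "odd p" shows "\<exists>a. Legendre a (int p) = -1"
proof (rule ccontr)
  assume "\<not> ?thesis"
  then have *: "\<exists>y. [y\<^sup>2 = a] (mod int p)" if "\<not> int p dvd a" for a
    using that by (auto simp: Legendre_def QuadRes_def cong_0_iff split: if_splits)
  let ?S = "{0..<int p}"
  have p: "p > 2" using assms prime_gt_1_nat[of p] by (cases "p = 2") auto
  have "?S \<subseteq> (\<lambda>y. y\<^sup>2 mod int p) ` ?S"
  proof
    fix a assume a: "a \<in> ?S"
    show "a \<in> (\<lambda>y. y\<^sup>2 mod int p) ` ?S"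
    proof (cases "a = 0")
      case True then show ?thesis using a by (intro image_eqI[of _ _ 0]) auto
    next
      case False
      then have "\<not> int p dvd a" using a zdvd_imp_le by force
      then obtain y where "[y\<^sup>2 = a] (mod int p)" using * by blast
      then have "(y mod int p)\<^sup>2 mod int p = a" using a by (simp add: Cong.cong_def power_mod)
      then show ?thesis using p by (intro image_eqI[of _ _ "y mod int p"]) auto
    qed
  qed
  then have "(\<lambda>y. y\<^sup>2 mod int p) ` ?S = ?S" using p by auto
  then have "inj_on (\<lambda>y. y\<^sup>2 mod int p) ?S" by (intro eq_card_imp_inj_on) auto
  moreover have "(int p - 1)\<^sup>2 mod int p = 1\<^sup>2 mod int p"
  proof -
    have "(int p - 1)\<^sup>2 = 1 + int p * (int p - 2)" by (simp add: power2_eq_square algebra_simps)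
    then show ?thesis by simp
  qed
  ultimately have "int p - 1 = 1"
    by (rule inj_onD[of "\<lambda>y. y\<^sup>2 mod int p" ?S]) (use p in auto)
  then show False using p by simp
qed

text \<open>If a prime \<open>p\<close> divides both \<open>a\<close> and \<open>n\<close>, twisting by some \<open>b\<close> that is \<open>1\<close> modulo \<open>n/p\<close>
  and a non-residue modulo \<open>p\<close> fixes the sum and reverses its sign.\<close>
lemma gauss_sum_eq_0:
  assumes "odd n" "squarefree n" "\<not> coprime a (int n)" shows "gauss_sum a n = 0"
proof -
  have n: "n > 0" using assms(1) odd_pos by blast
  have "jac a n = 0" using assms n by (simp add: jac_eq_0_iff)
  then have "\<exists>p. prime p \<and> p dvd n \<and> int p dvd a"
    using n unfolding jac_def by (auto simp: prod_mset_zero_iff in_prime_factors_iff Legendre_eq_0_iff image_iff)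
  then obtain p where p: "prime p" "p dvd n" "int p dvd a" by blast
  obtain m where m: "n = p * m" using p by blast
  have op: "odd p" "m > 0" using m assms(1) n by auto
  have "coprime p m"
  proof (rule ccontr)
    assume "\<not> coprime p m"
    then have "p dvd m" using p(1) prime_imp_coprime by blast
    then have "p^2 dvd n" using m by (simp add: power2_eq_square)
    from squarefreeD[OF assms(2) this] show False using p(1) by auto
  qed
  then have cop: "coprime (int p) (int m)" by simp
  obtain r where r: "Legendre r (int p) = -1" using exists_nonresidue p(1) op by blast
  obtain b where b: "[b = r] (mod int p)" "[b = 1] (mod int m)"
    using binary_chinese_remainder_int[OF cop] by blast
  have jb: "jac b n = -1"
    using r b op p(1) by (simp add: m jac_mult_right prime_gt_0_nat jac_prime jac_cong[of b 1 m] Legendre_cong[of b r])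
  then have cb: "coprime b (int n)" using jac_eq_0_iff[OF n, of b] by auto
  have "[a * b = a] (mod int n)"
  proof -
    have "int p * int m dvd a * (b - 1)" using p(3) b(2) by (intro mult_dvd_mono) (auto simp: cong_iff_dvd_diff)
    then show ?thesis by (simp add: cong_iff_dvd_diff m algebra_simps)
  qed
  then have "gauss_sum a n = - gauss_sum a n" using gauss_sum_mult[OF assms(1) cb, of a] jb gauss_sum_cong[OF n] by auto
  then show ?thesis by (simp add: eq_neg_iff_add_eq_0)
qed

lemma gauss_sum_eq:
  assumes "odd n" "squarefree n" shows "gauss_sum a n = of_int (jac a n) * gauss_sum 1 n"
proof (cases "coprime a (int n)")
  case True
  then show ?thesis using gauss_sum_mult[OF assms(1) True, of 1] by simp
next
  case False
  then show ?thesis using gauss_sum_eq_0[OF assms False] jac_eq_0_iff[of n a] assms(1) odd_pos by auto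
qed

text \<open>Parseval: the sum of |G(a)|^2 over all a equals n times the sum of (t | n)^2 by
  orthogonality, and |G(1)|^2 times the same sum by \<open>gauss_sum_eq\<close>. The common factor
  is positive and cancels.\<close>

lemma norm_gauss_sum:
  assumes "odd n" "squarefree n" shows "norm (gauss_sum 1 n) = sqrt (real n)"
proof -
  let ?S = "{0..<int n}"
  have n: "n > 0" using assms(1) odd_pos by blast
  let ?J = "\<lambda>t. of_int (jac t n) :: complex"
  have "gauss_sum a n * cnj (gauss_sum a n) = (\<Sum>t\<in>?S. \<Sum>s\<in>?S. ?J t * ?J s * ee n ((t - s) * a))" for a
    unfolding gauss_sum_def cnj_sum sum_product
  proof (intro sum.cong refl)
    fix t s
    have "ee n ((t - s) * a) = ee n (a * t) * ee n (- (a * s))"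
      by (simp add: ee_add[symmetric] algebra_simps)
    then show "?J t * ee n (a * t) * cnj (?J s * ee n (a * s)) = ?J t * ?J s * ee n ((t - s) * a)"
      by (simp add: cnj_ee)
  qed
  then have "(\<Sum>a\<in>?S. gauss_sum a n * cnj (gauss_sum a n)) = (\<Sum>a\<in>?S. \<Sum>t\<in>?S. \<Sum>s\<in>?S. ?J t * ?J s * ee n ((t - s) * a))"
    by simp
  also have "\<dots> = (\<Sum>t\<in>?S. \<Sum>a\<in>?S. \<Sum>s\<in>?S. ?J t * ?J s * ee n ((t - s) * a))"
    by (rule sum.swap)
  also have "\<dots> = (\<Sum>t\<in>?S. \<Sum>s\<in>?S. \<Sum>a\<in>?S. ?J t * ?J s * ee n ((t - s) * a))"
    by (intro sum.cong refl sum.swap)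
  also have "\<dots> = (\<Sum>t\<in>?S. \<Sum>s\<in>?S. ?J t * ?J s * (\<Sum>a\<in>?S. ee n ((t - s) * a)))"
    by (simp only: sum_distrib_left)
  also have "\<dots> = (\<Sum>t\<in>?S. \<Sum>s\<in>?S. if t = s then ?J t * ?J s * of_nat n else 0)"
  proof (intro sum.cong refl)
    fix t s assume ts: "t \<in> ?S" "s \<in> ?S"
    have "int n dvd t - s \<longleftrightarrow> t = s" using ts cong_less_imp_eq_int[of t "int n" s]
      by (auto simp: cong_iff_dvd_diff)
    then show "?J t * ?J s * (\<Sum>a\<in>?S. ee n ((t - s) * a)) = (if t = s then ?J t * ?J s * of_nat n else 0)"
      by (simp add: sum_ee[OF n])
  qed
  also have "\<dots> = of_nat n * (\<Sum>t\<in>?S. ?J t * ?J t)"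
    by (simp add: sum_distrib_left mult_ac)
  finally have 1: "(\<Sum>a\<in>?S. gauss_sum a n * cnj (gauss_sum a n)) = of_nat n * (\<Sum>t\<in>?S. ?J t * ?J t)" .
  have f: "gauss_sum a n * cnj (gauss_sum a n) = (gauss_sum 1 n * cnj (gauss_sum 1 n)) * (?J a * ?J a)" for a
    using gauss_sum_eq[OF assms, of a] by simp
  have 2: "(\<Sum>a\<in>?S. gauss_sum a n * cnj (gauss_sum a n)) = (gauss_sum 1 n * cnj (gauss_sum 1 n)) * (\<Sum>t\<in>?S. ?J t * ?J t)"
    unfolding sum_distrib_left by (intro sum.cong refl f)
  have nz: "(\<Sum>t\<in>?S. ?J t * ?J t) \<noteq> 0"
  proof -
    \<comment> \<open>The residue is written \<open>1 mod int n\<close> because for n = 1 the only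
      residue is 0.\<close>
    have "1 mod int n \<in> ?S" using n by simp
    then have "(\<Sum>t\<in>?S. (jac t n)\<^sup>2) \<ge> (jac (1 mod int n) n)\<^sup>2"
      by (intro member_le_sum) auto
    moreover have "jac (1 mod int n) n = 1" using jac_mod[of 1 n] by (simp only: jac_1_left)
    ultimately have "(\<Sum>t\<in>?S. (jac t n)\<^sup>2) > 0" by simp
    moreover have "(\<Sum>t\<in>?S. ?J t * ?J t) = of_int (\<Sum>t\<in>?S. (jac t n)\<^sup>2)" by (simp add: power2_eq_square)
    ultimately show ?thesis by (simp only: of_int_eq_0_iff)
  qed
  have "gauss_sum 1 n * cnj (gauss_sum 1 n) = of_nat n" using 1 2 nz by simp
  then have "(norm (gauss_sum 1 n))\<^sup>2 = real n"
    by (metis complex_norm_square of_real_eq_iff of_real_of_nat_eq)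
  then show ?thesis by (metis norm_ge_zero real_sqrt_unique)
qed

section \<open>Quadratic Gauss sums and the sign of the Gauss sum\<close>

definition quadratic_sum :: "int \<Rightarrow> nat \<Rightarrow> complex" where
  "quadratic_sum a n = (\<Sum>t\<in>{0..<int n}. ee n (a * t\<^sup>2))"

lemma card_square_roots:
  assumes "prime p" "odd p" "t \<in> {0..<int p}"
  shows "int (card {s\<in>{0..<int p}. s\<^sup>2 mod int p = t}) = 1 + Legendre t (int p)"
proof -
  let ?R = "{s\<in>{0..<int p}. s\<^sup>2 mod int p = t}"
  have "p > 2" using assms prime_gt_1_nat[of p] by (cases "p = 2") auto
  then have p: "p > 2" "prime (int p)" using assms by auto
  have fact: "\<And>s y. [s\<^sup>2 = y\<^sup>2] (mod int p) \<Longrightarrow> [s = y] (mod int p) \<or> [s = -y] (mod int p)"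
  proof -
    fix s y assume "[s\<^sup>2 = y\<^sup>2] (mod int p)"
    then have "int p dvd (s - y) * (s + y)" by (simp add: cong_iff_dvd_diff power2_eq_square algebra_simps)
    then show "[s = y] (mod int p) \<or> [s = -y] (mod int p)"
      using p(2) by (auto simp: cong_iff_dvd_diff prime_dvd_mult_iff)
  qed
  show ?thesis
  proof (cases "QuadRes (int p) t")
    case False
    then have "?R = {}" using assms(3) by (auto simp: QuadRes_def Cong.cong_def)
    then have c: "card ?R = 0" by (simp only: card.empty)
    have "t \<noteq> 0"
    proof
      assume "t = 0"
      then have "[0\<^sup>2 = t] (mod int p)" by simp
      then show False using False unfolding QuadRes_def by blast
    qed
    then have "\<not> int p dvd t" using assms(3) zdvd_imp_le by force
    then have "Legendre t (int p) = -1" using False by (simp add: Legendre_def cong_0_iff)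
    then show ?thesis using c by linarith
  next
    case True
    then obtain y0 where y0: "[y0\<^sup>2 = t] (mod int p)" by (auto simp: QuadRes_def)
    define y where "y = y0 mod int p"
    have y: "y \<in> {0..<int p}" "y\<^sup>2 mod int p = t" 
      using y0 assms(3) p by (auto simp: y_def power_mod Cong.cong_def)
    define z where "z = (- y) mod int p"
    have z: "z \<in> {0..<int p}" "z\<^sup>2 mod int p = t" "[z = - y] (mod int p)"
      using y p by (auto simp: z_def power_mod)
    have R: "?R = {y, z}"
    proof (intro equalityI subsetI)
      fix s assume s: "s \<in> ?R"
      then have "[s\<^sup>2 = y\<^sup>2] (mod int p)" using y by (auto simp: Cong.cong_def)
      then have "[s = y] (mod int p) \<or> [s = z] (mod int p)" using fact z(3) cong_trans cong_sym by blast
      then show "s \<in> {y, z}" using s y z cong_less_imp_eq_int by auto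
    qed (use y z in auto)
    show ?thesis
    proof (cases "t = 0")
      case True
      then have "int p dvd y\<^sup>2" using y by auto
      then have "int p dvd y" using p(2) prime_dvd_power by blast
      then have "y = 0" using y zdvd_imp_le by force
      then have "z = 0" by (simp add: z_def)
      then show ?thesis using R \<open>y = 0\<close> True by (simp add: Legendre_def)
    next
      case False
      then have "\<not> int p dvd t" using assms(3) zdvd_imp_le by force
      then have L: "Legendre t (int p) = 1" using \<open>QuadRes (int p) t\<close> by (simp add: Legendre_def cong_0_iff)
      have "y \<noteq> z"
      proof
        assume "y = z"
        then have "int p dvd 2 * y" using z(3) by (simp add: cong_iff_dvd_diff)
        then have "int p dvd 2 \<or> int p dvd y" using p(2) by (simp add: prime_dvd_mult_iff)
        moreover have "\<not> int p dvd 2" using p(1) zdvd_imp_le by force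
        ultimately have "int p dvd y\<^sup>2" by (simp add: power2_eq_square)
        then have "t = 0" using y by simp
        then show False using False by simp
      qed
      then show ?thesis using R L by simp
    qed
  qed
qed

text \<open>Grouping by the value t of the square gives the weight 1 + (t | p). The part with weight
  1 is a complete exponential sum, which vanishes as p does not divide a.\<close>

lemma quadratic_sum_prime:
  assumes "prime p" "odd p" "\<not> int p dvd a" shows "quadratic_sum a p = gauss_sum a p"
proof -
  let ?S = "{0..<int p}"
  have p: "p > 0" using assms prime_gt_0_nat by blast
  have "quadratic_sum a p = (\<Sum>s\<in>?S. ee p (a * (s\<^sup>2 mod int p)))"
    unfolding quadratic_sum_def by (intro sum.cong refl ee_cong p cong_scalar_left) simp
  also have "\<dots> = (\<Sum>t\<in>?S. of_nat (card {s\<in>?S. s\<^sup>2 mod int p = t}) * ee p (a * t))"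
    by (rule sum_fun_comp[where f = "\<lambda>t. ee p (a * t)" and g = "\<lambda>s. s\<^sup>2 mod int p"]) (use p in auto)
  also have "\<dots> = (\<Sum>t\<in>?S. ee p (a * t) + of_int (jac t p) * ee p (a * t))"
  proof (intro sum.cong refl)
    fix t assume "t \<in> ?S"
    then have "complex_of_int (int (card {s\<in>?S. s\<^sup>2 mod int p = t})) = 1 + of_int (jac t p)"
      by (subst card_square_roots[OF assms(1,2)]) (auto simp: jac_prime assms)
    then show "of_nat (card {s\<in>?S. s\<^sup>2 mod int p = t}) * ee p (a * t) = ee p (a * t) + of_int (jac t p) * ee p (a * t)"
      by (simp add: algebra_simps)
  qed
  also have "\<dots> = gauss_sum a p" using assms(3) by (simp add: sum.distrib gauss_sum_def sum_ee[OF p])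
  finally show ?thesis .
qed

text \<open>Both sums factor along n = p m. The quadratic sum acquires the frequencies a m and a p,
  the Gauss sum the symbols (m | p) and (p | m), and \<open>gauss_sum_mult\<close> matches the two.
  The sign can thus be determined on the quadratic sum, whose terms are explicit.\<close>

lemma quadratic_sum_eq_gauss_sum:
  assumes "odd n" "squarefree n" "coprime a (int n)" shows "quadratic_sum a n = gauss_sum a n"
  using assms
proof (induction n arbitrary: a rule: odd_induct_prime)
  case one
  have "{0..<1::int} = {0}" by auto
  then show ?case by (simp add: quadratic_sum_def gauss_sum_def)
next
  case (mult p m)
  have pos: "p > 0" "m > 0" using mult prime_gt_0_nat odd_pos by auto
  have sq: "squarefree m" using mult squarefree_multD by blast
  have "\<not> p dvd m"
  proof
    assume "p dvd m"
    then have "p^2 dvd p * m" by (simp add: power2_eq_square)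
    from squarefreeD[OF mult.prems(1) this] show False using mult.hyps(1) by auto
  qed
  then have cop: "coprime p m" using mult.hyps(1) prime_imp_coprime by blast
  have ca: "coprime a (int p)" "coprime a (int m)" using mult.prems by auto
  have npa: "\<not> int p dvd a * int m" 
  proof
    assume "int p dvd a * int m"
    moreover have "coprime (a * int m) (int p)" using ca cop by (simp add: coprime_commute)
    ultimately have "is_unit (int p)"
      using coprime_common_divisor[of "a * int m" "int p" "int p"] by simp
    then show False using mult.hyps(1) by auto
  qed
  have cam: "coprime (a * int p) (int m)" using ca cop by simp
  have "quadratic_sum a (p * m) = (\<Sum>s\<in>{0..<int p}. \<Sum>t\<in>{0..<int m}. ee (p * m) (a * (s * int m + t * int p)\<^sup>2))"
    unfolding quadratic_sum_def
  proof (rule sum_residues_crt[OF pos cop, where F = "\<lambda>t. ee (p * m) (a * t\<^sup>2)"])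
    fix s t assume "[s = t] (mod int (p * m))"
    then have "[a * s\<^sup>2 = a * t\<^sup>2] (mod int (p * m))" by (intro cong_scalar_left cong_pow)
    then show "ee (p * m) (a * s\<^sup>2) = ee (p * m) (a * t\<^sup>2)" using pos by (intro ee_cong) auto
  qed
  also have "\<dots> = (\<Sum>s\<in>{0..<int p}. \<Sum>t\<in>{0..<int m}. ee p (a * int m * s\<^sup>2) * ee m (a * int p * t\<^sup>2))"
  proof (intro sum.cong refl)
    fix s t
    have "ee (p * m) (a * (s * int m + t * int p)\<^sup>2) = ee (p * m) ((a * int m * s\<^sup>2) * int m) * ee (m * p) ((a * int p * t\<^sup>2) * int p) * ee (p * m) (int (p * m) * (2 * a * s * t))"
      by (simp add: ee_add[symmetric] power2_eq_square algebra_simps)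
    then show "ee (p * m) (a * (s * int m + t * int p)\<^sup>2) = ee p (a * int m * s\<^sup>2) * ee m (a * int p * t\<^sup>2)"
      using pos by (simp only: ee_scale ee_multiple mult_pos_pos) simp
  qed
  also have "\<dots> = quadratic_sum (a * int m) p * quadratic_sum (a * int p) m"
    by (simp add: quadratic_sum_def sum_product)
  also have "\<dots> = gauss_sum (a * int m) p * gauss_sum (a * int p) m"
    using quadratic_sum_prime[OF mult.hyps(1,2) npa] mult.IH[OF sq cam] by simp
  also have "\<dots> = (of_int (jac (int m) p) * gauss_sum a p) * (of_int (jac (int p) m) * gauss_sum a m)"
    using gauss_sum_mult[of p "int m" a] gauss_sum_mult[of m "int p" a] mult.hyps cop by (simp add: coprime_commute)
  also have "\<dots> = (\<Sum>s\<in>{0..<int p}. \<Sum>t\<in>{0..<int m}. of_int (jac (s * int m + t * int p) (p * m)) * ee (p * m) (a * (s * int m + t * int p)))"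
  proof -
    have 1: "of_int (jac (int m) p) * gauss_sum a p = (\<Sum>s\<in>{0..<int p}. of_int (jac (int m) p) * (of_int (jac s p) * ee p (a * s)))"
      "of_int (jac (int p) m) * gauss_sum a m = (\<Sum>t\<in>{0..<int m}. of_int (jac (int p) m) * (of_int (jac t m) * ee m (a * t)))"
      by (simp_all only: gauss_sum_def sum_distrib_left)
    show ?thesis unfolding 1 sum_product
  proof (intro sum.cong[OF refl])
    fix s t
    have "jac (s * int m + t * int p) (p * m) = jac (s * int m) p * jac (t * int p) m"
    proof -
      have "[s * int m + t * int p = s * int m] (mod int p)" "[s * int m + t * int p = t * int p] (mod int m)"
        by (simp_all add: cong_iff_dvd_diff)
      from this[THEN jac_cong] show ?thesis by (simp only: jac_mult_right[OF pos])
    qed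
    moreover have "ee (p * m) (a * (s * int m + t * int p)) = ee (p * m) (a * s * int m) * ee (m * p) (a * t * int p)"
      by (simp add: ee_add[symmetric] algebra_simps)
    ultimately show "of_int (jac (int m) p) * (of_int (jac s p) * ee p (a * s)) * (of_int (jac (int p) m) * (of_int (jac t m) * ee m (a * t))) =
       of_int (jac (s * int m + t * int p) (p * m)) * ee (p * m) (a * (s * int m + t * int p))"
      using pos by (simp only: ee_scale jac_mult_left[OF mult.hyps(2)] jac_mult_left[OF mult.hyps(3)]
        jac_mult_right[OF pos]) simp
  qed
  qed
  also have "\<dots> = gauss_sum a (p * m)"
    unfolding gauss_sum_def
  proof (rule sum_residues_crt[OF pos cop, where F = "\<lambda>t. of_int (jac t (p * m)) * ee (p * m) (a * t)", symmetric])
    fix s t assume st: "[s = t] (mod int (p * m))"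
    then have "[a * s = a * t] (mod int (p * m))" by (intro cong_scalar_left)
    then have "ee (p * m) (a * s) = ee (p * m) (a * t)" using pos by (intro ee_cong) auto
    then show "of_int (jac s (p * m)) * ee (p * m) (a * s) = of_int (jac t (p * m)) * ee (p * m) (a * t)"
      using jac_cong[OF st] by simp
  qed
  finally show ?case .
qed

text \<open>Concavity of the sine: on [0, pi] the chord from 0 to y lies below the graph.\<close>

lemma sin_scale_ge:
  assumes "0 \<le> t" "t \<le> 1" "0 \<le> y" "y \<le> pi" shows "t * sin y \<le> sin (t * y)"
proof -
  have "convex_on {0..pi} (\<lambda>x. - sin x)"
  proof (rule f''_ge0_imp_convex[where f' = "\<lambda>x. - cos x" and f'' = "\<lambda>x. sin x"])
    show "((\<lambda>x. - sin x) has_real_derivative - cos x) (at x)" for x :: real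
      by (auto intro!: derivative_eq_intros)
    show "((\<lambda>x. - cos x) has_real_derivative sin x) (at x)" for x :: real
      by (auto intro!: derivative_eq_intros)
    show "sin x \<ge> 0" if "x \<in> {0..pi}" for x :: real
      using that by (intro sin_ge_zero) auto
  qed auto
  then have "- sin ((1 - t) *\<^sub>R 0 + t *\<^sub>R y) \<le> (1 - t) * (- sin 0) + t * (- sin y)"
    by (rule convex_onD) (use assms in auto)
  then show ?thesis by simp
qed

lemma sin_pi_ge: assumes "0 \<le> x" "x \<le> 1/2" shows "2 * x \<le> sin (pi * x)"
  using sin_scale_ge[of "2 * x" "pi / 2"] assms by (simp add: mult.commute)

lemma sin_pi_ge3: assumes "0 \<le> x" "x \<le> 1/6" shows "3 * x \<le> sin (pi * x)"
  using sin_scale_ge[of "6 * x" "pi / 6"] assms by (simp add: sin_30 mult.commute)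

lemma harm_le: assumes "n > 0" shows "harm n \<le> 1 + ln (real n)"
proof -
  obtain m where m: "n = Suc m" using assms gr0_conv_Suc by blast
  have "harm (Suc m) - ln (real (Suc m)) \<le> harm (Suc 0) - ln (real (Suc 0))"
    using decseq_harm_diff_ln by (rule decseqD) simp
  then show ?thesis by (simp add: m harm_expand)
qed

text \<open>Summation by parts, stated for a normed space because it serves both the complex tail of
  the quadratic Gauss sum and the real averages over N, where the variation of f is the price of
  removing a weight.\<close>

lemma abel_bound:
  fixes g :: "nat \<Rightarrow> 'a :: real_normed_vector"
  assumes "a \<le> b" "\<And>t. a \<le> t \<Longrightarrow> t \<le> b \<Longrightarrow> norm (\<Sum>k=a..t. g k) \<le> P"
  shows "norm (\<Sum>k=a..b. f k *\<^sub>R g k) \<le> P * (\<bar>f b\<bar> + (\<Sum>k=a..<b. \<bar>f (Suc k) - f k\<bar>))"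
proof -
  define G where "G t = (\<Sum>k=a..t. g k)" for t
  have eq: "(\<Sum>k=a..b. f k *\<^sub>R g k) = f b *\<^sub>R G b - (\<Sum>k=a..<b. (f (Suc k) - f k) *\<^sub>R G k)"
    using assms(1)
  proof (induction b rule: dec_induct)
    case base
    then show ?case by (simp add: G_def)
  next
    case (step m)
    have "G (Suc m) = G m + g (Suc m)" using step by (simp add: G_def)
    then show ?case using step by (simp add: algebra_simps)
  qed
  have P: "norm (G t) \<le> P" if "a \<le> t" "t \<le> b" for t using assms(2) that by (simp add: G_def)
  have "norm (\<Sum>k=a..b. f k *\<^sub>R g k) \<le> norm (f b *\<^sub>R G b) + norm (\<Sum>k=a..<b. (f (Suc k) - f k) *\<^sub>R G k)"
    unfolding eq by (rule norm_triangle_ineq4)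
  also have "norm (f b *\<^sub>R G b) \<le> \<bar>f b\<bar> * P"
    using P[of b] assms(1) by (simp add: mult_left_mono)
  also have "norm (\<Sum>k=a..<b. (f (Suc k) - f k) *\<^sub>R G k) \<le> (\<Sum>k=a..<b. \<bar>f (Suc k) - f k\<bar> * P)"
    by (rule sum_norm_le) (use P in \<open>auto intro!: mult_left_mono\<close>)
  finally show ?thesis by (simp add: sum_distrib_left algebra_simps)
qed

lemma cis_half_angle: "cis (x + y) - cis (x - y) = 2 * \<i> * of_real (sin y) * cis x"
  by (simp add: complex_eq_iff cos_add cos_diff sin_add sin_diff)

text \<open>Up to the factor \<open>w j\<close>, each term is the difference of the consecutive unit
  numbers \<open>v (Suc j)\<close> and \<open>v j\<close>. As \<open>w\<close> decreases as long as
  its angle is at most pi / 2, summation by parts leaves only twice the first weight.\<close>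

lemma quadratic_phase_tail:
  fixes N :: nat
  assumes "N > 0" "m \<le> J" "2 * J + 1 \<le> N"
  shows "norm (\<Sum>j=m..J. cis (pi * (1/4 + (real j + 1/2)\<^sup>2 / N))) \<le> 1 / sin (pi * (real m + 1/2) / N)"
proof -
  define v where "v j = cis (pi * (1/4 + (real j ^ 2 - 1/4) / N))" for j
  define w where "w j = 1 / (2 * sin (pi * (real j + 1/2) / N))" for j
  have ang: "0 < pi * (real j + 1/2) / N" "pi * (real j + 1/2) / N \<le> pi / 2" if "j \<le> J" for j
  proof -
    show "0 < pi * (real j + 1/2) / N" using assms by (simp add: add_nonneg_pos)
    have "real j + 1/2 \<le> real N / 2" using that assms by linarith
    then have "pi * (real j + 1/2) / N \<le> pi * (real N / 2) / N" by (intro divide_right_mono mult_left_mono) auto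
    then show "pi * (real j + 1/2) / N \<le> pi / 2" using assms by simp
  qed
  have pos: "sin (pi * (real j + 1/2) / N) > 0" if "j \<le> J" for j
    using ang[OF that] pi_gt_zero by (intro sin_gt_zero) linarith+
  have dec: "w (Suc j) \<le> w j" if "Suc j \<le> J" for j
  proof -
    have "sin (pi * (real j + 1/2) / N) \<le> sin (pi * (real (Suc j) + 1/2) / N)"
    proof (rule sin_monotone_2pi_le)
      show "- (pi / 2) \<le> pi * (real j + 1/2) / N" using ang[of j] that pi_gt_zero by linarith
      show "pi * (real j + 1/2) / N \<le> pi * (real (Suc j) + 1/2) / N"
        by (intro divide_right_mono mult_left_mono) auto
    qed (use ang[of "Suc j"] that in auto)
    then show ?thesis using pos[of j] that unfolding w_def by (intro divide_left_mono mult_left_mono) auto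
  qed
  have trm: "cis (pi * (1/4 + (real j + 1/2)\<^sup>2 / N)) = w j *\<^sub>R (- \<i> * (v (Suc j) - v j))" if "j \<le> J" for j
  proof -
    let ?x = "pi * (1/4 + (real j + 1/2)\<^sup>2 / N)" and ?y = "pi * (real j + 1/2) / N"
    have "v (Suc j) = cis (?x + ?y)" "v j = cis (?x - ?y)"
      unfolding v_def using assms(1) by (auto intro!: arg_cong[where f = cis] simp: field_simps power2_eq_square)
    then have "v (Suc j) - v j = 2 * \<i> * of_real (sin ?y) * cis ?x" by (simp add: cis_half_angle)
    then show ?thesis using pos[OF that] by (simp add: w_def scaleR_conv_of_real field_simps)
  qed
  have ps: "norm (\<Sum>k=m..t. - \<i> * (v (Suc k) - v k)) \<le> 2" if "m \<le> t" for t
  proof -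
    have "(\<Sum>k=m..t. - \<i> * (v (Suc k) - v k)) = - \<i> * (\<Sum>k=m..t. v (Suc k) - v k)" by (simp only: sum_distrib_left)
    also have "(\<Sum>k=m..t. v (Suc k) - v k) = v (Suc t) - v m" using that by (simp add: sum_Suc_diff)
    finally have "norm (\<Sum>k=m..t. - \<i> * (v (Suc k) - v k)) = norm (v (Suc t) - v m)" by (simp add: norm_mult)
    also have "\<dots> \<le> norm (v (Suc t)) + norm (v m)" by (rule norm_triangle_ineq4)
    finally show ?thesis by (simp add: v_def)
  qed
  have tv: "(\<Sum>k=m..<J. \<bar>w (Suc k) - w k\<bar>) = w m - w J"
  proof -
    have "(\<Sum>k=m..<J. \<bar>w (Suc k) - w k\<bar>) = (\<Sum>k=m..<J. - (w (Suc k) - w k))"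
    proof (intro sum.cong refl)
      fix k assume "k \<in> {m..<J}"
      then have "w (Suc k) \<le> w k" by (intro dec) auto
      then show "\<bar>w (Suc k) - w k\<bar> = - (w (Suc k) - w k)" by simp
    qed
    also have "\<dots> = - (\<Sum>k=m..<J. w (Suc k) - w k)" by (simp only: sum_negf)
    also have "\<dots> = w m - w J" using assms(2) by (simp add: sum_Suc_diff')
    finally show ?thesis .
  qed
  have "(\<Sum>j=m..J. cis (pi * (1/4 + (real j + 1/2)\<^sup>2 / N))) = (\<Sum>j=m..J. w j *\<^sub>R (- \<i> * (v (Suc j) - v j)))"
    by (intro sum.cong refl trm) auto
  also have "norm \<dots> \<le> 2 * (\<bar>w J\<bar> + (\<Sum>k=m..<J. \<bar>w (Suc k) - w k\<bar>))"
    by (rule abel_bound[OF assms(2)]) (rule ps)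
  also have "\<dots> = 2 * w m" using pos[of J] by (simp add: tv) (simp add: w_def)
  finally show ?thesis by (simp add: w_def)
qed

text \<open>The frequency is the inverse of 2 modulo N. The reflection of t to N - t folds the sum
  to half of the residues, and counting from the middle, t = (N - 1) / 2 - j, makes the phase vary
  slowly for small j.\<close>

lemma quadratic_sum_half:
  assumes "N mod 16 = 7" shows "quadratic_sum ((int N + 1) div 2) N = 2 * (\<Sum>j=0..(N-1) div 2. cis (pi * (1/4 + (real j + 1/2)\<^sup>2 / N))) - 1"
proof -
  define k where "k = N div 16"
  have N: "N = 16 * k + 7" using assms mult_div_mod_eq[of 16 N] unfolding k_def by simp
  define J where "J = 8 * k + 3"
  have J: "(N - 1) div 2 = J" unfolding N J_def by simp
  have a: "(int N + 1) div 2 = 8 * int k + 4" unfolding N by simp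
  let ?f = "\<lambda>t. ee N ((8 * int k + 4) * t\<^sup>2)"
  have N0: "N > 0" using N by simp
  have f: "?f (int (J - j)) = cis (pi * (1/4 + (real j + 1/2)\<^sup>2 / N))" if "j \<le> J" for j
  proof -
    define t where "t = int (J - j)"
    have t: "t = 8 * int k + 3 - int j" unfolding t_def J_def using that by (simp add: J_def of_nat_diff)
    \<comment> \<open>Expanding t = N/2 - (j + 1/2) in pi (N + 1) t^2 / N leaves pi times this
      integer plus the stated phase. As it is even, it contributes whole turns only.\<close>
    have "even (t\<^sup>2 + 4 * int k + 1 - int j)" unfolding t by (simp add: power2_eq_square)
    then obtain m where m: "t\<^sup>2 + 4 * int k + 1 - int j = 2 * m" by (elim evenE)
    have rt: "real_of_int t = 8 * real k + 3 - real j" unfolding t by simp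
    have rm: "real_of_int m = ((8 * real k + 3 - real j)\<^sup>2 + 4 * real k + 1 - real j) / 2"
      using arg_cong[OF m, of real_of_int] by (simp add: rt)
    have rN: "real N = 16 * real k + 7" unfolding N by simp
    have "2 * (8 * real k + 4) * (8 * real k + 3 - real j)\<^sup>2 / (16 * real k + 7) 
       = (1/4 + (real j + 1/2)\<^sup>2 / (16 * real k + 7)) + ((8 * real k + 3 - real j)\<^sup>2 + 4 * real k + 1 - real j)"
      by (simp add: divide_simps add_nonneg_eq_0_iff) (simp add: power2_eq_square algebra_simps)
    moreover have "2 * pi * real_of_int ((8 * int k + 4) * t\<^sup>2) / real N = pi * (2 * (8 * real k + 4) * (8 * real k + 3 - real j)\<^sup>2 / (16 * real k + 7))"
      unfolding rN by (simp add: rt)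
    ultimately have "2 * pi * real_of_int ((8 * int k + 4) * t\<^sup>2) / real N = pi * (1/4 + (real j + 1/2)\<^sup>2 / N) + 2 * pi * real_of_int m"
      unfolding rN rm by (simp only: distrib_left)
    then show ?thesis unfolding ee_def t_def[symmetric] by (simp add: cis_mult[symmetric] cis_multiple_2pi)
  qed
  have sym: "?f (int N - t) = ?f t" for t
  proof (rule ee_cong[OF N0])
    have "(int N - t)\<^sup>2 - t\<^sup>2 = int N * (int N - 2 * t)" by (simp add: power2_eq_square algebra_simps)
    then have "[(int N - t)\<^sup>2 = t\<^sup>2] (mod int N)" by (simp add: cong_iff_dvd_diff)
    then show "[(8 * int k + 4) * (int N - t)\<^sup>2 = (8 * int k + 4) * t\<^sup>2] (mod int N)" by (rule cong_scalar_left)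
  qed
  have split: "{0..<int N} = {0..int J} \<union> {int J + 1..<int N}" using N J_def by auto
  have "quadratic_sum ((int N + 1) div 2) N = (\<Sum>t\<in>{0..int J}. ?f t) + (\<Sum>t\<in>{int J + 1..<int N}. ?f t)"
    unfolding quadratic_sum_def a split by (rule sum.union_disjoint) auto
  also have "(\<Sum>t\<in>{int J + 1..<int N}. ?f t) = (\<Sum>t\<in>{1..int J}. ?f t)"
    by (rule sum.reindex_bij_witness[of _ "\<lambda>t. int N - t" "\<lambda>t. int N - t"]) (use sym N J_def in auto)
  \<comment> \<open>The residue 0 has no mirror image, so doubling counts it once too often.\<close>
  also have "\<dots> = (\<Sum>t\<in>{0..int J}. ?f t) - 1"
  proof -
    have "{0..int J} = insert 0 {1..int J}" by auto
    then show ?thesis by simp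
  qed
  also have "(\<Sum>t\<in>{0..int J}. ?f t) = (\<Sum>j=0..J. cis (pi * (1/4 + (real j + 1/2)\<^sup>2 / N)))"
  proof -
    have "{0..int J} = (\<lambda>j. int (J - j)) ` {0..J}"
    proof (intro equalityI subsetI)
      fix t assume "t \<in> {0..int J}"
      then show "t \<in> (\<lambda>j. int (J - j)) ` {0..J}" by (intro image_eqI[of _ _ "J - nat t"]) auto
    qed auto
    moreover have "inj_on (\<lambda>j. int (J - j)) {0..J}" by (auto simp: inj_on_def)
    ultimately have "(\<Sum>t\<in>{0..int J}. ?f t) = (\<Sum>j\<in>{0..J}. ?f (int (J - j)))" by (simp only: sum.reindex o_def)
    also have "\<dots> = (\<Sum>j=0..J. cis (pi * (1/4 + (real j + 1/2)\<^sup>2 / N)))" by (intro sum.cong refl f) auto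
    finally show ?thesis .
  qed
  finally show ?thesis unfolding J by simp
qed

text \<open>The argument of Estermann: among the terms of the quadratic Gauss sum those with a short
  phase have non-negative imaginary part and the others nearly telescope, so that the imaginary
  part exceeds \<open>- sqrt N\<close>.\<close>
lemma Im_quadratic_sum_half:
  assumes N: "N mod 16 = 7" and "N \<ge> 100"
  shows "- sqrt (real N) < Im (quadratic_sum ((int N + 1) div 2) N)"
proof -
  define s where "s = sqrt (real N)"
  have s: "s \<ge> 10" "s * s = real N" unfolding s_def using assms by (auto intro!: real_le_rsqrt)
  define J where "J = (N - 1) div 2"
  \<comment> \<open>For j < m the phase pi (1/4 + (j + 1/2)^2 / N) stays within [0, pi], so that
    these terms have non-negative imaginary part.\<close>
  define m where "m = nat \<lfloor>sqrt (3/4 * real N)\<rfloor>"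
  let ?u = "\<lambda>j. cis (pi * (1/4 + (real j + 1/2)\<^sup>2 / N))"
  have "real m = of_int \<lfloor>sqrt (3/4 * real N)\<rfloor>" unfolding m_def by simp
  then have m: "real m \<le> sqrt (3/4 * real N)" "sqrt (3/4 * real N) - 1 \<le> real m" by linarith+
  \<comment> \<open>Decimal bounds for sqrt 3 / 2.\<close>
  have "sqrt (3/4 * real N) \<le> 0.87 * s" "0.86 * s \<le> sqrt (3/4 * real N)"
    using s(1) unfolding s(2)[symmetric] by (intro real_le_lsqrt real_le_rsqrt; simp add: power2_eq_square)+
  then have ms: "real m \<le> 0.87 * s" "0.86 * s - 1 \<le> real m" using m by linarith+
  have s10: "10 * s \<le> real N" unfolding s(2)[symmetric] using s(1) by (intro mult_right_mono) auto
  have "2 * real m + 1 \<le> real N" using ms(1) s10 s(1) by simp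
  then have "2 * m + 1 \<le> N" by linarith
  then have mJ: "m \<le> J" unfolding J_def by simp
  have J2: "2 * J + 1 \<le> N" unfolding J_def using assms by linarith
  have "{0..J} = {0..<m} \<union> {m..J}" using mJ by auto
  then have split: "(\<Sum>j=0..J. ?u j) = (\<Sum>j=0..<m. ?u j) + (\<Sum>j=m..J. ?u j)"
    by (simp add: sum.union_disjoint ivl_disj_int)
  have "Im (\<Sum>j=0..<m. ?u j) \<ge> 0"
    unfolding Im_sum
  proof (rule sum_nonneg)
    fix j assume "j \<in> {0..<m}"
    then have "real j + 1/2 \<le> sqrt (3/4 * real N)" using m(1) by (auto simp: less_eq_real_def)
    then have "(real j + 1/2)\<^sup>2 \<le> (sqrt (3/4 * real N))\<^sup>2" by (intro power_mono) auto
    then have "(real j + 1/2)\<^sup>2 \<le> 3/4 * real N" by simp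
    then have "(real j + 1/2)\<^sup>2 / N \<le> 3/4" using assms(2) by (simp add: pos_divide_le_eq)
    then have "1/4 + (real j + 1/2)\<^sup>2 / N \<le> 1" by linarith
    then have "pi * (1/4 + (real j + 1/2)\<^sup>2 / N) \<le> pi * 1" by (intro mult_left_mono) auto
    then show "0 \<le> Im (?u j)" by (auto intro!: sin_ge_zero)
  qed
  moreover have "norm (\<Sum>j=m..J. ?u j) \<le> 1 / sin (pi * (real m + 1/2) / N)"
    by (rule quadratic_phase_tail) (use assms mJ J2 in auto)
  \<comment> \<open>The tail enters doubled, so it has to stay below s / 2. The slope 2 of
    \<open>sin_pi_ge\<close> would give about s / 1.72, too much. The slope 3, valid up to 1/6,
    gives about s / 2.58.\<close>
  moreover have "1 / sin (pi * (real m + 1/2) / N) < (s - 1) / 2"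
  proof -
    define z where "z = (real m + 1/2) / N"
    have "z \<le> 1/6" unfolding z_def using ms(1) s10 s(1) assms(2) by (simp add: pos_divide_le_eq)
    moreover have "z \<ge> 0" unfolding z_def by simp
    ultimately have sz: "3 * z \<le> sin (pi * z)" by (intro sin_pi_ge3)
    have "(0.86 * s - 1/2) / (s * s) \<le> z" unfolding z_def s(2) using ms(2) by (intro divide_right_mono) auto
    then have z1: "3 * ((0.86 * s - 1/2) / (s * s)) \<le> sin (pi * z)" using sz by linarith
    have p: "(0.86 * s - 1/2) / (s * s) > 0" using s(1) by (intro divide_pos_pos) auto
    have "1 / sin (pi * z) \<le> 1 / (3 * ((0.86 * s - 1/2) / (s * s)))"
    proof (rule divide_left_mono)
      have "0 < sin (pi * z)" using z1 p by linarith
      then show "0 < sin (pi * z) * (3 * ((0.86 * s - 1/2) / (s * s)))" using p by (intro mult_pos_pos) auto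
    qed (use z1 in auto)
    also have "\<dots> = (s * s) / (2.58 * s - 1.5)" using s(1) by (simp add: field_simps)
    also have "\<dots> < (s - 1) / 2"
    proof -
      have "10 * s \<le> s * s" using s(1) by (intro mult_right_mono) auto
      then have "100 * (s * s) < 129 * (s * s) - 204 * s + 75" using s(1) by linarith
      then have "s * s < (s - 1) / 2 * (2.58 * s - 1.5)" by (simp add: field_simps)
      then show ?thesis using s(1) by (subst pos_divide_less_eq) auto
    qed
    finally show ?thesis by (simp add: z_def)
  qed
  moreover have "Im (\<Sum>j=m..J. ?u j) \<ge> - norm (\<Sum>j=m..J. ?u j)"
    using abs_Im_le_cmod[of "\<Sum>j=m..J. ?u j"] by linarith
  ultimately have "Im (\<Sum>j=0..J. ?u j) > - ((s - 1) / 2)"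
    unfolding split plus_complex.sel by linarith
  moreover have "quadratic_sum ((int N + 1) div 2) N = 2 * (\<Sum>j=0..J. ?u j) - 1"
    using quadratic_sum_half[OF N] unfolding J_def .
  moreover have "Im (2 * z - 1) = 2 * Im z" for z by simp
  ultimately have "Im (quadratic_sum ((int N + 1) div 2) N) = 2 * Im (\<Sum>j=0..J. ?u j)" by (simp only:)
  with \<open>Im (\<Sum>j=0..J. ?u j) > - ((s - 1) / 2)\<close> have "- s < Im (quadratic_sum ((int N + 1) div 2) N)" by argo
  then show ?thesis unfolding s_def .
qed

text \<open>As (-1 | N) = -1, the Gauss sum is purely imaginary of modulus sqrt N. It equals the
  quadratic sum at (N + 1) / 2, because ((N + 1) / 2 | N) = 1, and
  \<open>Im_quadratic_sum_half\<close> excludes the negative value.\<close>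

lemma gauss_sum_sign:
  assumes "N mod 16 = 7" "squarefree N" "N \<ge> 100"
  shows "gauss_sum 1 N = \<i> * of_real (sqrt (real N))"
proof -
  have o: "odd N" "N mod 4 = 3" using assms mod16_7D by auto
  define a where "a = (int N + 1) div 2"
  have a: "2 * a = int N + 1" unfolding a_def using o(1) by (intro dvd_mult_div_cancel) simp
  have c: "coprime a (int N)"
  proof (rule coprimeI)
    fix d assume "d dvd a" "d dvd int N"
    then have "d dvd 2 * a - int N" by auto
    then show "is_unit d" using a by simp
  qed
  have "jac (2 * a) N = jac 1 N" unfolding a by (rule jac_cong) (simp add: cong_iff_dvd_diff)
  then have ja: "jac a N = 1" using jac_2 assms by (simp add: jac_mult_left[OF o(1)])
  have "quadratic_sum a N = gauss_sum 1 N" using quadratic_sum_eq_gauss_sum[OF o(1) _ c] gauss_sum_eq[OF o(1), of a] assms ja by simp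
  then have im: "- sqrt (real N) < Im (gauss_sum 1 N)" using Im_quadratic_sum_half[of N] assms unfolding a_def by simp
  have "cnj (gauss_sum 1 N) = gauss_sum (-1) N" by (simp add: gauss_sum_def cnj_ee)
  also have "\<dots> = - gauss_sum 1 N" using gauss_sum_eq[OF o(1), of "-1"] jac_minus_one[OF o(1)] o(2) assms by simp
  finally have re: "Re (gauss_sum 1 N) = 0" by (simp add: complex_eq_iff)
  have "norm (gauss_sum 1 N) = sqrt (real N)" using norm_gauss_sum[OF o(1)] assms by blast
  then have "\<bar>Im (gauss_sum 1 N)\<bar> = sqrt (real N)" using re by (simp add: cmod_eq_Im)
  then have "Im (gauss_sum 1 N) = sqrt (real N)" using im by linarith
  then show "gauss_sum 1 N = \<i> * of_real (sqrt (real N))" using re by (simp add: complex_eq_iff)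
qed

lemma sin_transform:
  assumes "N mod 16 = 7" "squarefree N" "N \<ge> 100"
  shows "(\<Sum>t\<in>{0..<int N}. real_of_int (jac t N) * sin (2 * pi * real_of_int (a * t) / N)) = real_of_int (jac a N) * sqrt (real N)"
proof -
  have "gauss_sum a N = of_int (jac a N) * (\<i> * of_real (sqrt (real N)))"
    using gauss_sum_eq[of N a] mod16_7D[of N] gauss_sum_sign[OF assms] assms by simp
  then have "Im (gauss_sum a N) = real_of_int (jac a N) * sqrt (real N)" by simp
  moreover have "Im (gauss_sum a N) = (\<Sum>t\<in>{0..<int N}. real_of_int (jac t N) * sin (2 * pi * real_of_int (a * t) / N))"
    by (simp add: gauss_sum_def ee_def Im_sum)
  ultimately show ?thesis by simp
qed

section \<open>Character sums in arithmetic progressions\<close>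

text \<open>Multiplication by \<open>ee n s - 1\<close>, whose modulus is twice the sine, telescopes
  the geometric series to two numbers of modulus 1.\<close>

lemma norm_sum_ee_le:
  assumes "0 < s" "s < int n"
  shows "norm (\<Sum>j\<in>{a..b}. ee n (s * j)) \<le> 1 / sin (pi * real_of_int s / n)"
proof -
  let ?x = "pi * real_of_int s / n"
  have sp: "sin ?x > 0"
  proof (rule sin_gt_zero)
    have "real_of_int s < real n" using assms by linarith
    then have "pi * real_of_int s < pi * real n" by (intro mult_strict_left_mono) auto
    then show "?x < pi" using assms by (simp add: pos_divide_less_eq)
  qed (use assms in auto)
  have "ee n s - 1 = cis (?x + ?x) - cis (?x - ?x)" by (simp add: ee_def mult.assoc)
  also have "\<dots> = 2 * \<i> * of_real (sin ?x) * cis ?x" by (rule cis_half_angle)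
  finally have n1: "norm (ee n s - 1) = 2 * sin ?x" using sp by (simp add: norm_mult)
  have "norm ((ee n s - 1) * (\<Sum>j\<in>{a..b}. ee n (s * j))) \<le> 2"
  proof (cases "a \<le> b + 1")
    case True
    have "(ee n s - 1) * (\<Sum>j\<in>{a..b}. ee n (s * j)) = ee n (s * (b + 1)) - ee n (s * a)"
      using True
    proof (induction "b + 1" arbitrary: b rule: int_ge_induct)
      case base
      then show ?case by simp
    next
      case (step i)
      have b: "b = i" using step by simp
      have "{a..b} = insert b {a..b-1}" using step by auto
      then have "(\<Sum>j\<in>{a..b}. ee n (s * j)) = ee n (s * b) + (\<Sum>j\<in>{a..b-1}. ee n (s * j))" by simp
      moreover have "(ee n s - 1) * (\<Sum>j\<in>{a..b-1}. ee n (s * j)) = ee n (s * b) - ee n (s * a)"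
        using step(2)[of "b - 1"] b by simp
      ultimately show ?case by (simp add: algebra_simps ee_add)
    qed
    also have "norm \<dots> \<le> norm (ee n (s * (b + 1))) + norm (ee n (s * a))" by (rule norm_triangle_ineq4)
    finally show ?thesis by simp
  qed auto
  then have "2 * sin ?x * norm (\<Sum>j\<in>{a..b}. ee n (s * j)) \<le> 2" by (simp add: norm_mult n1)
  then show ?thesis using sp by (simp add: field_simps)
qed

text \<open>The summand is at most n / (2 t), where t is the distance from s to the nearer end of
  the range. Adding the bounds for both ends avoids splitting the sum and produces two harmonic
  sums.\<close>

lemma sum_inverse_sin_le:
  assumes "n > 1"
  shows "(\<Sum>s\<in>{1..<int n}. 1 / sin (pi * real_of_int s / n)) \<le> real n * (1 + ln (real n))"
proof -
  have "1 / sin (pi * real_of_int s / n) \<le> real n / 2 * (1 / real_of_int s) + real n / 2 * (1 / real_of_int (int n - s))"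
    if s: "s \<in> {1..<int n}" for s
  proof -
    have *: "1 / sin (pi * real_of_int t / n) \<le> real n / 2 * (1 / real_of_int t)" if t: "0 < t" "2 * t \<le> int n" for t
    proof -
      have "2 * (real_of_int t / n) \<le> sin (pi * (real_of_int t / n))"
        using t assms by (intro sin_pi_ge) (auto simp: field_simps)
      moreover have "0 < 2 * (real_of_int t / n)" using t assms by simp
      ultimately have "1 / sin (pi * (real_of_int t / n)) \<le> 1 / (2 * (real_of_int t / n))"
        by (intro divide_left_mono mult_pos_pos) auto
      then show ?thesis by simp
    qed
    show ?thesis
    proof (cases "2 * s \<le> int n")
      case True
      then show ?thesis using *[of s] s by (smt (verit) atLeastLessThan_iff divide_nonneg_nonneg mult_nonneg_nonneg of_int_nonneg of_nat_0_le_iff)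
    next
      case False
      have "pi * real_of_int (int n - s) / n = pi - pi * real_of_int s / n"
        using assms by (simp add: field_simps)
      then have "sin (pi * real_of_int (int n - s) / n) = sin (pi * real_of_int s / n)" by simp
      then have "1 / sin (pi * real_of_int s / n) \<le> real n / 2 * (1 / real_of_int (int n - s))"
        using *[of "int n - s"] False s by (simp only:) simp
      moreover have "0 \<le> real n / 2 * (1 / real_of_int s)" using s by simp
      ultimately show ?thesis by linarith
    qed
  qed
  then have "(\<Sum>s\<in>{1..<int n}. 1 / sin (pi * real_of_int s / n)) \<le>
     (\<Sum>s\<in>{1..<int n}. real n / 2 * (1 / real_of_int s) + real n / 2 * (1 / real_of_int (int n - s)))"
    by (rule sum_mono)
  also have "\<dots> = real n / 2 * (\<Sum>s\<in>{1..<int n}. 1 / real_of_int s) + real n / 2 * (\<Sum>s\<in>{1..<int n}. 1 / real_of_int (int n - s))"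
    by (simp only: sum.distrib sum_distrib_left)
  also have "(\<Sum>s\<in>{1..<int n}. 1 / real_of_int (int n - s)) = (\<Sum>s\<in>{1..<int n}. 1 / real_of_int s)"
    by (rule sum.reindex_bij_witness[of _ "\<lambda>s. int n - s" "\<lambda>s. int n - s"]) auto
  also have "(\<Sum>s\<in>{1..<int n}. 1 / real_of_int s) = harm (n - 1)"
    unfolding harm_def
    by (rule sum.reindex_bij_witness[of _ int nat]) (auto simp: inverse_eq_divide)
  also have "real n / 2 * harm (n - 1) + real n / 2 * harm (n - 1) = real n * harm (n - 1)" by simp
  also have "\<dots> \<le> real n * (1 + ln (real n))"
  proof (intro mult_left_mono)
    have "harm (n - 1) \<le> 1 + ln (real (n - 1))" using assms by (intro harm_le) simp
    also have "\<dots> \<le> 1 + ln (real n)" using assms by simp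
    finally show "harm (n - 1) \<le> 1 + ln (real n)" .
  qed simp
  finally show ?thesis .
qed

lemma coprime_inverse_int:
  assumes "coprime d n" shows "\<exists>e. [d * e = 1] (mod (n::int))"
  using cong_solve_coprime_int[OF assms] by blast

definition pv_bound :: "nat \<Rightarrow> real" where "pv_bound n = sqrt (real n) * (1 + ln (real n))"

lemma pv_bound_nonneg: "n \<ge> 1 \<Longrightarrow> pv_bound n \<ge> 0" by (simp add: pv_bound_def)

lemma le_div_iff_int: "0 < d \<Longrightarrow> j \<le> x div d \<longleftrightarrow> d * j \<le> (x::int)"
proof
  assume "0 < d" "j \<le> x div d"
  then have "d * j \<le> d * (x div d)" by (intro mult_left_mono) auto
  also have "\<dots> \<le> x" using \<open>0 < d\<close> mult_div_mod_eq[of d x] pos_mod_sign[of d x] by linarith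
  finally show "d * j \<le> x" .
next
  assume "0 < d" "d * j \<le> x"
  then show "j \<le> x div d" using zdiv_mono1[of "d * j" x d] by simp
qed

lemma arith_prog_image:
  fixes d :: int
  assumes "d > 0"
  shows "{t\<in>{lo..hi}. [t = c] (mod d)} = (\<lambda>j. c + d * j) ` {- ((c - lo) div d)..(hi - c) div d}"
proof (intro equalityI subsetI)
  fix t assume "t \<in> {t\<in>{lo..hi}. [t = c] (mod d)}"
  then have t: "lo \<le> t" "t \<le> hi" "d dvd t - c" by (auto simp: cong_iff_dvd_diff)
  then obtain j where j: "t = c + d * j" by (metis add_diff_cancel_left' dvdE diff_add_cancel add.commute)
  then show "t \<in> (\<lambda>j. c + d * j) ` {- ((c - lo) div d)..(hi - c) div d}"
    using t by (intro image_eqI[of _ _ j]) (auto simp: le_div_iff_int[OF assms] minus_le_iff[of _ j])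
next
  fix t assume "t \<in> (\<lambda>j. c + d * j) ` {- ((c - lo) div d)..(hi - c) div d}"
  then obtain j where j: "t = c + d * j" "j \<in> {- ((c - lo) div d)..(hi - c) div d}" by (rule imageE)
  then have "- j \<le> (c - lo) div d" "j \<le> (hi - c) div d" by auto
  then show "t \<in> {t\<in>{lo..hi}. [t = c] (mod d)}"
    using j(1) by (auto simp: cong_iff_dvd_diff le_div_iff_int[OF assms])
qed

text \<open>The character is expanded through its Gauss sum and the sums are interchanged, which
  leaves geometric series. The common difference d is removed by its inverse modulo n, so the bound
  does not depend on d.\<close>

lemma polya_vinogradov_squarefree:
  assumes "odd n" "squarefree n" "n > 1" "d > 0" "coprime d (int n)"
  shows "\<bar>\<Sum>t\<in>{t\<in>{lo..hi}. [t = c] (mod d)}. real_of_int (jac t n)\<bar> \<le> pv_bound n"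
proof -
  have n: "n > 0" using assms by simp
  let ?I = "{- ((c - lo) div d)..(hi - c) div d}"
  obtain e where e: "[d * e = 1] (mod int n)" using coprime_inverse_int[OF assms(5)] by blast
  have ce: "coprime e (int n)"
  proof (rule coprimeI)
    fix x assume "x dvd e" "x dvd int n"
    then have "x dvd d * e" "x dvd d * e - 1" using e by (auto simp: cong_iff_dvd_diff intro: dvd_trans)
    then have "x dvd d * e - (d * e - 1)" by (rule dvd_diff)
    then show "is_unit x" by simp
  qed
  have je: "jac e n * jac e n = 1" using jac_sq_1[OF n ce] .
  have inj: "inj_on (\<lambda>j. c + d * j) ?I" using assms(4) by (auto simp: inj_on_def)
  let ?A = "\<Sum>j\<in>?I. complex_of_int (jac (c + d * j) n)"
  have Aeq: "(\<Sum>t\<in>{t\<in>{lo..hi}. [t = c] (mod d)}. real_of_int (jac t n)) = (\<Sum>j\<in>?I. real_of_int (jac (c + d * j) n))"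
    unfolding arith_prog_image[OF assms(4)] by (simp add: sum.reindex[OF inj])
  \<comment> \<open>The symbol is expanded at e (c + d j) instead of c + d j, with d e = 1 modulo n.
    The phase in j becomes s j / n, and the correction is the sign (e | n).\<close>
  have gsj: "complex_of_int (jac (c + d * j) n) * gauss_sum 1 n = of_int (jac e n) * (\<Sum>s\<in>{0..<int n}. of_int (jac s n) * (ee n (s * e * c) * ee n (s * j)))" for j
  proof -
    have "gauss_sum (e * (c + d * j)) n = of_int (jac e n * jac (c + d * j) n) * gauss_sum 1 n"
      using gauss_sum_eq[OF assms(1,2), of "e * (c + d * j)"] by (simp add: jac_mult_left[OF assms(1)])
    then have "complex_of_int (jac (c + d * j) n) * gauss_sum 1 n = of_int (jac e n * jac e n) * of_int (jac (c + d * j) n) * gauss_sum 1 n"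
      by (simp add: je)
    also have "\<dots> = of_int (jac e n) * gauss_sum (e * (c + d * j)) n"
      using gauss_sum_eq[OF assms(1,2), of "e * (c + d * j)"] by (simp add: jac_mult_left[OF assms(1)])
    also have "gauss_sum (e * (c + d * j)) n = (\<Sum>s\<in>{0..<int n}. of_int (jac s n) * (ee n (s * e * c) * ee n (s * j)))"
      unfolding gauss_sum_def
    proof (intro sum.cong refl arg_cong2[where f = times])
      fix s
      have "[s * e * c + (d * e) * (s * j) = s * e * c + 1 * (s * j)] (mod int n)"
        by (intro cong_add cong_mult e) auto
      then have "ee n (s * e * c + (d * e) * (s * j)) = ee n (s * e * c + 1 * (s * j))" by (rule ee_cong[OF n])
      moreover have "e * (c + d * j) * s = s * e * c + (d * e) * (s * j)" by (simp add: algebra_simps)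
      ultimately show "ee n (e * (c + d * j) * s) = ee n (s * e * c) * ee n (s * j)" by (simp add: ee_add)
    qed
    finally show ?thesis .
  qed
  have "?A * gauss_sum 1 n = of_int (jac e n) * (\<Sum>j\<in>?I. \<Sum>s\<in>{0..<int n}. of_int (jac s n) * (ee n (s * e * c) * ee n (s * j)))"
    unfolding sum_distrib_right gsj by (simp only: sum_distrib_left)
  also have "(\<Sum>j\<in>?I. \<Sum>s\<in>{0..<int n}. of_int (jac s n) * (ee n (s * e * c) * ee n (s * j))) =
     (\<Sum>s\<in>{0..<int n}. of_int (jac s n) * ee n (s * e * c) * (\<Sum>j\<in>?I. ee n (s * j)))"
    by (subst sum.swap) (simp add: sum_distrib_left mult.assoc)
  also have "\<dots> = (\<Sum>s\<in>{1..<int n}. of_int (jac s n) * ee n (s * e * c) * (\<Sum>j\<in>?I. ee n (s * j)))"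
  proof -
    have "{0..<int n} = insert 0 {1..<int n}" using n by auto
    moreover have "jac 0 n = 0" using assms(3) by (simp add: jac_eq_0_iff)
    ultimately show ?thesis by simp
  qed
  finally have "norm (?A * gauss_sum 1 n) = norm (of_int (jac e n) * (\<Sum>s\<in>{1..<int n}. of_int (jac s n) * ee n (s * e * c) * (\<Sum>j\<in>?I. ee n (s * j))))"
    by simp
  also have "\<dots> \<le> 1 * (\<Sum>s\<in>{1..<int n}. 1 / sin (pi * real_of_int s / n))"
    unfolding norm_mult
  proof (intro mult_mono sum_norm_le)
    show "norm (complex_of_int (jac e n)) \<le> 1" using jac_abs_le by simp
    fix s assume s: "s \<in> {1..<int n}"
    have "norm (of_int (jac s n) * ee n (s * e * c) * (\<Sum>j\<in>?I. ee n (s * j))) = \<bar>real_of_int (jac s n)\<bar> * norm (\<Sum>j\<in>?I. ee n (s * j))"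
      by (simp add: norm_mult)
    also have "\<dots> \<le> 1 * (1 / sin (pi * real_of_int s / n))"
      by (intro mult_mono jac_abs_le norm_sum_ee_le) (use s in auto)
    finally show "norm (of_int (jac s n) * ee n (s * e * c) * (\<Sum>j\<in>?I. ee n (s * j))) \<le> 1 / sin (pi * real_of_int s / n)" by simp
  qed auto
  also have "\<dots> \<le> real n * (1 + ln (real n))" using sum_inverse_sin_le[OF assms(3)] by simp
  finally have "norm ?A * sqrt (real n) \<le> real n * (1 + ln (real n))"
    by (simp only: norm_mult norm_gauss_sum[OF assms(1,2)])
  also have "real n * (1 + ln (real n)) = pv_bound n * sqrt (real n)"
    by (simp add: pv_bound_def)
  finally have "norm ?A \<le> pv_bound n" using n by simp
  moreover have "?A = complex_of_real (\<Sum>j\<in>?I. real_of_int (jac (c + d * j) n))" by simp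
  ultimately show ?thesis unfolding Aeq by (metis norm_of_real)
qed

text \<open>The multiples q u of a prime q in a progression modulo d correspond to u in another such
  progression, as q is invertible modulo d. Hence each sieved prime at most doubles the bound. The
  sieve accounts for characters that are not primitive.\<close>

lemma polya_vinogradov:
  assumes "odd n" "squarefree n" "n > 1" "d > 0" "coprime d (int n)"
    "finite S" "\<And>p. p \<in> S \<Longrightarrow> prime p \<and> coprime d (int p)"
  shows "\<bar>\<Sum>t\<in>{t\<in>{lo..hi}. [t = c] (mod d) \<and> (\<forall>p\<in>S. \<not> int p dvd t)}. real_of_int (jac t n)\<bar> \<le> 2 ^ card S * pv_bound n"
  using assms(6,7)
proof (induction S arbitrary: lo hi c rule: finite_induct)
  case empty
  then show ?case using polya_vinogradov_squarefree[OF assms(1-5)] by simp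
next
  case (insert q S)
  let ?A = "\<lambda>lo hi c. {t\<in>{lo..hi}. [t = c] (mod d) \<and> (\<forall>p\<in>S. \<not> int p dvd t)}"
  have q: "prime q" "coprime d (int q)" using insert.prems by auto
  have qp: "int q > 0" using q prime_gt_0_nat by simp
  obtain e where e: "[int q * e = 1] (mod d)" using coprime_inverse_int[of "int q" d] q by (auto simp: coprime_commute)
  have fin: "finite (?A lo hi c)" by (rule finite_subset[of _ "{lo..hi}"]) auto
  have img: "{t\<in>?A lo hi c. int q dvd t} = (\<lambda>t. int q * t) ` (?A (- ((- lo) div int q)) (hi div int q) (e * c))"
  proof (intro equalityI subsetI)
    fix t assume t: "t \<in> {t\<in>?A lo hi c. int q dvd t}"
    then obtain u where u: "t = int q * u" by auto
    have "u \<le> hi div int q" "- u \<le> (- lo) div int q" using t u by (auto simp: le_div_iff_int[OF qp])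
    moreover have "[u = e * c] (mod d)"
    proof -
      have "[e * (int q * u) = e * c] (mod d)" using t u by (intro cong_scalar_left) auto
      moreover have "[(int q * e) * u = 1 * u] (mod d)" by (intro cong_mult e) auto
      ultimately show ?thesis by (metis cong_sym cong_trans mult.assoc mult.commute mult_1)
    qed
    moreover have "\<forall>p\<in>S. \<not> int p dvd u" using t u by auto
    ultimately show "t \<in> (\<lambda>t. int q * t) ` (?A (- ((- lo) div int q)) (hi div int q) (e * c))" using u by auto
  next
    fix t assume "t \<in> (\<lambda>t. int q * t) ` (?A (- ((- lo) div int q)) (hi div int q) (e * c))"
    then obtain u where u0: "t = int q * u" "u \<in> ?A (- ((- lo) div int q)) (hi div int q) (e * c)" by (rule imageE)
    then have u: "t = int q * u" "u \<le> hi div int q" "- u \<le> (- lo) div int q" "[u = e * c] (mod d)" "\<forall>p\<in>S. \<not> int p dvd u"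
      by auto
    then have "lo \<le> t" "t \<le> hi" by (auto simp: le_div_iff_int[OF qp])
    moreover have "[t = c] (mod d)"
    proof -
      have "[int q * u = int q * (e * c)] (mod d)" using u(4) by (rule cong_scalar_left)
      moreover have "[(int q * e) * c = 1 * c] (mod d)" by (intro cong_mult e) auto
      ultimately show ?thesis unfolding u(1) by (metis cong_trans mult.assoc mult_1)
    qed
    moreover have "\<not> int p dvd t" if "p \<in> S" for p
    proof
      assume "int p dvd t"
      moreover have p: "prime (int p)" using insert.prems that by auto
      moreover have "\<not> int p dvd u" using u(5) that by blast
      ultimately have "int p dvd int q" using u(1) prime_dvd_mult_iff by blast
      then have "p = q" using insert.prems(1)[of p] that q primes_dvd_imp_eq[of p q] by auto
      then show False using that insert.hyps by blast
    qed
    ultimately show "t \<in> {t\<in>?A lo hi c. int q dvd t}" using u(1) by auto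
  qed
  have inj: "inj_on (\<lambda>t. int q * t) X" for X using qp by (auto simp: inj_on_def)
  let ?B = "\<Sum>t\<in>?A (- ((- lo) div int q)) (hi div int q) (e * c). real_of_int (jac t n)"
  have "{t\<in>{lo..hi}. [t = c] (mod d) \<and> (\<forall>p\<in>insert q S. \<not> int p dvd t)} = ?A lo hi c - {t\<in>?A lo hi c. int q dvd t}"
    by auto
  then have "(\<Sum>t\<in>{t\<in>{lo..hi}. [t = c] (mod d) \<and> (\<forall>p\<in>insert q S. \<not> int p dvd t)}. real_of_int (jac t n))
     = (\<Sum>t\<in>?A lo hi c. real_of_int (jac t n)) - (\<Sum>t\<in>{t\<in>?A lo hi c. int q dvd t}. real_of_int (jac t n))"
    by (simp only:) (rule sum_diff[OF fin], auto)
  also have "(\<Sum>t\<in>{t\<in>?A lo hi c. int q dvd t}. real_of_int (jac t n)) = real_of_int (jac (int q) n) * ?B"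
    unfolding img by (simp add: sum.reindex[OF inj] jac_mult_left[OF assms(1)] sum_distrib_left)
  finally have eq: "(\<Sum>t\<in>{t\<in>{lo..hi}. [t = c] (mod d) \<and> (\<forall>p\<in>insert q S. \<not> int p dvd t)}. real_of_int (jac t n))
     = (\<Sum>t\<in>?A lo hi c. real_of_int (jac t n)) - real_of_int (jac (int q) n) * ?B" .
  have "\<bar>\<Sum>t\<in>?A lo hi c. real_of_int (jac t n)\<bar> \<le> 2 ^ card S * pv_bound n" "\<bar>?B\<bar> \<le> 2 ^ card S * pv_bound n"
    using insert by auto
  moreover have "\<bar>real_of_int (jac (int q) n) * ?B\<bar> \<le> 1 * \<bar>?B\<bar>"
    unfolding abs_mult by (intro mult_right_mono jac_abs_le) auto
  moreover have "2 ^ card (insert q S) * pv_bound n = 2 * (2 ^ card S * pv_bound n)" using insert by simp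
  ultimately show ?case unfolding eq by linarith
qed

text \<open>The only odd prime below 4 is 3, and the factor 4 on the right pays for it.\<close>

lemma four_power_card_primes_le:
  assumes "finite S" "\<And>p. p \<in> S \<Longrightarrow> prime p \<and> odd (p::nat)"
  shows "4 ^ card S \<le> 4 * \<Prod>S"
proof -
  have *: "4 ^ card F \<le> \<Prod>F" if "finite F" "\<And>p. p \<in> F \<Longrightarrow> p \<ge> 4" for F :: "nat set"
    using that
  proof (induction F rule: finite_induct)
    case (insert x F)
    have "4 * 4 ^ card F \<le> x * \<Prod>F" using insert by (intro mult_le_mono) auto
    then show ?case using insert by simp
  qed simp
  have ge: "p \<ge> 4" if "p \<in> S - {3}" for p
  proof -
    have p: "prime p" "odd p" "p \<noteq> 3" using assms(2) that by auto
    then have "p \<ge> 2" using prime_ge_2_nat by blast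
    moreover have "p \<noteq> 2" using p by auto
    ultimately show ?thesis using p(3) by linarith
  qed
  have a: "4 ^ card (S - {3}) \<le> \<Prod>(S - {3})" by (rule *) (use assms(1) ge in auto)
  show ?thesis
  proof (cases "3 \<in> S")
    case True
    have "card S = Suc (card (S - {3}))" using card.remove[OF assms(1) True] .
    moreover have "\<Prod>S = 3 * \<Prod>(S - {3})" using prod.remove[OF assms(1) True, of id] by simp
    ultimately show ?thesis using a by simp
  qed (use a in simp)
qed

lemma prod_primes_dvd:
  assumes "finite S" "\<And>p. p \<in> S \<Longrightarrow> prime p \<and> p dvd (s::nat)"
  shows "\<Prod>S dvd s"
  using assms
proof (induction S rule: finite_induct)
  case (insert p S)
  have "coprime p (\<Prod>S)"
  proof (rule prod_coprime_right)
    fix q assume "q \<in> S"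
    then show "coprime p q" using insert by (intro primes_coprime) auto
  qed
  then show ?case using insert by (simp add: divides_mult)
qed simp

text \<open>With s the square part of the conductor, this makes the cost of sieving by the primes of
  s at most 2 sqrt s, which is less than the factor s by which the square root of the conductor
  drops.\<close>

lemma two_power_card_primes_le:
  assumes "finite S" "\<And>p. p \<in> S \<Longrightarrow> prime p \<and> odd p \<and> p dvd (s::nat)" "s > 0"
  shows "2 ^ card S \<le> 2 * sqrt (real s)"
proof (rule power2_le_imp_le)
  have "\<Prod>S dvd s" using assms by (intro prod_primes_dvd) auto
  then have "\<Prod>S \<le> s" using assms(3) dvd_imp_le by blast
  then have "4 ^ card S \<le> 4 * s" using four_power_card_primes_le[OF assms(1)] assms(2) by (meson le_trans mult_le_mono2)
  then have "real (4 ^ card S) \<le> real (4 * s)" by (rule of_nat_mono)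
  moreover have "((2::real) ^ card S)\<^sup>2 = 4 ^ card S" by (simp add: power2_eq_square power_mult_distrib[symmetric])
  ultimately show "((2::real) ^ card S)\<^sup>2 \<le> (2 * sqrt (real s))\<^sup>2" by (simp add: power_mult_distrib)
qed simp

lemma odd_square_mod_16: assumes "odd (s::nat)" shows "s\<^sup>2 mod 16 \<noteq> 7"
proof -
  obtain k where "s = 2 * k + 1" using assms oddE by blast
  then have "s\<^sup>2 = 4 * (k\<^sup>2 + k) + 1" by (simp add: power2_eq_square algebra_simps)
  then have "s\<^sup>2 mod 4 = 1" by presburger
  moreover have "s\<^sup>2 mod 16 mod 4 = s\<^sup>2 mod 4" by (simp add: mod_mod_cancel)
  ultimately show ?thesis by auto
qed

text \<open>Write N = n s^2 with n squarefree, so that b divides s. Polya-Vinogradov modulo n gains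
  the factor s, and sieving by the primes of s costs at most 2 sqrt s. This controls the N with a
  large square divisor in the short range.\<close>

lemma character_sum_bound:
  assumes "N mod 16 = 7" "b\<^sup>2 dvd N" "b \<ge> 1"
  shows "\<bar>\<Sum>n=1..X. real_of_int (jac (int n) N)\<bar> \<le> 2 * pv_bound N / sqrt (real b)"
proof -
  define s where "s = square_part N"
  define n where "n = squarefree_part N"
  have N: "N = n * s\<^sup>2" unfolding n_def s_def by (rule squarefree_decompose)
  have o: "odd N" using assms(1) mod16_7D by blast
  then have N0: "N > 0" using odd_pos by blast
  have os: "odd n" "odd s" "n > 0" "s > 0" using o N N0 by auto
  have sqf: "squarefree n" unfolding n_def by blast
  \<comment> \<open>No odd square is 7 modulo 16, so the character is not principal.\<close>
  have "n \<noteq> 1" using N odd_square_mod_16[OF os(2)] assms(1) by auto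
  then have n1: "n > 1" using os by linarith
  have "b dvd s" unfolding s_def using assms(2) by (simp add: dvd_square_part_iff)
  then have bs: "b \<le> s" using os(4) dvd_imp_le by blast
  let ?S = "prime_factors s"
  have S: "prime p \<and> odd p \<and> p dvd s" if "p \<in> ?S" for p
    using that os(2) by (auto simp: in_prime_factors_iff)
  have cop: "coprime t (int s) \<longleftrightarrow> (\<forall>p\<in>?S. \<not> int p dvd t)" for t
  proof -
    have "jac t s = 0 \<longleftrightarrow> \<not> (\<forall>p\<in>?S. \<not> int p dvd t)"
      using os(4) unfolding jac_def by (auto simp: prod_mset_zero_iff Legendre_eq_0_iff image_iff)
    then show ?thesis using jac_eq_0_iff[OF os(4), of t] by blast
  qed
  have jacN: "jac t N = (if \<forall>p\<in>?S. \<not> int p dvd t then jac t n else 0)" for t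
  proof -
    have "jac t N = jac t n * (jac t s)\<^sup>2" unfolding N using os by (simp add: jac_mult_right power2_eq_square)
    also have "(jac t s)\<^sup>2 = jac (t\<^sup>2) s" using os(2) by (simp add: jac_power_left)
    finally show ?thesis using jac_square[OF os(2), of t] cop[of t] by simp
  qed
  have "(\<Sum>m=1..X. real_of_int (jac (int m) N)) = (\<Sum>t\<in>{1..int X}. real_of_int (jac t N))"
    by (rule sum.reindex_bij_witness[of _ nat int]) auto
  also have "\<dots> = (\<Sum>t\<in>{t\<in>{1..int X}. [t = 0] (mod 1) \<and> (\<forall>p\<in>?S. \<not> int p dvd t)}. real_of_int (jac t n))"
    by (rule sum.mono_neutral_cong_right) (auto simp: jacN)
  finally have "\<bar>\<Sum>m=1..X. real_of_int (jac (int m) N)\<bar> \<le> 2 ^ card ?S * pv_bound n"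
    using polya_vinogradov[OF os(1) sqf n1, of 1 ?S 1 "int X" 0] S by simp
  also have "\<dots> \<le> (2 * sqrt (real s)) * pv_bound n"
    using two_power_card_primes_le[of ?S s] S os(4) pv_bound_nonneg[of n] n1 by (intro mult_right_mono) auto
  also have "\<dots> \<le> (2 * sqrt (real s)) * (sqrt (real n) * (1 + ln (real N)))"
  proof -
    have "n \<le> N" using N os by simp
    then show ?thesis unfolding pv_bound_def using os(3) by (intro mult_left_mono) auto
  qed
  also have "\<dots> = 2 * pv_bound N / sqrt (real s)"
  proof -
    have "sqrt (real N) = sqrt (real n) * real s" unfolding N by (simp add: real_sqrt_mult)
    then have "2 * pv_bound N / sqrt (real s) = 2 * sqrt (real n) * (1 + ln (real N)) * (real s / sqrt (real s))"
      unfolding pv_bound_def by simp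
    then show ?thesis by (simp add: real_div_sqrt)
  qed
  also have "\<dots> \<le> 2 * pv_bound N / sqrt (real b)"
    using bs assms(3) pv_bound_nonneg[of N] N0 by (intro divide_left_mono) auto
  finally show ?thesis .
qed

text \<open>As \<open>(2 | N) = 1\<close> for the conductors used here, these are the \<open>h\<close> with \<open>(h | N) \<ge> 0\<close>
  throughout; all other \<open>h\<close> cancel on average over \<open>N\<close>.\<close>
definition near_square :: "nat \<Rightarrow> bool" where
  "near_square h \<longleftrightarrow> squarefree_part h = 1 \<or> squarefree_part h = 2"

lemma jac_decompose:
  assumes "N mod 16 = 7"
  shows "jac (int h) N = (if coprime (int (square_part h)) (int N) then jac (int (squarefree_part h)) N else 0)"
proof -
  have o: "odd N" using assms mod16_7D by blast
  have "jac (int h) N = jac (int (squarefree_part h) * (int (square_part h))\<^sup>2) N"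
    by (subst (1) squarefree_decompose) simp
  then show ?thesis using jac_square[OF o, of "int (square_part h)"] by (simp add: jac_mult_left[OF o])
qed

lemma jac_near_square:
  assumes "N mod 16 = 7" "near_square h"
  shows "jac (int h) N = (if coprime (int (square_part h)) (int N) then 1 else 0)"
  using assms jac_2[OF assms(1)] by (subst jac_decompose) (auto simp: near_square_def)

section \<open>Averages over conductors\<close>

lemma crt_family:
  assumes "odd d"
  shows "\<exists>c. \<forall>N. (N mod 16 = 7 \<and> d dvd N) \<longleftrightarrow> [int N = c] (mod int (16 * d))"
proof -
  have "coprime (2::nat) d" using assms by simp
  then have "coprime ((2::nat)^4) d" by (subst coprime_power_left_iff) blast
  then have cop: "coprime (16::nat) d" by simp
  obtain c where c: "[c = 7] (mod 16)" "[c = 0] (mod d)" using binary_chinese_remainder_nat[OF cop] by blast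
  have "(N mod 16 = 7 \<and> d dvd N) \<longleftrightarrow> [int N = int c] (mod int (16 * d))" for N
  proof -
    have "(N mod 16 = 7 \<and> d dvd N) \<longleftrightarrow> [N = 7] (mod 16) \<and> [N = 0] (mod d)"
      by (simp add: Cong.cong_def cong_0_iff mod_eq_0_iff_dvd)
    also have "\<dots> \<longleftrightarrow> [N = c] (mod 16) \<and> [N = c] (mod d)" using c cong_sym cong_trans by blast
    also have "\<dots> \<longleftrightarrow> [N = c] (mod 16 * d)" 
    proof
      assume "[N = c] (mod 16) \<and> [N = c] (mod d)"
      then show "[N = c] (mod 16 * d)" using coprime_cong_mult_nat[OF _ _ cop] by blast
    next
      assume *: "[N = c] (mod 16 * d)"
      show "[N = c] (mod 16) \<and> [N = c] (mod d)"
        using cong_dvd_modulus_nat[OF *, of 16] cong_dvd_modulus_nat[OF *, of d] by simp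
    qed
    finally show ?thesis by (simp only: cong_int_iff)
  qed
  then show ?thesis by blast
qed

text \<open>Reciprocity turns (h | N) into the character (-N | k), where k is the odd part of the
  squarefree part of h. It is non-principal exactly because h is not near a square. Coprimality of N
  to the square part is handled by the sieve. If B is even or shares a factor with h, no non-zero
  term is present.\<close>

lemma family_average_bound:
  assumes "\<not> near_square h" "h > 0"
  shows "\<bar>\<Sum>N\<in>{N\<in>{a..t}. N mod 16 = 7 \<and> B\<^sup>2 dvd N}. real_of_int (jac (int h) N)\<bar> \<le> 2 * pv_bound h"
proof -
  let ?X = "{N\<in>{a..t}. N mod 16 = 7 \<and> B\<^sup>2 dvd N}"
  have p0: "pv_bound h \<ge> 0" using assms by (intro pv_bound_nonneg) auto
  have oX: "odd N" "odd B" if "N \<in> ?X" for N using that mod16_7D[of N] by auto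
  show ?thesis
  proof (cases "odd B \<and> coprime B h")
    case False
    have "jac (int h) N = 0" if N: "N \<in> ?X" for N
    proof -
      have "\<not> coprime B h" using False oX(2)[OF N] by blast
      moreover have "B dvd N" using N by (auto intro: dvd_trans[of B "B\<^sup>2"])
      ultimately have "\<not> coprime h N" using coprime_divisors[of B N h h] by (auto simp: coprime_commute)
      then show ?thesis using oX(1)[OF N] odd_pos by (simp add: jac_eq_0_iff)
    qed
    then have "(\<Sum>N\<in>?X. real_of_int (jac (int h) N)) = 0" by (intro sum.neutral) auto
    then show ?thesis using p0 by simp
  next
    case True
    define s where "s = square_part h"
    define k' where "k' = squarefree_part h"
    define k where "k = (if even k' then k' div 2 else k')"
    have h: "h = k' * s\<^sup>2" unfolding s_def k'_def by (rule squarefree_decompose)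
    have sqk': "squarefree k'" unfolding k'_def by blast
    have pos: "s > 0" "k' > 0" using h assms(2) by auto
    have kk: "(even k' \<and> k' = 2 * k) \<or> (odd k' \<and> k' = k)" unfolding k_def by auto
    have ok: "odd k"
    proof (cases "even k'")
      case True
      then have k: "k' = 2 * k" using kk by blast
      show ?thesis
      proof
        assume "even k"
        then have "2\<^sup>2 dvd k'" using k by auto
        from squarefreeD[OF sqk' this] show False by simp
      qed
    qed (simp add: k_def)
    have kdvd': "k dvd k'" using kk by auto
    have sqk: "squarefree k" using squarefree_mono[OF kdvd' sqk'] .
    have k1: "k > 1"
    proof -
      have "k \<noteq> 1" using assms(1) kk unfolding near_square_def k'_def[symmetric] by auto
      then show ?thesis using ok odd_pos[of k] by linarith
    qed
    have kh: "k \<le> k'" using kk by linarith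
    \<comment> \<open>The prime 2 is left out: N is odd anyway, and 2 is not coprime to the modulus
      16 B^2.\<close>
    define S where "S = {p\<in>prime_factors s. odd p}"
    have finS: "finite S" unfolding S_def by simp
    have S: "prime p \<and> odd p \<and> p dvd s" if "p \<in> S" for p using that by (auto simp: S_def in_prime_factors_iff)
    define d where "d = 16 * B\<^sup>2"
    have "odd (B\<^sup>2)" using True by simp
    then obtain c where c: "\<And>N. (N mod 16 = 7 \<and> B\<^sup>2 dvd N) \<longleftrightarrow> [int N = c] (mod int d)"
      unfolding d_def using crt_family by blast
    have copd: "coprime d q" if "odd q" "q dvd h" for q
    proof -
      have "coprime (2::nat) q" using that(1) by simp
      then have "coprime ((2::nat)^4) q" by (subst coprime_power_left_iff) blast
      moreover have "coprime B q" using True that(2) coprime_divisors[of B B q h] by auto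
      ultimately show ?thesis unfolding d_def by simp
    qed
    have jacN: "jac (int h) N = (if \<forall>p\<in>S. \<not> int p dvd - int N then jac (- int N) k else 0)" if N: "N \<in> ?X" for N
    proof -
      have N7: "N mod 16 = 7" using N by simp
      have "coprime (int s) (int N) \<longleftrightarrow> (\<forall>p\<in>S. \<not> int p dvd - int N)"
      proof
        assume *: "coprime (int s) (int N)"
        show "\<forall>p\<in>S. \<not> int p dvd - int N"
        proof
          fix p assume "p \<in> S"
          then have p: "prime p" "p dvd s" using S by auto
          show "\<not> int p dvd - int N"
          proof
            assume "int p dvd - int N"
            then have "p dvd N" by simp
            then have "is_unit p" using p(2) * coprime_common_divisor[of s N p] by simp
            then show False using p(1) by auto
          qed
        qed
      next
        assume *: "\<forall>p\<in>S. \<not> int p dvd - int N"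
        show "coprime (int s) (int N)"
        proof (rule ccontr)
          assume "\<not> coprime (int s) (int N)"
          then have "\<not> coprime s N" by simp
          then have "gcd s N \<noteq> 1" using coprime_iff_gcd_eq_1 by blast
          then obtain p where p: "prime p" "p dvd gcd s N" using prime_factor_nat by blast
          then have "p dvd s" "p dvd N" by auto
          moreover have "odd p" using \<open>p dvd N\<close> oX(1)[OF N] by auto
          ultimately have "p \<in> S" using p(1) pos(1) by (auto simp: S_def in_prime_factors_iff)
          then show False using * \<open>p dvd N\<close> by auto
        qed
      qed
      moreover have "jac (int k') N = jac (- int N) k"
      proof -
        have "jac (int k') N = jac (int k) N"
        proof (cases "even k'")
          case True
          then have "k' = 2 * k" using kk by blast
          then show ?thesis using jac_2[OF N7] jac_mult_left[OF oX(1)[OF N], of 2 "int k"] by simp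
          next
          case False
          then have "k' = k" using kk by blast
          then show ?thesis by simp
        qed
        also have "\<dots> = jac (- int N) k" using jac_neg_reciprocity[OF _ ok] mod16_7D(2)[OF N7] by simp
        finally show ?thesis .
      qed
      ultimately show ?thesis using jac_decompose[OF N7, of h] by (simp add: s_def[symmetric] k'_def[symmetric])
    qed
    have "(\<Sum>N\<in>?X. real_of_int (jac (int h) N)) = (\<Sum>N\<in>?X. if \<forall>p\<in>S. \<not> int p dvd - int N then real_of_int (jac (- int N) k) else 0)"
      by (intro sum.cong refl) (simp add: jacN)
    also have "\<dots> = (\<Sum>N\<in>{N\<in>?X. \<forall>p\<in>S. \<not> int p dvd - int N}. real_of_int (jac (- int N) k))"
      by (rule sum.inter_filter[symmetric]) simp
    \<comment> \<open>The substitution u = -N puts the sign from reciprocity into the range of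
      summation.\<close>
    also have "\<dots> = (\<Sum>u\<in>{u\<in>{- int t..- int a}. [u = - c] (mod int d) \<and> (\<forall>p\<in>S. \<not> int p dvd u)}. real_of_int (jac u k))"
    proof (rule sum.reindex_bij_witness[of _ "\<lambda>u. nat (- u)" "\<lambda>N. - int N"])
      fix u assume u: "u \<in> {u\<in>{- int t..- int a}. [u = - c] (mod int d) \<and> (\<forall>p\<in>S. \<not> int p dvd u)}"
      define w where "w = nat (- u)"
      have w: "u = - int w" "a \<le> w" "w \<le> t" unfolding w_def using u by auto
      then show "- int (nat (- u)) = u" by simp
      have "[- int w = - c] (mod int d)" using u w(1) by blast
      then have "[int w = c] (mod int d)" by (simp only: cong_minus_minus_iff)
      then have "w mod 16 = 7 \<and> B\<^sup>2 dvd w" using c by blast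
      moreover have "\<forall>p\<in>S. \<not> int p dvd - int w" using u w(1) by blast
      moreover have "nat (- u) = w" using w(1) by simp
      ultimately show "nat (- u) \<in> {N\<in>?X. \<forall>p\<in>S. \<not> int p dvd - int N}" using w(2,3) by simp
    next
      fix N assume N: "N \<in> {N\<in>?X. \<forall>p\<in>S. \<not> int p dvd - int N}"
      then have "[int N = c] (mod int d)" using c by blast
      then have "[- int N = - c] (mod int d)" by (simp only: cong_minus_minus_iff)
      then show "- int N \<in> {u\<in>{- int t..- int a}. [u = - c] (mod int d) \<and> (\<forall>p\<in>S. \<not> int p dvd u)}" using N by simp
    qed auto
    finally have eq: "(\<Sum>N\<in>?X. real_of_int (jac (int h) N)) = (\<Sum>u\<in>{u\<in>{- int t..- int a}. [u = - c] (mod int d) \<and> (\<forall>p\<in>S. \<not> int p dvd u)}. real_of_int (jac u k))" .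
    have kdvd: "k dvd h" using kdvd' h dvd_mult2 by simp
    have "\<bar>\<Sum>N\<in>?X. real_of_int (jac (int h) N)\<bar> \<le> 2 ^ card S * pv_bound k"
      unfolding eq
    proof (rule polya_vinogradov[OF ok sqk k1 _ _ finS])
      have "B > 0" using True odd_pos by blast
      then show "int d > 0" by (simp add: d_def)
      show "coprime (int d) (int k)" using copd[OF ok kdvd] by simp
      fix p assume "p \<in> S"
      then have p: "prime p" "odd p" "p dvd s" using S by auto
      then have "p dvd h" using h by (simp add: dvd_mult power2_eq_square)
      then show "prime p \<and> coprime (int d) (int p)" using p copd by simp
    qed
    also have "\<dots> \<le> (2 * sqrt (real s)) * pv_bound k"
      using two_power_card_primes_le[OF finS, of s] S pos pv_bound_nonneg[of k] k1 by (intro mult_right_mono) auto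
    also have "\<dots> \<le> 2 * pv_bound h"
    proof -
      have "real s \<le> (real s)\<^sup>2" using pos(1) by (simp add: power2_eq_square)
      then have "sqrt (real s) \<le> real s" using pos(1) by (intro real_le_lsqrt) auto
      moreover have "sqrt (real k) \<le> sqrt (real k')" using kh by simp
      ultimately have "sqrt (real s) * sqrt (real k) \<le> real s * sqrt (real k')" by (intro mult_mono) auto
      also have "real s * sqrt (real k') = sqrt (real h)" unfolding h by (simp add: real_sqrt_mult)
      finally have 1: "sqrt (real s) * sqrt (real k) \<le> sqrt (real h)" .
      have "k \<le> h" using kdvd assms(2) dvd_imp_le by blast
      then have "(sqrt (real s) * sqrt (real k)) * (1 + ln (real k)) \<le> sqrt (real h) * (1 + ln (real h))"
        using 1 k1 by (intro mult_mono) auto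
      then show ?thesis by (simp add: pv_bound_def)
    qed
    finally show ?thesis .
  qed
qed

section \<open>Counting integers in residue classes\<close>

lemma div_real_bounds:
  fixes x d :: int
  assumes "d > 0"
  shows "real_of_int (x div d) \<le> real_of_int x / real_of_int d" "real_of_int x / real_of_int d - 1 < real_of_int (x div d)"
proof -
  have "real_of_int x = real_of_int d * real_of_int (x div d) + real_of_int (x mod d)"
    by (metis mult_div_mod_eq of_int_add of_int_mult)
  moreover have "0 \<le> real_of_int (x mod d)" "real_of_int (x mod d) < real_of_int d" using assms by auto
  ultimately show "real_of_int (x div d) \<le> real_of_int x / real_of_int d" "real_of_int x / real_of_int d - 1 < real_of_int (x div d)"
    using assms by (auto simp: field_simps)
qed

lemma card_residue_class:
  fixes c d lo hi :: int
  assumes "d > 0" "lo \<le> hi"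
  defines "n \<equiv> real (card {t\<in>{lo..hi}. [t = c] (mod d)})"
  shows "n \<le> real_of_int (hi - lo) / real_of_int d + 1" "n \<ge> real_of_int (hi - lo) / real_of_int d - 1"
proof -
  have inj: "inj_on (\<lambda>j. c + d * j) X" for X using assms(1) by (auto simp: inj_on_def)
  have "n = real (nat ((hi - c) div d + (c - lo) div d + 1))"
    unfolding n_def arith_prog_image[OF assms(1)] card_image[OF inj] by simp
  moreover have "real_of_int (hi - lo) / real_of_int d = real_of_int (hi - c) / real_of_int d + real_of_int (c - lo) / real_of_int d"
    by (simp add: diff_divide_distrib)
  moreover have "real_of_int (hi - lo) / real_of_int d \<ge> 0" using assms by simp
  ultimately show "n \<le> real_of_int (hi - lo) / real_of_int d + 1" "n \<ge> real_of_int (hi - lo) / real_of_int d - 1"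
    using div_real_bounds[OF assms(1), of "hi - c"] div_real_bounds[OF assms(1), of "c - lo"]
    by linarith+
qed

lemma card_residue_class_nat:
  fixes a b d :: nat and c :: int
  assumes "d > 0" "a \<le> b"
  defines "n \<equiv> real (card {t\<in>{a..b}. [int t = c] (mod int d)})"
  shows "n \<le> real (b - a) / real d + 1" "n \<ge> real (b - a) / real d - 1"
proof -
  have "{t\<in>{int a..int b}. [t = c] (mod int d)} = int ` {t\<in>{a..b}. [int t = c] (mod int d)}"
  proof (intro equalityI subsetI)
    fix t assume "t \<in> {t\<in>{int a..int b}. [t = c] (mod int d)}"
    then show "t \<in> int ` {t\<in>{a..b}. [int t = c] (mod int d)}" by (intro image_eqI[of _ _ "nat t"]) auto
  qed auto
  then have "n = real (card {t\<in>{int a..int b}. [t = c] (mod int d)})"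
    unfolding n_def by (simp add: card_image)
  then show "n \<le> real (b - a) / real d + 1" "n \<ge> real (b - a) / real d - 1"
    using card_residue_class[of "int d" "int a" "int b" c] assms(1,2) by (simp_all add: of_nat_diff)
qed

lemma card_family_dvd_le:
  assumes "odd e" "a \<le> b"
  shows "real (card {N\<in>{a..b}. N mod 16 = 7 \<and> e dvd N}) \<le> real (b - a) / (16 * real e) + 1"
proof -
  obtain c where "\<And>N. (N mod 16 = 7 \<and> e dvd N) \<longleftrightarrow> [int N = c] (mod int (16 * e))"
    using crt_family[OF assms(1)] by blast
  then show ?thesis using card_residue_class_nat(1)[OF _ assms(2), of "16 * e" c] assms(1) odd_pos by simp
qed

lemma card_family_ge:
  assumes "a \<le> b"
  shows "real (card {N\<in>{a..b}. N mod 16 = 7}) \<ge> real (b - a) / 16 - 1"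
proof -
  obtain c where "\<And>N. (N mod 16 = 7 \<and> 1 dvd N) \<longleftrightarrow> [int N = c] (mod int (16 * 1))"
    using crt_family[of 1] by auto
  then show ?thesis using card_residue_class_nat(2)[OF _ assms(1), of "16" c] by simp
qed

lemma card_dvd_le:
  assumes "e > 0" "a \<le> b"
  shows "real (card {N\<in>{a..b}. e dvd N}) \<le> real (b - a) / real e + 1"
proof -
  have "e dvd N \<longleftrightarrow> [int N = 0] (mod int e)" for N by (simp add: cong_0_iff)
  then show ?thesis using card_residue_class_nat(1)[OF assms, of 0] by simp
qed

section \<open>The Moebius function and the sieve for squarefree integers\<close>

definition mu :: "nat \<Rightarrow> int" where
  "mu n = (if squarefree n then (-1) ^ card (prime_factors n) else 0)"

lemma mu_abs_le: "\<bar>real_of_int (mu n)\<bar> \<le> 1"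
  by (simp add: mu_def)

lemma sum_Pow_minus_one:
  assumes "finite F" shows "(\<Sum>T\<in>Pow F. (-1::int) ^ card T) = (if F = {} then 1 else 0)"
  using assms
proof (induction F rule: finite_induct)
  case (insert x F)
  have "(\<Sum>T\<in>Pow (insert x F). (-1::int) ^ card T) = (\<Sum>T\<in>Pow F. (-1) ^ card T) + (\<Sum>T\<in>insert x ` Pow F. (-1) ^ card T)"
    unfolding Pow_insert using insert by (intro sum.union_disjoint) auto
  also have "(\<Sum>T\<in>insert x ` Pow F. (-1::int) ^ card T) = (\<Sum>T\<in>Pow F. (-1) ^ card (insert x T))"
    using insert by (subst sum.reindex) (auto simp: inj_on_def)
  also have "\<dots> = (\<Sum>T\<in>Pow F. - ((-1) ^ card T))"
  proof (intro sum.cong refl)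
    fix T assume "T \<in> Pow F"
    then have "finite T" "x \<notin> T" using insert finite_subset by auto
    then show "(-1::int) ^ card (insert x T) = - ((-1) ^ card T)" by simp
  qed
  finally show ?case by (simp add: sum_negf)
qed simp

lemma prime_factors_prod_primes:
  assumes "finite T" "\<And>p. p \<in> T \<Longrightarrow> prime (p::nat)"
  shows "prime_factors (\<Prod>T) = T" "squarefree (\<Prod>T)" "\<Prod>T > 0"
proof -
  show pos: "\<Prod>T > 0" using assms prime_gt_0_nat by (intro prod_pos) auto
  show "squarefree (\<Prod>T)"
    by (rule squarefree_prod_coprime) (use assms primes_coprime squarefree_prime in blast)+
  have "p dvd \<Prod>T \<longleftrightarrow> p \<in> T" if "prime p" for p
    using that assms prime_dvd_prod_iff[of T p "\<lambda>x. x"] primes_dvd_imp_eq[of p] by auto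
  then show "prime_factors (\<Prod>T) = T" using assms pos by (auto simp: in_prime_factors_iff)
qed

lemma squarefree_eq_prod_primes:
  assumes "squarefree (n::nat)" shows "\<Prod>(prime_factors n) = n"
proof -
  have n: "n \<noteq> 0" using assms not_squarefree_0 by metis
  then have "n = (\<Prod>p\<in>prime_factors n. p ^ multiplicity p n)" using prime_factorization_nat by auto
  also have "\<dots> = \<Prod>(prime_factors n)"
    using assms n by (intro prod.cong refl) (simp add: squarefree_factorial_semiring')
  finally show ?thesis ..
qed

text \<open>Squarefree divisors of s correspond to subsets of its prime factors, so the sum is the
  alternating count of subsets.\<close>

lemma sum_mu_divisors:
  assumes "s > 0" shows "(\<Sum>b | b dvd s. mu b) = (if s = 1 then 1 else 0)"
proof -
  let ?F = "prime_factors s"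
  have fin: "finite {b. b dvd s}" using assms by simp
  have "(\<Sum>b | b dvd s. mu b) = (\<Sum>b\<in>{b. b dvd s \<and> squarefree b}. mu b)"
    using assms by (intro sum.mono_neutral_right) (auto simp: mu_def)
  also have "\<dots> = (\<Sum>T\<in>Pow ?F. (-1) ^ card T)"
  proof (rule sum.reindex_bij_witness[of _ "\<lambda>T. \<Prod>T" prime_factors])
    fix b assume b: "b \<in> {b. b dvd s \<and> squarefree b}"
    then show "\<Prod>(prime_factors b) = b" using squarefree_eq_prod_primes by blast
    show "prime_factors b \<in> Pow ?F" using b assms dvd_prime_factors by auto
    show "(-1) ^ card (prime_factors b) = mu b" using b by (simp add: mu_def)
  next
    fix T assume T: "T \<in> Pow ?F"
    then have T': "finite T" "\<And>p. p \<in> T \<Longrightarrow> prime p \<and> p dvd s" by (auto intro: finite_subset)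
    then show "prime_factors (\<Prod>T) = T" by (intro prime_factors_prod_primes(1)) auto
    have "\<Prod>T dvd s" using T' by (intro prod_primes_dvd) auto
    then show "\<Prod>T \<in> {b. b dvd s \<and> squarefree b}" using prime_factors_prod_primes(2)[of T] T' by auto
  qed
  also have "\<dots> = (if ?F = {} then 1 else 0)" by (rule sum_Pow_minus_one) simp
  also have "?F = {} \<longleftrightarrow> s = 1" using assms by (auto simp: prime_factorization_empty_iff)
  finally show ?thesis .
qed

text \<open>The b with b^2 dividing N are the divisors of the square part of N, which is 1 exactly
  for squarefree N.\<close>

lemma sum_mu_square_divisors:
  assumes "N > 0" shows "(\<Sum>b | b\<^sup>2 dvd N. mu b) = (if squarefree N then 1 else 0)"
proof -
  have "{b. b\<^sup>2 dvd N} = {b. b dvd square_part N}" by (simp add: dvd_square_part_iff)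
  moreover have "square_part N = 1 \<longleftrightarrow> squarefree N"
  proof
    assume "square_part N = 1"
    then have "N = squarefree_part N" using squarefree_decompose[of N] by simp
    then show "squarefree N" by (metis squarefree_squarefree_part)
  next
    assume "squarefree N"
    from squarefreeD[OF this, of "square_part N"] show "square_part N = 1" by simp
  qed
  moreover have "square_part N > 0" using assms by (metis neq0_conv square_part_0_iff)
  ultimately show ?thesis using sum_mu_divisors[of "square_part N"] by simp
qed

section \<open>Squarefree parts of products\<close>

lemma squarefree_part_cancel:
  assumes "h > 0" "m > 0" "n > 0" "squarefree_part (m * h) = squarefree_part (n * (h::nat))"
  shows "squarefree_part m = squarefree_part n"
proof (rule multiplicity_eq_nat)
  fix p :: nat assume p: "prime p"
  have "multiplicity p (m * h) mod 2 = multiplicity p (n * h) mod 2"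
    using assms(4) by (simp only: prime_multiplicity_squarefree_part[OF p, symmetric])
  then have "(multiplicity p m + multiplicity p h) mod 2 = (multiplicity p n + multiplicity p h) mod 2"
    using assms(1-3) p by (simp add: prime_elem_multiplicity_mult_distrib prime_imp_prime_elem)
  then have "multiplicity p m mod 2 = multiplicity p n mod 2" by presburger
  then show "multiplicity p (squarefree_part m) = multiplicity p (squarefree_part n)"
    using p by (simp add: prime_multiplicity_squarefree_part)
qed (metis neq0_conv squarefree_part_nonzero)+

text \<open>Prescribing the squarefree part of n h fixes that of n, by
  \<open>squarefree_part_cancel\<close>. Then n is determined by its square part, which is at most
  sqrt X. The factor 2 stems from the two admissible values 1 and 2.\<close>

lemma card_near_square_le:
  assumes "h > 0" shows "real (card {n\<in>{1..X}. near_square (n * h)}) \<le> 2 * sqrt (real X)"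
proof -
  have *: "real (card {n\<in>{1..X}. squarefree_part (n * h) = v}) \<le> sqrt (real X)" for v
  proof -
    let ?E = "{n\<in>{1..X}. squarefree_part (n * h) = v}"
    have "inj_on square_part ?E"
    proof (rule inj_onI)
      fix m n assume mn: "m \<in> ?E" "n \<in> ?E" "square_part m = square_part n"
      then have "squarefree_part m = squarefree_part n" using squarefree_part_cancel[OF assms, of m n] by auto
      then show "m = n" using mn(3) squarefree_decomposition_unique by blast
    qed
    moreover have "square_part ` ?E \<subseteq> {1..nat \<lfloor>sqrt (real X)\<rfloor>}"
    proof
      fix s assume "s \<in> square_part ` ?E"
      then obtain n where n: "n \<in> ?E" "s = square_part n" by blast
      then have "n > 0" by auto
      then have "s > 0" "s\<^sup>2 dvd n" using n(2) by (metis neq0_conv square_part_0_iff, simp)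
      then have "s\<^sup>2 \<le> X" using n(1) \<open>n > 0\<close> dvd_imp_le[of "s\<^sup>2" n] by auto
      then have "real (s\<^sup>2) \<le> real X" by (rule of_nat_mono)
      then have "real s \<le> sqrt (real X)" by (intro real_le_rsqrt) simp
      then show "s \<in> {1..nat \<lfloor>sqrt (real X)\<rfloor>}" using \<open>s > 0\<close> by (simp add: le_nat_floor)
    qed
    ultimately have "card ?E \<le> card {1..nat \<lfloor>sqrt (real X)\<rfloor>}" by (rule card_inj_on_le) simp
    then have "card ?E \<le> nat \<lfloor>sqrt (real X)\<rfloor>" by simp
    then have "real (card ?E) \<le> real (nat \<lfloor>sqrt (real X)\<rfloor>)" by (rule of_nat_mono)
    also have "\<dots> \<le> sqrt (real X)" by (simp add: of_nat_floor)
    finally show ?thesis .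
  qed
  have "{n\<in>{1..X}. near_square (n * h)} = {n\<in>{1..X}. squarefree_part (n * h) = 1} \<union> {n\<in>{1..X}. squarefree_part (n * h) = 2}"
    by (auto simp: near_square_def)
  then have "card {n\<in>{1..X}. near_square (n * h)} \<le> card {n\<in>{1..X}. squarefree_part (n * h) = 1} + card {n\<in>{1..X}. squarefree_part (n * h) = 2}"
    by (simp only: card_Un_le)
  then show ?thesis using *[of 1] *[of 2] by linarith
qed

text \<open>Every odd prime has even multiplicity in a near square, so it lies in both sets or in
  neither. This is the orthogonality behind the second moment of the resonator.\<close>

lemma near_square_prod_primes:
  assumes "finite T" "finite U" "\<And>p. p \<in> T \<union> U \<Longrightarrow> prime p \<and> odd (p::nat)" "near_square (\<Prod>T * \<Prod>U)"
  shows "T = U"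
proof -
  have mult: "multiplicity p (\<Prod>V) = (if p \<in> V then 1 else 0)" if "finite V" "V \<subseteq> T \<union> U" "prime p" for V p
  proof -
    have V: "\<And>p. p \<in> V \<Longrightarrow> prime p" using that assms(3) by blast
    note pf = prime_factors_prod_primes[OF that(1) V]
    have nz: "\<Prod>V \<noteq> 0" using pf(3) by simp
    show ?thesis
    proof (cases "p \<in> V")
      case True
      then show ?thesis using pf nz by (metis squarefree_factorial_semiring')
    next
      case False
      then have "\<not> p dvd \<Prod>V" using pf(1) nz that(3) by (metis in_prime_factors_iff)
      then show ?thesis using False by (simp add: not_dvd_imp_multiplicity_0)
    qed
  qed
  have pos: "\<Prod>T > 0" "\<Prod>U > 0" using assms prime_gt_0_nat by (auto intro!: prod_pos)
  have "p \<in> T \<longleftrightarrow> p \<in> U" if p: "prime p" "odd p" for p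
  proof -
    have "multiplicity p (squarefree_part (\<Prod>T * \<Prod>U)) = 0"
    proof -
      have "squarefree_part (\<Prod>T * \<Prod>U) = 1 \<or> squarefree_part (\<Prod>T * \<Prod>U) = 2" using assms(4) by (simp add: near_square_def)
      moreover have "\<not> p dvd 2" using p primes_dvd_imp_eq[of p 2] by auto
      moreover have "\<not> p dvd 1" using p by auto
      ultimately have "\<not> p dvd squarefree_part (\<Prod>T * \<Prod>U)" by metis
      then show ?thesis by (rule not_dvd_imp_multiplicity_0)
    qed
    then have "(multiplicity p (\<Prod>T) + multiplicity p (\<Prod>U)) mod 2 = 0"
      using p pos by (simp add: prime_multiplicity_squarefree_part prime_elem_multiplicity_mult_distrib prime_imp_prime_elem)
    then show ?thesis using mult[OF assms(1) _ p(1)] mult[OF assms(2) _ p(1)] by (auto split: if_splits)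
  qed
  then show ?thesis using assms(3) by blast
qed

section \<open>The dual sum\<close>

text \<open>The conjugate Dirichlet kernel, multiplied out by 2 sin x to avoid a division. The last
  term will become the half weight of the endpoint X in \<open>dual_formula\<close>.\<close>

lemma sum_sin_even:
  "2 * sin x * (\<Sum>n=1..X. sin (2 * real n * x)) = cos x * (1 - cos (2 * real X * x)) + sin x * sin (2 * real X * x)"
proof (induction X)
  case (Suc X)
  have g: "2 * sin x * sin y = cos (y - x) - cos (y + x)" for y
    by (simp add: cos_diff cos_add)
  have e: "2 * real (Suc X) * x - x = 2 * real X * x + x" by (simp add: algebra_simps)
  from g[of "2 * real (Suc X) * x"] have "2 * sin x * sin (2 * real (Suc X) * x) = cos (2 * real X * x + x) - cos (2 * real (Suc X) * x + x)" unfolding e .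
  then have "2 * sin x * sin (2 * real (Suc X) * x) = cos (2 * real X * x) * cos x - sin (2 * real X * x) * sin x
      - cos (2 * real (Suc X) * x) * cos x + sin (2 * real (Suc X) * x) * sin x" by (simp only: cos_add)
  then show ?case using Suc by (simp add: distrib_left algebra_simps)
qed simp

text \<open>The cotangent of pi n / N, cut off where it changes sign; the other half of the residues
  is folded onto this one by n to N - n.\<close>

definition half_cot :: "nat \<Rightarrow> nat \<Rightarrow> real" where
  "half_cot n N = (if 2 * n \<le> N then cos (pi * real n / real N) / sin (pi * real n / real N) else 0)"

definition cos_average :: "nat \<Rightarrow> nat \<Rightarrow> nat \<Rightarrow> nat \<Rightarrow> real" where
  "cos_average X W n N = (\<Sum>Y\<in>{X-W<..X}. cos (2 * pi * (real n * real Y) / real N)) / real W"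

text \<open>The kernel of the functional equation, averaged over the lengths in \<open>{X-W<..X}\<close>. The oscillating
  part is dropped beyond \<open>Z\<close>, where averaging makes it negligible but its variation in \<open>N\<close> would be large.\<close>
definition dual_kernel :: "nat \<Rightarrow> nat \<Rightarrow> real \<Rightarrow> nat \<Rightarrow> nat \<Rightarrow> real" where
  "dual_kernel X W Z n N = half_cot n N * (1 - (if real n \<le> Z then cos_average X W n N else 0))"

lemma sin_frac:
  assumes "1 \<le> n" "2 * n \<le> N"
  shows "2 * real n / real N \<le> sin (pi * real n / real N)" "sin (pi * real n / real N) > 0"
    "0 < 2 * real n / real N"
proof -
  have "real n / real N \<le> 1/2" using assms by (simp add: field_simps)
  then have "2 * (real n / real N) \<le> sin (pi * (real n / real N))" by (intro sin_pi_ge) auto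
  then show 1: "2 * real n / real N \<le> sin (pi * real n / real N)" by simp
  show 2: "0 < 2 * real n / real N" using assms by simp
  show "sin (pi * real n / real N) > 0" using 1 2 by linarith
qed

lemma half_cot_bounds:
  assumes "1 \<le> n" shows "0 \<le> half_cot n N" "half_cot n N \<le> real N / (2 * real n)"
proof -
  have "0 \<le> half_cot n N \<and> half_cot n N \<le> real N / (2 * real n)"
  proof (cases "2 * n \<le> N")
    case True
    note s = sin_frac[OF assms True]
    have "real n / real N \<le> 1/2" using assms True by (simp add: field_simps)
    then have "pi * (real n / real N) \<le> pi * (1/2)" by (intro mult_left_mono) auto
    then have c: "0 \<le> cos (pi * real n / real N)" by (intro cos_ge_zero) (auto intro: order_trans[of _ 0])
    have "cos (pi * real n / real N) / sin (pi * real n / real N) \<le> 1 / (2 * real n / real N)"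
      using s c by (intro frac_le) auto
    then show ?thesis using True c s by (simp add: half_cot_def)
  qed (simp add: half_cot_def)
  then show "0 \<le> half_cot n N" "half_cot n N \<le> real N / (2 * real n)" by auto
qed

lemma cot_diff_cot:
  "sin a \<noteq> 0 \<Longrightarrow> sin b \<noteq> 0 \<Longrightarrow> cos a / sin a - cos b / sin b = sin (b - a) / (sin a * sin (b::real))"
  by (simp add: sin_diff field_simps)

text \<open>The difference of cotangents is a sine of the tiny angle pi n / (N (N + 1)) over a
  product of two sines, each bounded below linearly.\<close>

lemma half_cot_diff:
  assumes "1 \<le> n" shows "\<bar>half_cot n (Suc N) - half_cot n N\<bar> \<le> 1 / real n"
proof (cases "2 * n \<le> N")
  case True
  let ?a = "pi * real n / real (Suc N)" and ?b = "pi * real n / real N"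
  have N0: "real N > 0" using assms True by simp
  have s1: "2 * real n / real (Suc N) \<le> sin ?a" "sin ?a > 0" "0 < 2 * real n / real (Suc N)"
    using sin_frac[OF assms, of "Suc N"] True by auto
  note s2 = sin_frac[OF assms True]
  have ba: "?b - ?a = pi * real n / (real N * real (Suc N))"
    using N0 by (simp add: field_simps)
  have "half_cot n (Suc N) - half_cot n N = cos ?a / sin ?a - cos ?b / sin ?b" using True by (simp add: half_cot_def)
  also have "\<dots> = sin (?b - ?a) / (sin ?a * sin ?b)" using s1 s2 by (intro cot_diff_cot) auto
  finally have eq: "half_cot n (Suc N) - half_cot n N = sin (?b - ?a) / (sin ?a * sin ?b)" .
  have "\<bar>sin (?b - ?a)\<bar> \<le> \<bar>?b - ?a\<bar>" by (rule abs_sin_x_le_abs_x)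
  also have "\<dots> = pi * real n / (real N * real (Suc N))" unfolding ba using N0 by simp
  finally have "\<bar>sin (?b - ?a)\<bar> \<le> pi * real n / (real N * real (Suc N))" .
  moreover have "(2 * real n / real (Suc N)) * (2 * real n / real N) \<le> sin ?a * sin ?b"
    using s1 s2 by (intro mult_mono) auto
  ultimately have "\<bar>sin (?b - ?a)\<bar> / (sin ?a * sin ?b) \<le> (pi * real n / (real N * real (Suc N))) / ((2 * real n / real (Suc N)) * (2 * real n / real N))"
    using s1 s2 by (intro frac_le mult_pos_pos) auto
  also have "\<dots> = pi / (4 * real n)"
  proof -
    have "(pi * m / (A * B)) / ((2 * m / B) * (2 * m / A)) = pi / (4 * m)" if "A > 0" "B > 0" "m > 0" for A B m :: real
      using that by (simp add: field_simps)
    from this[of "real N" "real (Suc N)" "real n"] show ?thesis using N0 assms by simp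
  qed
  also have "\<dots> \<le> 4 / (4 * real n)" using pi_less_4 assms by (intro divide_right_mono) auto
  finally show ?thesis unfolding eq using s1 s2 by (simp add: abs_mult)
next
  case False
  have "half_cot n (Suc N) = 0"
  \<comment> \<open>Here n enters the support as N grows, with the value cot(pi / 2) = 0, so the
    cutoff causes no jump.\<close>
  proof (cases "2 * n = Suc N")
    case True
    then have "pi * real n / real (Suc N) = pi / 2" using assms by (simp add: field_simps flip: of_nat_Suc)
    then have "half_cot n (Suc N) = cos (pi / 2) / sin (pi / 2)" using True by (simp only: half_cot_def order_refl if_True)
    then show ?thesis by simp
  qed (use False in \<open>simp add: half_cot_def\<close>)
  then show ?thesis using False by (simp add: half_cot_def)
qed

lemma cos_average_abs_le: "W \<ge> 1 \<Longrightarrow> W \<le> X \<Longrightarrow> \<bar>cos_average X W n N\<bar> \<le> 1"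
proof -
  assume W: "W \<ge> 1" "W \<le> X"
  have "\<bar>\<Sum>Y\<in>{X-W<..X}. cos (2 * pi * (real n * real Y) / real N)\<bar> \<le> (\<Sum>Y\<in>{X-W<..X}. 1)"
    by (intro order_trans[OF sum_abs] sum_mono) simp
  also have "\<dots> = real W" using W by simp
  finally show ?thesis using W by (simp add: cos_average_def field_simps)
qed

text \<open>The average is the real part of a geometric series of length W, so it decays once n W
  exceeds N.\<close>

lemma cos_average_decay:
  assumes "1 \<le> n" "2 * n \<le> N" "W \<ge> 1"
  shows "\<bar>cos_average X W n N\<bar> \<le> real N / (2 * real n * real W)"
proof -
  have "(\<Sum>Y\<in>{X-W<..X}. cos (2 * pi * (real n * real Y) / real N)) = Re (\<Sum>j\<in>{int (X-W)+1..int X}. ee N (int n * j))"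
    unfolding Re_sum
    by (rule sum.reindex_bij_witness[of _ nat int]) (auto simp: ee_def)
  then have "\<bar>\<Sum>Y\<in>{X-W<..X}. cos (2 * pi * (real n * real Y) / real N)\<bar> \<le> norm (\<Sum>j\<in>{int (X-W)+1..int X}. ee N (int n * j))"
    using abs_Re_le_cmod by metis
  also have "\<dots> \<le> 1 / sin (pi * real_of_int (int n) / real N)"
    using assms by (intro norm_sum_ee_le) auto
  also have "\<dots> \<le> 1 / (2 * real n / real N)"
    using sin_frac[OF assms(1,2)] by (intro frac_le) auto
  finally have "\<bar>\<Sum>Y\<in>{X-W<..X}. cos (2 * pi * (real n * real Y) / real N)\<bar> \<le> real N / (2 * real n)" by simp
  then show ?thesis using assms unfolding cos_average_def by (simp add: field_simps)
qed

lemma abs_cos_diff_le: "\<bar>cos x - cos y\<bar> \<le> \<bar>x - (y::real)\<bar>"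
proof -
  have "cos x - cos y = 2 * sin ((x + y) / 2) * sin ((y - x) / 2)" by (rule cos_diff_cos)
  then have "\<bar>cos x - cos y\<bar> = 2 * \<bar>sin ((x + y) / 2)\<bar> * \<bar>sin ((y - x) / 2)\<bar>" by (simp add: abs_mult)
  also have "\<dots> \<le> 2 * 1 * \<bar>(y - x) / 2\<bar>" by (intro mult_mono abs_sin_x_le_abs_x) auto
  finally show ?thesis by simp
qed

lemma cos_average_diff:
  assumes "N \<ge> 1" "W \<ge> 1" "W \<le> X"
  shows "\<bar>cos_average X W n (Suc N) - cos_average X W n N\<bar> \<le> 7 * real n * real X / (real N)\<^sup>2"
proof -
  have one: "\<bar>cos (2 * pi * (real n * real Y) / real (Suc N)) - cos (2 * pi * (real n * real Y) / real N)\<bar> \<le> 7 * real n * real X / (real N)\<^sup>2"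
    if "Y \<in> {X-W<..X}" for Y
  proof -
    have "\<bar>cos (2 * pi * (real n * real Y) / real (Suc N)) - cos (2 * pi * (real n * real Y) / real N)\<bar>
       \<le> \<bar>2 * pi * (real n * real Y) / real (Suc N) - 2 * pi * (real n * real Y) / real N\<bar>" by (rule abs_cos_diff_le)
    also have "2 * pi * (real n * real Y) / real (Suc N) - 2 * pi * (real n * real Y) / real N = - (2 * pi * (real n * real Y) / (real N * real (Suc N)))"
      using assms by (simp add: field_simps)
    also have "\<bar>\<dots>\<bar> = 2 * pi * (real n * real Y) / (real N * real (Suc N))" by simp
    also have "\<dots> \<le> 7 * (real n * real X) / (real N)\<^sup>2"
    proof (rule frac_le)
      have "2 * pi \<le> 7" using pi_approx by simp
      then show "2 * pi * (real n * real Y) \<le> 7 * (real n * real X)" using that by (intro mult_mono) auto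
      show "(real N)\<^sup>2 \<le> real N * real (Suc N)" unfolding power2_eq_square by (intro mult_left_mono) auto
    qed (use assms in auto)
    finally show ?thesis by simp
  qed
  have "cos_average X W n (Suc N) - cos_average X W n N = (\<Sum>Y\<in>{X-W<..X}. cos (2 * pi * (real n * real Y) / real (Suc N)) - cos (2 * pi * (real n * real Y) / real N)) / real W"
    unfolding cos_average_def by (simp only: sum_subtractf diff_divide_distrib)
  moreover have "\<bar>\<Sum>Y\<in>{X-W<..X}. cos (2 * pi * (real n * real Y) / real (Suc N)) - cos (2 * pi * (real n * real Y) / real N)\<bar> \<le> (\<Sum>Y\<in>{X-W<..X}. 7 * real n * real X / (real N)\<^sup>2)"
    by (intro order_trans[OF sum_abs] sum_mono one)
  moreover have "(\<Sum>Y\<in>{X-W<..X}. 7 * real n * real X / (real N)\<^sup>2) = real W * (7 * real n * real X / (real N)\<^sup>2)" using assms by simp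
  ultimately show ?thesis using assms by (simp add: pos_divide_le_eq mult.commute)
qed

lemma dual_kernel_nonneg: "1 \<le> n \<Longrightarrow> W \<ge> 1 \<Longrightarrow> W \<le> X \<Longrightarrow> 0 \<le> dual_kernel X W Z n N"
  unfolding dual_kernel_def using half_cot_bounds(1)[of n N] cos_average_abs_le[of W X n N] by (intro mult_nonneg_nonneg) auto

lemma dual_kernel_le: "1 \<le> n \<Longrightarrow> W \<ge> 1 \<Longrightarrow> W \<le> X \<Longrightarrow> dual_kernel X W Z n N \<le> real N / real n"
proof -
  assume a: "1 \<le> n" "W \<ge> 1" "W \<le> X"
  have "dual_kernel X W Z n N \<le> (real N / (2 * real n)) * 2"
    unfolding dual_kernel_def using half_cot_bounds[of n N] cos_average_abs_le[of W X n N] a by (intro mult_mono) auto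
  then show ?thesis by simp
qed

text \<open>The first term is the variation of the cotangent. The second is that of the phase: a
  cotangent of size N / n times a change of size n X / N^2 gives X / N for every n alike. It occurs
  only up to Z.\<close>

lemma dual_kernel_diff:
  assumes "1 \<le> n" "N \<ge> 1" "W \<ge> 1" "W \<le> X"
  shows "\<bar>dual_kernel X W Z n (Suc N) - dual_kernel X W Z n N\<bar> \<le> 2 / real n + (if real n \<le> Z then 4 * real X / real N else 0)"
proof (cases "real n \<le> Z")
  case True
  let ?c = "cos_average X W n"
  have "dual_kernel X W Z n (Suc N) - dual_kernel X W Z n N = (half_cot n (Suc N) - half_cot n N) * (1 - ?c (Suc N)) - half_cot n N * (?c (Suc N) - ?c N)"
    using True by (simp add: dual_kernel_def algebra_simps)
  then have "\<bar>dual_kernel X W Z n (Suc N) - dual_kernel X W Z n N\<bar> \<le> \<bar>(half_cot n (Suc N) - half_cot n N) * (1 - ?c (Suc N))\<bar> + \<bar>half_cot n N * (?c (Suc N) - ?c N)\<bar>"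
    by (simp only: abs_triangle_ineq4)
  also have "\<bar>(half_cot n (Suc N) - half_cot n N) * (1 - ?c (Suc N))\<bar> \<le> 1 / real n * 2"
    unfolding abs_mult using half_cot_diff[OF assms(1), of N] cos_average_abs_le[OF assms(3,4), of n "Suc N"] by (intro mult_mono) auto
  also have "\<bar>half_cot n N * (?c (Suc N) - ?c N)\<bar> \<le> (real N / (2 * real n)) * (7 * real n * real X / (real N)\<^sup>2)"
    unfolding abs_mult using half_cot_bounds[OF assms(1), of N] cos_average_diff[OF assms(2-4), of n] by (intro mult_mono) auto
  also have "\<dots> = (7 / 2) * real X / real N" using assms by (simp add: field_simps power2_eq_square)
  also have "\<dots> \<le> 4 * real X / real N" by (intro divide_right_mono mult_right_mono) auto
  finally show ?thesis using True by simp
next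
  case False
  then have "\<bar>dual_kernel X W Z n (Suc N) - dual_kernel X W Z n N\<bar> \<le> 1 / real n" using half_cot_diff[OF assms(1)] by (simp add: dual_kernel_def)
  also have "\<dots> \<le> 2 / real n" by (intro divide_right_mono) auto
  finally show ?thesis using False by simp
qed

text \<open>For n X <= N / 2 every phase is at most pi, and 1 - cos is twice a squared sine, bounded
  below linearly. As all lengths in the window are at least X / 2, it is at least 2 (n X / N)^2. The
  cotangent supplies N / (5 n).\<close>

lemma dual_kernel_lower:
  assumes "1 \<le> n" "4 * n \<le> N" "2 * n * X \<le> N" "real n \<le> Z" "W \<ge> 1" "2 * W \<le> X"
  shows "dual_kernel X W Z n N \<ge> 2 * real n * (real X)\<^sup>2 / (5 * real N)"
proof -
  have N0: "real N > 0" using assms by simp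
  let ?z = "real n / real N"
  have z: "0 < ?z" "?z \<le> 1/4" using assms N0 by (auto simp: field_simps)
  have k: "real N / (5 * real n) \<le> half_cot n N"
  proof -
    have "pi * ?z \<le> pi * (1/4)" using z by (intro mult_left_mono) auto
    then have "cos (pi/4) \<le> cos (pi * ?z)" using z by (intro cos_monotone_0_pi_le) auto
    moreover have "cos (pi/4) \<ge> 7/10" unfolding cos_45
      using real_le_rsqrt[of "7/5" 2] by (simp add: power2_eq_square)
    ultimately have c: "7/10 \<le> cos (pi * ?z)" by linarith
    have s: "sin (pi * ?z) \<le> pi * ?z" using z by (intro sin_x_le_x) auto
    have s0: "0 < sin (pi * ?z)" using sin_frac(2)[OF assms(1), of N] assms(2) by simp
    have "(7/10) / (pi * ?z) \<le> cos (pi * ?z) / sin (pi * ?z)" using c s s0 by (intro frac_le) auto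
    moreover have "(7/10) / (pi * ?z) \<ge> (7/10) / ((7/2) * ?z)" using z pi_approx by (intro divide_left_mono mult_right_mono mult_pos_pos) auto
    moreover have "(7/10) / ((7/2) * ?z) = real N / (5 * real n)" using assms(1) N0 by (simp add: field_simps)
    ultimately show ?thesis using assms by (simp add: half_cot_def)
  qed
  have one: "cos (2 * pi * (real n * real Y) / real N) \<le> 1 - 2 * (real n * real X / real N)\<^sup>2" if Y: "Y \<in> {X-W<..X}" for Y
  proof -
    let ?s = "real n * real Y / real N"
    have "real X / 2 \<le> real Y" using Y assms(6) by auto
    then have "real n * (real X / 2) / real N \<le> ?s" by (intro divide_right_mono mult_left_mono) auto
    then have s1: "real n * real X / real N / 2 \<le> ?s" by simp
    have "real (2 * n * Y) \<le> real N" using Y assms(3) by (meson greaterThanAtMost_iff le_trans mult_le_mono2 of_nat_mono)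
    then have s2: "?s \<le> 1/2" using N0 by (simp add: field_simps)
    have "2 * ?s \<le> sin (pi * ?s)" using s2 by (intro sin_pi_ge) auto
    moreover have h: "a / 2 \<le> s \<Longrightarrow> 2 * s \<le> t \<Longrightarrow> a \<le> t" for a s t :: real by linarith
    ultimately have "real n * real X / real N \<le> sin (pi * ?s)" by (intro h[OF s1])
    then have "(real n * real X / real N)\<^sup>2 \<le> (sin (pi * ?s))\<^sup>2" by (intro power_mono) auto
    moreover have "cos (2 * (pi * ?s)) = 1 - 2 * (sin (pi * ?s))\<^sup>2" by (rule cos_double_sin)
    moreover have "2 * pi * (real n * real Y) / real N = 2 * (pi * ?s)" by simp
    ultimately show ?thesis by (simp only:)
  qed
  have "(\<Sum>Y\<in>{X-W<..X}. cos (2 * pi * (real n * real Y) / real N)) \<le> (\<Sum>Y\<in>{X-W<..X}. 1 - 2 * (real n * real X / real N)\<^sup>2)"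
    by (intro sum_mono one)
  also have "\<dots> = real W * (1 - 2 * (real n * real X / real N)\<^sup>2)" using assms by simp
  finally have "cos_average X W n N \<le> 1 - 2 * (real n * real X / real N)\<^sup>2"
    using assms(5) unfolding cos_average_def by (simp add: pos_divide_le_eq mult.commute)
  then have "2 * (real n * real X / real N)\<^sup>2 \<le> 1 - cos_average X W n N" by simp
  then have "(real N / (5 * real n)) * (2 * (real n * real X / real N)\<^sup>2) \<le> half_cot n N * (1 - cos_average X W n N)"
    using k by (intro mult_mono order_trans[OF _ k]) auto
  moreover have "(real N / (5 * real n)) * (2 * (real n * real X / real N)\<^sup>2) = 2 * real n * (real X)\<^sup>2 / (5 * real N)"
    using assms(1) N0 by (simp add: field_simps power2_eq_square)
  ultimately show ?thesis using assms(4) by (simp add: dual_kernel_def)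
qed

text \<open>Each symbol is replaced by its sine expansion \<open>sin_transform\<close>, and
  \<open>sum_sin_even\<close> sums over n. Its last term is again a sine expansion and yields half
  the symbol at X. Symbol and cotangent are both odd under t to N - t, so folding doubles the sum
  over t < N / 2.\<close>

lemma dual_formula:
  assumes "N mod 16 = 7" "squarefree N" "N \<ge> 100" "N \<le> 2 * Y + 1"
  shows "sqrt (real N) * ((\<Sum>n=1..X. real_of_int (jac (int n) N)) - real_of_int (jac (int X) N) / 2)
    = (\<Sum>n=1..Y. real_of_int (jac (int n) N) * (half_cot n N * (1 - cos (2 * pi * (real n * real X) / real N))))"
proof -
  let ?J = "\<lambda>t. real_of_int (jac t N)"
  have o: "odd N" "N mod 4 = 3" using assms mod16_7D by auto
  have N0: "N > 0" using assms by simp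
  define H where "H = (N - 1) div 2"
  have H: "N = 2 * H + 1" unfolding H_def using o(1) by simp
  have J0: "jac 0 N = 0" using assms by (simp add: jac_eq_0_iff)
  have split0: "{0..<int N} = insert 0 {1..<int N}" using N0 by auto
  let ?th = "\<lambda>t. pi * real_of_int t / real N"
  let ?c = "\<lambda>t. cos (?th t) / sin (?th t) * (1 - cos (2 * real X * ?th t))"
  have trm: "(\<Sum>n=1..X. sin (2 * pi * real_of_int (int n * t) / real N)) = ?c t / 2 + sin (2 * pi * real_of_int (int X * t) / N) / 2"
    if t: "t \<in> {1..<int N}" for t
  proof -
    have s: "sin (?th t) > 0"
    proof (rule sin_gt_zero)
      have "real_of_int t < real N" using t by auto
      then have "pi * real_of_int t < pi * real N" by (intro mult_strict_left_mono) auto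
      then show "?th t < pi" using N0 by (simp add: pos_divide_less_eq)
    qed (use t N0 in auto)
    have e: "2 * pi * real_of_int (int n * t) / real N = 2 * real n * ?th t" for n by simp
    show ?thesis using sum_sin_even[of "?th t" X] s unfolding e by (simp add: field_simps)
  qed
  have "sqrt (real N) * (\<Sum>n=1..X. ?J (int n)) = (\<Sum>n=1..X. ?J (int n) * sqrt (real N))"
    by (simp add: sum_distrib_left mult.commute)
  also have "\<dots> = (\<Sum>n=1..X. \<Sum>t\<in>{0..<int N}. ?J t * sin (2 * pi * real_of_int (int n * t) / N))"
    by (simp only: sin_transform[OF assms(1-3)])
  also have "\<dots> = (\<Sum>t\<in>{0..<int N}. ?J t * (\<Sum>n=1..X. sin (2 * pi * real_of_int (int n * t) / N)))"
    by (subst sum.swap) (simp only: sum_distrib_left)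
  also have "\<dots> = (\<Sum>t\<in>{1..<int N}. ?J t * (\<Sum>n=1..X. sin (2 * pi * real_of_int (int n * t) / N)))"
    unfolding split0 using J0 by simp
  also have "\<dots> = (\<Sum>t\<in>{1..<int N}. ?J t * ?c t / 2 + ?J t * sin (2 * pi * real_of_int (int X * t) / N) / 2)"
    by (intro sum.cong refl) (simp only: trm, simp add: distrib_left)
  also have "\<dots> = (\<Sum>t\<in>{1..<int N}. ?J t * ?c t) / 2 + (\<Sum>t\<in>{1..<int N}. ?J t * sin (2 * pi * real_of_int (int X * t) / N)) / 2"
    by (simp only: sum.distrib sum_divide_distrib)
  also have "(\<Sum>t\<in>{1..<int N}. ?J t * sin (2 * pi * real_of_int (int X * t) / N)) = ?J (int X) * sqrt (real N)"
    using sin_transform[OF assms(1-3), of "int X"] unfolding split0 using J0 by simp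
  also have "(\<Sum>t\<in>{1..<int N}. ?J t * ?c t) = 2 * (\<Sum>t\<in>{1..int H}. ?J t * ?c t)"
  proof -
    have "{1..<int N} = {1..int H} \<union> {int H + 1..<int N}" using H by auto
    then have "(\<Sum>t\<in>{1..<int N}. ?J t * ?c t) = (\<Sum>t\<in>{1..int H}. ?J t * ?c t) + (\<Sum>t\<in>{int H + 1..<int N}. ?J t * ?c t)"
      by (simp only:) (rule sum.union_disjoint, auto)
    also have "(\<Sum>t\<in>{int H + 1..<int N}. ?J t * ?c t) = (\<Sum>t\<in>{1..int H}. ?J t * ?c t)"
    proof (rule sum.reindex_bij_witness[of _ "\<lambda>t. int N - t" "\<lambda>t. int N - t"])
      fix t assume t: "t \<in> {int H + 1..<int N}"
      show "int N - (int N - t) = t" "int N - t \<in> {1..int H}" using t H by auto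
      have "jac (int N - t) N = jac (-1 * t) N" by (rule jac_cong) (simp add: cong_iff_dvd_diff)
      then have j: "jac (int N - t) N = - jac t N" using jac_minus_one[OF o(1)] o(2) by (simp only: jac_mult_left[OF o(1)]) simp
      have th: "?th (int N - t) = pi - ?th t" using N0 by (simp add: field_simps)
      have "2 * real X * (pi - ?th t) = 2 * real X * pi - 2 * real X * ?th t" by (rule right_diff_distrib)
      then have "cos (2 * real X * (pi - ?th t)) = cos (2 * real X * ?th t)"
        by (simp only: cos_diff cos_2npi sin_2npi)
      then show "?J (int N - t) * ?c (int N - t) = ?J t * ?c t" unfolding th j by simp
    qed (use H in auto)
    finally show ?thesis by simp
  qed
  also have "(\<Sum>t\<in>{1..int H}. ?J t * ?c t) = (\<Sum>n=1..H. ?J (int n) * (half_cot n N * (1 - cos (2 * pi * (real n * real X) / real N))))"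
    by (rule sum.reindex_bij_witness[of _ int nat]) (use H in \<open>auto simp: half_cot_def mult_ac\<close>)
  also have "\<dots> = (\<Sum>n=1..Y. ?J (int n) * (half_cot n N * (1 - cos (2 * pi * (real n * real X) / real N))))"
    by (rule sum.mono_neutral_left) (use H assms(4) in \<open>auto simp: half_cot_def\<close>)
  finally show ?thesis by (simp add: algebra_simps)
qed

lemma sum_inverse_squares_tail:
  assumes "1 \<le> a" shows "(\<Sum>n\<in>{a<..b}. 1 / (real n)\<^sup>2) \<le> 1 / real a"
proof -
  have tel: "(\<Sum>n\<in>{a<..b}. 1 / (real n)\<^sup>2) \<le> 1 / real a - 1 / real b" if "a \<le> b" for b
    using that
  proof (induction b rule: dec_induct)
    case (step m)
    have "{a<..Suc m} = insert (Suc m) {a<..m}" using step by auto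
    moreover have "1 / (real (Suc m))\<^sup>2 \<le> 1 / real m - 1 / real (Suc m)"
    proof -
      have m: "real m > 0" using step assms by simp
      have "1 / real m - 1 / real (Suc m) = 1 / (real m * real (Suc m))" using m by (simp add: field_simps)
      moreover have "1 / (real (Suc m))\<^sup>2 \<le> 1 / (real m * real (Suc m))"
        unfolding power2_eq_square using m by (intro divide_left_mono mult_right_mono mult_pos_pos) auto
      ultimately show ?thesis by simp
    qed
    ultimately show ?case using step by simp
  qed simp
  have "1 / real b \<ge> 0" by simp
  then have "a \<le> b \<Longrightarrow> ?thesis" using tel[of b] by linarith
  then show ?thesis by (cases "a \<le> b") auto
qed

text \<open>\<open>dual_formula\<close> is averaged over the lengths in the window, each of which
  changes the character sum by at most W. Beyond Z the omitted oscillation is at most N^2 / (4 W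
  n^2), by \<open>cos_average_decay\<close>, and the tail of the inverse squares gives the last
  term.\<close>

lemma dual_lower:
  assumes "N mod 16 = 7" "squarefree N" "N \<ge> 100" "N \<le> 2 * Y + 1" "W \<ge> 1" "W \<le> X" "Z \<ge> 1"
  shows "(\<Sum>n=1..Y. dual_kernel X W Z n N * real_of_int (jac (int n) N))
    \<le> sqrt (real N) * ((\<Sum>n=1..X. real_of_int (jac (int n) N)) + real W + 1) + (real N)\<^sup>2 / (2 * real W * Z)"
proof -
  let ?J = "\<lambda>t. real_of_int (jac (int t) N)"
  let ?S = "\<lambda>X. \<Sum>n=1..X. ?J n"
  let ?I = "{X-W<..X}"
  have cI: "real (card ?I) = real W" using assms by simp
  have fin: "finite ?I" by simp
  have S: "?S Y' - ?J Y' / 2 \<le> ?S X + real W + 1" if "Y' \<in> ?I" for Y'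
  proof -
    have "{1..X} = {1..Y'} \<union> {Y'<..X}" using that by auto
    then have "?S X = ?S Y' + (\<Sum>n\<in>{Y'<..X}. ?J n)" by (simp only:) (rule sum.union_disjoint, auto)
    moreover have "\<bar>\<Sum>n\<in>{Y'<..X}. ?J n\<bar> \<le> (\<Sum>n\<in>{Y'<..X}. 1)"
      by (intro order_trans[OF sum_abs] sum_mono jac_abs_le)
    moreover have "(\<Sum>n\<in>{Y'<..X}. 1) \<le> real W" using that assms by auto
    moreover have "\<bar>?J Y'\<bar> \<le> 1" by (rule jac_abs_le)
    ultimately show ?thesis by linarith
  qed
  have "(\<Sum>n=1..Y. ?J n * (half_cot n N * (1 - cos_average X W n N))) = (\<Sum>Y'\<in>?I. sqrt (real N) * (?S Y' - ?J Y' / 2)) / real W"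
  proof -
    have "(\<Sum>Y'\<in>?I. sqrt (real N) * (?S Y' - ?J Y' / 2)) = (\<Sum>Y'\<in>?I. \<Sum>n=1..Y. ?J n * (half_cot n N * (1 - cos (2 * pi * (real n * real Y') / real N))))"
      by (simp only: dual_formula[OF assms(1-4)])
    also have "\<dots> = (\<Sum>n=1..Y. \<Sum>Y'\<in>?I. ?J n * (half_cot n N * (1 - cos (2 * pi * (real n * real Y') / real N))))"
      by (rule sum.swap)
    also have "\<dots> = (\<Sum>n=1..Y. real W * (?J n * (half_cot n N * (1 - cos_average X W n N))))"
    proof (intro sum.cong refl)
      fix n
      have "(\<Sum>Y'\<in>?I. 1 - cos (2 * pi * (real n * real Y') / real N)) = real W * (1 - cos_average X W n N)"
        using assms(5) cI by (simp add: sum_subtractf cos_average_def field_simps)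
      then show "(\<Sum>Y'\<in>?I. ?J n * (half_cot n N * (1 - cos (2 * pi * (real n * real Y') / real N)))) = real W * (?J n * (half_cot n N * (1 - cos_average X W n N)))"
        by (simp add: sum_distrib_left[symmetric])
    qed
    also have "\<dots> = real W * (\<Sum>n=1..Y. ?J n * (half_cot n N * (1 - cos_average X W n N)))" by (simp only: sum_distrib_left)
    finally show ?thesis using assms(5) by simp
  qed
  also have "\<dots> \<le> (\<Sum>Y'\<in>?I. sqrt (real N) * (?S X + real W + 1)) / real W"
    by (intro divide_right_mono sum_mono mult_left_mono S) auto
  also have "\<dots> = sqrt (real N) * (?S X + real W + 1)" using assms(5) cI by simp
  finally have main: "(\<Sum>n=1..Y. ?J n * (half_cot n N * (1 - cos_average X W n N))) \<le> sqrt (real N) * (?S X + real W + 1)" .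
  define z where "z = nat \<lfloor>Z\<rfloor>"
  have z: "z \<ge> 1" "\<And>n. real n \<le> Z \<longleftrightarrow> n \<le> z" "real z \<ge> Z / 2"
  proof -
    show "z \<ge> 1" unfolding z_def using assms(7) by (simp add: le_nat_floor)
    show "real n \<le> Z \<longleftrightarrow> n \<le> z" for n unfolding z_def using assms(7) by (simp add: le_nat_iff le_floor_iff)
    have "real z = of_int \<lfloor>Z\<rfloor>" unfolding z_def using assms(7) by simp
    then have "real z > Z - 1" by linarith
    then show "real z \<ge> Z / 2" using \<open>z \<ge> 1\<close> by linarith
  qed
  have "(\<Sum>n=1..Y. dual_kernel X W Z n N * ?J n) - (\<Sum>n=1..Y. ?J n * (half_cot n N * (1 - cos_average X W n N)))
     = (\<Sum>n=1..Y. if n \<le> z then 0 else ?J n * (half_cot n N * cos_average X W n N))"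
    unfolding sum_subtractf[symmetric] by (intro sum.cong refl) (simp add: dual_kernel_def z(2) algebra_simps)
  also have "\<dots> = (\<Sum>n\<in>{z<..Y}. ?J n * (half_cot n N * cos_average X W n N))"
    by (rule sum.mono_neutral_cong_right) auto
  also have "\<dots> \<le> (\<Sum>n\<in>{z<..Y}. (real N)\<^sup>2 / (4 * real W) * (1 / (real n)\<^sup>2))"
  proof (intro sum_mono)
    fix n assume n: "n \<in> {z<..Y}"
    then have n1: "1 \<le> n" by simp
    have "\<bar>half_cot n N * cos_average X W n N\<bar> \<le> (real N)\<^sup>2 / (4 * real W) * (1 / (real n)\<^sup>2)"
    proof (cases "2 * n \<le> N")
      case True
      have "\<bar>half_cot n N * cos_average X W n N\<bar> \<le> real N / (2 * real n) * (real N / (2 * real n * real W))"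
        unfolding abs_mult using half_cot_bounds[OF n1, of N] cos_average_decay[OF n1 True assms(5), of X] by (intro mult_mono) auto
      then show ?thesis by (simp add: power2_eq_square mult_ac)
    qed (simp add: half_cot_def)
    moreover have "?J n * (half_cot n N * cos_average X W n N) \<le> \<bar>?J n\<bar> * \<bar>half_cot n N * cos_average X W n N\<bar>" by (metis abs_ge_self abs_mult)
    moreover have "\<bar>?J n\<bar> * \<bar>half_cot n N * cos_average X W n N\<bar> \<le> 1 * \<bar>half_cot n N * cos_average X W n N\<bar>" by (intro mult_right_mono jac_abs_le) auto
    ultimately show "?J n * (half_cot n N * cos_average X W n N) \<le> (real N)\<^sup>2 / (4 * real W) * (1 / (real n)\<^sup>2)" by linarith
  qed
  also have "\<dots> = (real N)\<^sup>2 / (4 * real W) * (\<Sum>n\<in>{z<..Y}. 1 / (real n)\<^sup>2)" by (simp only: sum_distrib_left)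
  also have "\<dots> \<le> (real N)\<^sup>2 / (4 * real W) * (1 / (Z / 2))"
  proof (intro mult_left_mono)
    have "(\<Sum>n\<in>{z<..Y}. 1 / (real n)\<^sup>2) \<le> 1 / real z" by (rule sum_inverse_squares_tail[OF z(1)])
    also have "\<dots> \<le> 1 / (Z / 2)" using z(3) assms(7) by (intro divide_left_mono mult_pos_pos) auto
    finally show "(\<Sum>n\<in>{z<..Y}. 1 / (real n)\<^sup>2) \<le> 1 / (Z / 2)" .
  qed simp
  also have "\<dots> = (real N)\<^sup>2 / (2 * real W * Z)" by simp
  finally show ?thesis using main by linarith
qed

section \<open>Chebyshev and Mertens estimates\<close>

lemma Suc_div_dvd: "d > 0 \<Longrightarrow> Suc n div d = n div d + (if d dvd Suc n then 1 else 0)"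
  by (simp add: div_Suc dvd_eq_mod_eq_0)

text \<open>The range d <= m, larger than d <= n, lets two factorials share one index range in
  \<open>ln_central_binomial\<close>.\<close>

lemma ln_fact_eq:
  assumes "n \<le> m" shows "ln (fact n) = (\<Sum>d=1..m. mangoldt d * real (n div d))"
  using assms
proof (induction n)
  case (Suc n)
  have "(\<Sum>d=1..m. mangoldt d * real (Suc n div d)) = (\<Sum>d=1..m. mangoldt d * real (n div d) + (if d dvd Suc n then mangoldt d else 0))"
    by (intro sum.cong refl) (auto simp: Suc_div_dvd algebra_simps)
  also have "\<dots> = ln (fact n) + (\<Sum>d=1..m. if d dvd Suc n then mangoldt d else 0)"
    using Suc by (simp add: sum.distrib)
  also have "(\<Sum>d=1..m. if d dvd Suc n then mangoldt d else 0) = (\<Sum>d | d dvd Suc n. mangoldt d)"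
  proof -
    have "{d \<in> {1..m}. d dvd Suc n} = {d. d dvd Suc n}"
      using Suc.prems by (auto simp: Suc_le_eq dest: dvd_imp_le intro!: Nat.gr0I)
    then show ?thesis by (simp add: sum.inter_filter[symmetric])
  qed
  also have "\<dots> = ln (real (Suc n))" by (subst mangoldt_sum) auto
  also have "ln (fact n) + ln (real (Suc n)) = ln (fact (Suc n))"
    by (simp add: ln_mult fact_gt_zero add.commute)
  finally show ?case ..
qed simp

lemma ln_fact_ge: "ln (fact n) \<ge> real n * ln (real n) - real n"
proof (induction n)
  case (Suc n)
  show ?case
  proof (cases "n = 0")
    case False
    then have n: "real n > 0" by simp
    have "ln (1 + 1 / real n) \<le> 1 / real n" by (rule ln_add_one_self_le_self) simp
    moreover have "1 + 1 / real n = real (Suc n) / real n" using n by (simp add: field_simps)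
    ultimately have "ln (real (Suc n)) - ln (real n) \<le> 1 / real n" using n by (simp add: ln_div)
    then have "real n * (ln (real (Suc n)) - ln (real n)) \<le> real n * (1 / real n)" using n by (intro mult_left_mono) auto
    then have "real n * ln (real (Suc n)) - real n * ln (real n) \<le> 1" using n by (simp add: right_diff_distrib)
    moreover have "ln (fact (Suc n)) = ln (real (Suc n)) + ln (fact n)" by (simp add: ln_mult fact_gt_zero)
    moreover have "real (Suc n) * ln (real (Suc n)) = real n * ln (real (Suc n)) + ln (real (Suc n))" by (simp add: algebra_simps)
    ultimately show ?thesis using Suc by simp
  qed simp
qed simp

lemma ln_central_binomial:
  "ln (real ((2 * n) choose n)) = (\<Sum>d=1..2*n. mangoldt d * (real ((2 * n) div d) - 2 * real (n div d)))"
proof -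
  have "real ((2 * n) choose n) = fact (2 * n) / (fact n * fact n)"
    using binomial_fact[of n "2 * n", where 'a = real] by (simp add: mult_2)
  then have "ln (real ((2 * n) choose n)) = ln (fact (2 * n)) - 2 * ln (fact n)"
    by (simp add: ln_div ln_mult fact_gt_zero)
  also have "\<dots> = (\<Sum>d=1..2*n. mangoldt d * real ((2 * n) div d)) - 2 * (\<Sum>d=1..2*n. mangoldt d * real (n div d))"
    using ln_fact_eq[of "2 * n" "2 * n"] ln_fact_eq[of n "2 * n"] by simp
  also have "\<dots> = (\<Sum>d=1..2*n. mangoldt d * (real ((2 * n) div d) - 2 * real (n div d)))"
    by (simp only: sum_distrib_left sum_subtractf[symmetric]) (simp add: algebra_simps)
  finally show ?thesis .
qed

lemma double_div_bounds:
  fixes n d :: nat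
  assumes "d > 0"
  shows "0 \<le> real ((2 * n) div d) - 2 * real (n div d)" "real ((2 * n) div d) - 2 * real (n div d) \<le> 1"
proof -
  have e: "d * (n div d) + n mod d = n" by simp
  have m: "n mod d < d" using assms by simp
  have "2 * (n div d) \<le> (2 * n) div d"
  proof -
    have "d * (2 * (n div d)) \<le> 2 * n" using e by linarith
    then show ?thesis using assms by (simp add: less_eq_div_iff_mult_less_eq mult.commute)
  qed
  moreover have "(2 * n) div d \<le> 2 * (n div d) + 1"
  proof -
    have "d * (2 * (n div d) + 2) = 2 * (d * (n div d)) + 2 * d" by (simp add: algebra_simps)
    then have "2 * n < d * (2 * (n div d) + 2)" using e m by linarith
    then have "(2 * n) div d < 2 * (n div d) + 2" using assms by (simp add: div_less_iff_less_mult mult.commute)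
    then show ?thesis by simp
  qed
  ultimately show "0 \<le> real ((2 * n) div d) - 2 * real (n div d)" "real ((2 * n) div d) - 2 * real (n div d) \<le> 1"
    by linarith+
qed

text \<open>In \<open>ln_central_binomial\<close> the bracket is 1 for n < d <= 2 n and never
  negative, and the binomial coefficient is at most 4^n.\<close>

lemma psi_dyadic_upper: "(\<Sum>d\<in>{n<..2*n}. mangoldt d) \<le> 2 * real n * ln 2"
proof -
  have "(\<Sum>d\<in>{n<..2*n}. mangoldt d) = (\<Sum>d\<in>{n<..2*n}. mangoldt d * (real ((2 * n) div d) - 2 * real (n div d)))"
  proof (intro sum.cong refl)
    fix d assume d: "d \<in> {n<..2*n}"
    then have "n div d = 0" "(2 * n) div d = 1" by (auto simp: div_nat_eqI)
    then show "mangoldt d = mangoldt d * (real ((2 * n) div d) - 2 * real (n div d))" by simp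
  qed
  also have "\<dots> \<le> (\<Sum>d=1..2*n. mangoldt d * (real ((2 * n) div d) - 2 * real (n div d)))"
    by (rule sum_mono2) (auto intro!: mult_nonneg_nonneg mangoldt_nonneg double_div_bounds(1))
  also have "\<dots> = ln (real ((2 * n) choose n))" by (simp only: ln_central_binomial)
  also have "\<dots> \<le> ln (2 ^ (2 * n))"
  proof (rule ln_mono)
    show "real ((2 * n) choose n) \<le> 2 ^ (2 * n)" using binomial_le_pow2[of "2 * n" n] by (metis of_nat_le_iff of_nat_numeral of_nat_power)
  qed simp_all
  also have "\<dots> = 2 * real n * ln 2" by (simp add: ln_realpow)
  finally show ?thesis .
qed

text \<open>The brackets in \<open>ln_central_binomial\<close> are at most 1, and the central
  binomial coefficient is at least 4^n / (2 n).\<close>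

lemma psi_lower:
  assumes "n > 0" shows "real n * ln 4 - ln (2 * real n) \<le> (\<Sum>d=1..2*n. mangoldt d)"
proof -
  have "real n * ln 4 - ln (2 * real n) = ln (4 ^ n / (2 * real n))" using assms by (simp add: ln_div ln_realpow)
  also have "\<dots> \<le> ln (real ((2 * n) choose n))"
    using central_binomial_lower_bound[OF assms] assms by (intro ln_mono) (auto simp: divide_simps)
  also have "\<dots> = (\<Sum>d=1..2*n. mangoldt d * (real ((2 * n) div d) - 2 * real (n div d)))" by (rule ln_central_binomial)
  also have "\<dots> \<le> (\<Sum>d=1..2*n. mangoldt d * 1)"
    by (intro sum_mono mult_left_mono double_div_bounds(2) mangoldt_nonneg) auto
  finally show ?thesis by simp
qed

lemma psi_lower':
  assumes "Y \<ge> 100" shows "real Y / 3 \<le> (\<Sum>d=1..Y. mangoldt d)"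
proof -
  define n where "n = Y div 2"
  have n: "2 * n \<le> Y" "Y \<le> 2 * n + 1" "n \<ge> 50" unfolding n_def using assms by linarith+
  have "ln (4::real) \<ge> 1" using exp_le by (subst ln_ge_iff) auto
  moreover have "ln (2 * real n) \<le> real n / 4"
  proof -
    \<comment> \<open>Tangent to the logarithm at 20, with slope small enough to stay below n / 4
      for n >= 50.\<close>
    have "ln (2 * real n / 20) \<le> 2 * real n / 20 - 1" using n by (intro ln_le_minus_one) auto
    moreover have "ln (2 * real n / 20) = ln (2 * real n) - ln 20" using n by (subst ln_div) auto
    moreover have "ln (20::real) \<le> 5"
    proof -
      have "(20::real) \<le> 2 ^ 5" by simp
      also have "\<dots> \<le> exp 1 ^ 5" using exp_ge_add_one_self[of 1] by (intro power_mono) auto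
      also have "exp (1::real) ^ 5 = exp 5" by (simp add: exp_of_nat_mult[symmetric])
      finally have "ln 20 \<le> ln (exp (5::real))" by (intro ln_mono) auto
      then show ?thesis by simp
    qed
    ultimately have "ln (2 * real n) \<le> 4 + real n / 10" by linarith
    also have "\<dots> \<le> real n / 4" using n(3) by linarith
    finally show ?thesis .
  qed
  ultimately have "real n * 1 - real n / 4 \<le> real n * ln 4 - ln (2 * real n)"
    by (intro diff_mono mult_left_mono) auto
  also have "\<dots> \<le> (\<Sum>d=1..2*n. mangoldt d)" using n by (intro psi_lower) auto
  also have "\<dots> \<le> (\<Sum>d=1..Y. mangoldt d)" using n by (intro sum_mono2) (auto intro: mangoldt_nonneg)
  finally have "3 / 4 * real n \<le> (\<Sum>d=1..Y. mangoldt d)" by simp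
  moreover have "real Y / 3 \<le> 3 / 4 * real n" using n by linarith
  ultimately show ?thesis by linarith
qed

lemma card_prime_factors_le:
  assumes "N > 0" shows "2 ^ card (prime_factors N) \<le> (N::nat)"
proof -
  have "2 ^ card (prime_factors N) = (\<Prod>p\<in>prime_factors N. 2::nat)" by simp
  also have "\<dots> \<le> \<Prod>(prime_factors N)" 
  proof (intro prod_mono conjI)
    fix p assume "p \<in> prime_factors N"
    then have "prime p" by auto
    then show "2 \<le> p" by (rule prime_ge_2_nat)
  qed auto
  also have "\<dots> \<le> N" using assms by (intro dvd_imp_le prod_primes_dvd) auto
  finally show ?thesis .
qed

text \<open>Chebyshev gives at least Y / (3 ln Y) prime powers up to Y. Those not coprime to N are
  powers, with exponent below K, of one of the fewer than R prime factors of N. Losing a logarithm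
  is affordable, and the bound holds for every N.\<close>

lemma card_coprime_ge:
  assumes "Y \<ge> 100" "N > 0" "Y < 2 ^ K" "N < 2 ^ R"
  shows "real Y / (3 * ln (real Y)) - real (R * K) \<le> real (card {l\<in>{1..Y}. coprime l N})"
proof -
  let ?P = "{l\<in>{1..Y}. primepow l}"
  have lnY: "ln (real Y) > 0" using assms by simp
  have "real Y / 3 \<le> (\<Sum>d=1..Y. mangoldt d)" by (rule psi_lower'[OF assms(1)])
  also have "\<dots> = (\<Sum>d\<in>?P. mangoldt d)" by (rule sum.mono_neutral_right) (auto simp: mangoldt_def)
  also have "\<dots> \<le> (\<Sum>d\<in>?P. ln (real Y))"
  proof (intro sum_mono)
    fix d assume "d \<in> ?P"
    then have "mangoldt d \<le> ln (real d)" "ln (real d) \<le> ln (real Y)" by (auto intro!: mangoldt_le)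
    then show "mangoldt d \<le> ln (real Y)" by linarith
  qed
  finally have "real Y / 3 \<le> real (card ?P) * ln (real Y)" by simp
  then have 1: "real Y / (3 * ln (real Y)) \<le> real (card ?P)" using lnY by (simp add: field_simps)
  let ?B = "{l\<in>?P. \<not> coprime l N}"
  have "?B \<subseteq> (\<lambda>(p, k). p ^ k) ` (prime_factors N \<times> {..<K})"
  proof
    fix l assume l: "l \<in> ?B"
    then have "primepow l" by auto
    then obtain p k where pk: "prime p" "k > 0" "l = p ^ k" by (auto simp: primepow_def)
    have "\<not> coprime p N" using l pk by (auto simp: coprime_power_left_iff)
    then have "p dvd N" using pk(1) prime_imp_coprime by blast
    then have "p \<in> prime_factors N" using pk(1) assms(2) by (simp add: in_prime_factors_iff)
    moreover have "(2::nat) ^ k < 2 ^ K"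
    proof -
      have "(2::nat) ^ k \<le> p ^ k" using pk(1) prime_ge_2_nat by (intro power_mono) auto
      also have "\<dots> \<le> Y" using l pk(3) by auto
      finally show ?thesis using assms(3) by linarith
    qed
    then have "k < K" by simp
    ultimately show "l \<in> (\<lambda>(p, k). p ^ k) ` (prime_factors N \<times> {..<K})" using pk(3) by auto
  qed
  then have "card ?B \<le> card (prime_factors N \<times> {..<K})"
    using surj_card_le[of "prime_factors N \<times> {..<K}"] by simp
  also have "\<dots> = card (prime_factors N) * K" by simp
  also have "\<dots> \<le> R * K"
  proof -
    have "(2::nat) ^ card (prime_factors N) < 2 ^ R" using card_prime_factors_le[OF assms(2)] assms(4) by linarith
    then show ?thesis by (intro mult_le_mono) auto
  qed
  finally have 2: "card ?B \<le> R * K" .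
  have "card ((?P - ?B) \<union> ?B) = card (?P - ?B) + card ?B" by (rule card_Un_disjoint) auto
  moreover have "(?P - ?B) \<union> ?B = ?P" by auto
  ultimately have "card ?P = card (?P - ?B) + card ?B" by simp
  moreover have "card (?P - ?B) \<le> card {l\<in>{1..Y}. coprime l N}" by (rule card_mono) auto
  ultimately show ?thesis using 1 2 by linarith
qed

lemma sum_mangoldt_lower:
  assumes "n > 0" shows "ln (real n) - 1 \<le> (\<Sum>d=1..n. mangoldt d / real d)"
proof -
  have "real n * ln (real n) - real n \<le> (\<Sum>d=1..n. mangoldt d * real (n div d))"
    using ln_fact_ge[of n] ln_fact_eq[of n n] by simp
  also have "\<dots> \<le> (\<Sum>d=1..n. real n * (mangoldt d / real d))"
  proof (intro sum_mono)
    fix d assume "d \<in> {1..n}"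
    have "real (n div d) \<le> real n / real d" using div_real_bounds(1)[of "int d" "int n"] \<open>d \<in> {1..n}\<close> by (simp flip: of_nat_div)
    then have "mangoldt d * real (n div d) \<le> mangoldt d * (real n / real d)" by (intro mult_left_mono mangoldt_nonneg)
    then show "mangoldt d * real (n div d) \<le> real n * (mangoldt d / real d)" by (simp add: mult.commute)
  qed
  also have "\<dots> = real n * (\<Sum>d=1..n. mangoldt d / real d)" by (simp only: sum_distrib_left)
  finally have "real n * (ln (real n) - 1) \<le> real n * (\<Sum>d=1..n. mangoldt d / real d)" by (simp add: algebra_simps)
  then show ?thesis using assms by simp
qed

text \<open>Each dyadic block contributes at most 2 ln 2. The resulting constant 2 in place of the
  true 1 is the reason for the long interval in \<open>sum_prime_reciprocals_ge\<close>.\<close>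

lemma sum_mangoldt_pow2: "(\<Sum>d=1..2^J. mangoldt d / real d) \<le> 2 * real J * ln 2"
proof (induction J)
  case (Suc J)
  have "{1..2^Suc J} = {1..2^J} \<union> {2^J<..2 * (2^J::nat)}" by auto
  then have "(\<Sum>d=1..2^Suc J. mangoldt d / real d) = (\<Sum>d=1..2^J. mangoldt d / real d) + (\<Sum>d\<in>{2^J<..2 * 2^J}. mangoldt d / real d)"
    by (simp only:) (rule sum.union_disjoint, auto)
  also have "(\<Sum>d\<in>{2^J<..2 * (2^J::nat)}. mangoldt d / real d) \<le> (\<Sum>d\<in>{2^J<..2 * (2^J::nat)}. mangoldt d / 2^J)"
  proof (intro sum_mono)
    fix d :: nat assume "d \<in> {2^J<..2 * 2^J}"
    then have "real (2 ^ J) \<le> real d" by (intro of_nat_mono) auto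
    then show "mangoldt d / real d \<le> mangoldt d / 2 ^ J" by (intro divide_left_mono mangoldt_nonneg mult_pos_pos) (auto intro: less_le_trans[of 0 "2 ^ J"])
  qed
  also have "\<dots> = (\<Sum>d\<in>{2^J<..2 * (2^J::nat)}. mangoldt d) / 2^J" by (simp only: sum_divide_distrib)
  also have "\<dots> \<le> (2 * real (2^J) * ln 2) / 2^J" by (intro divide_right_mono psi_dyadic_upper) auto
  finally show ?case using Suc by (simp add: algebra_simps)
qed simp

lemma sum_mangoldt_upper:
  assumes "n > 0" shows "(\<Sum>d=1..n. mangoldt d / real d) \<le> 2 * ln (real n) + 2"
proof -
  define J where "J = nat \<lceil>log 2 (real n)\<rceil>"
  have l: "log 2 (real n) \<ge> 0" using assms by simp
  have J: "log 2 (real n) \<le> real J" "real J \<le> log 2 (real n) + 1"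
    unfolding J_def using l by linarith+
  have "real n = 2 powr (log 2 (real n))" using assms by simp
  also have "\<dots> \<le> 2 powr (real J)" using J by (intro powr_mono) auto
  also have "\<dots> = real (2 ^ J)" by (simp add: powr_realpow)
  finally have "n \<le> 2 ^ J" by (simp only: of_nat_le_iff)
  then have "(\<Sum>d=1..n. mangoldt d / real d) \<le> (\<Sum>d=1..2^J. mangoldt d / real d)"
    by (intro sum_mono2) (auto intro!: divide_nonneg_nonneg mangoldt_nonneg)
  also have "\<dots> \<le> 2 * real J * ln 2" by (rule sum_mangoldt_pow2)
  also have "\<dots> \<le> 2 * (log 2 (real n) + 1) * ln 2" using J by (intro mult_right_mono) auto
  also have "\<dots> = 2 * ln (real n) + 2 * ln 2" by (simp add: log_def field_simps)
  also have "\<dots> \<le> 2 * ln (real n) + 2" using ln_2_less_1 by simp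
  finally show ?thesis .
qed

text \<open>Bases run over all integers p >= 2. The exponents k >= 2 sum to at most 2 ln p / p^2,
  and ln p <= 2 sqrt p gives the convergent majorant \<open>g\<close>.\<close>

lemma sum_nonprime_primepow_bounded:
  "\<exists>C. \<forall>n. (\<Sum>d\<in>{d\<in>{1..n}. \<not> prime d}. mangoldt d / real d) \<le> C"
proof -
  define g where "g p = 4 * real p powr (-3/2)" for p :: nat
  have "summable (\<lambda>p. 4 * real p powr (-3/2))"
    by (intro summable_mult) (simp add: summable_real_powr_iff)
  then have sg: "summable g" unfolding g_def .
  have g0: "g p \<ge> 0" for p by (simp add: g_def)
  have "(\<Sum>d\<in>{d\<in>{1..n}. \<not> prime d}. mangoldt d / real d) \<le> suminf g" for n
  proof -
    let ?A = "{d\<in>{1..n}. \<not> prime d \<and> primepow d}"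
    let ?I = "{2..n} \<times> {2..n}"
    have "(\<Sum>d\<in>{d\<in>{1..n}. \<not> prime d}. mangoldt d / real d) = (\<Sum>d\<in>?A. mangoldt d / real d)"
      by (rule sum.mono_neutral_right) (auto simp: mangoldt_def)
    also have "\<dots> \<le> (\<Sum>x\<in>?I. ln (real (fst x)) / real (fst x ^ snd x))"
    proof (rule sum_le_included[where i = "\<lambda>x. fst x ^ snd x"])
      show "\<forall>x\<in>?I. 0 \<le> ln (real (fst x)) / real (fst x ^ snd x)" by (auto intro!: divide_nonneg_nonneg)
      show "\<forall>d\<in>?A. \<exists>x\<in>?I. fst x ^ snd x = d \<and> mangoldt d / real d \<le> ln (real (fst x)) / real (fst x ^ snd x)"
      proof
        fix d assume d: "d \<in> ?A"
        then obtain p k where pk: "prime p" "k > 0" "d = p ^ k" by (auto simp: primepow_def)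
        have "k \<noteq> 1" using d pk by auto
        then have k: "k \<ge> 2" using pk by simp
        have p2: "p \<ge> 2" using pk prime_ge_2_nat by blast
        have "p \<le> p ^ k" using power_increasing[of 1 k p] p2 k by simp
        moreover have "k \<le> p ^ k" using p2 less_exp[of k] power_mono[of 2 p k] by linarith
        moreover have "p ^ k \<le> n" using d pk(3) by auto
        ultimately have "p \<le> n \<and> k \<le> n" by linarith
        then have "(p, k) \<in> ?I" using p2 k by auto
        moreover have "mangoldt d = ln (real p)" using pk by simp
        ultimately show "\<exists>x\<in>?I. fst x ^ snd x = d \<and> mangoldt d / real d \<le> ln (real (fst x)) / real (fst x ^ snd x)"
          using pk(3) by (intro bexI[of _ "(p, k)"]) auto
      qed
    qed auto
    also have "\<dots> = (\<Sum>p\<in>{2..n}. \<Sum>k\<in>{2..n}. ln (real p) * (1 / real p) ^ k)"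
      by (simp add: sum.cartesian_product case_prod_beta power_divide)
    also have "\<dots> \<le> (\<Sum>p\<in>{2..n}. g p)"
    proof (intro sum_mono)
      fix p assume p: "p \<in> {2..n}"
      then have p2: "real p \<ge> 2" by auto
      have "(\<Sum>k\<in>{2..n}. (1 / real p) ^ k) \<le> 2 / (real p)\<^sup>2"
      proof -
        have "(\<Sum>k\<in>{2..n}. (1 / real p) ^ k) = (if n < 2 then 0 else ((1 / real p) ^ 2 - (1 / real p) ^ Suc n) / (1 - 1 / real p))"
          using p2 by (subst sum_gp) auto
        also have "\<dots> \<le> (1 / real p) ^ 2 / (1 / 2)"
        proof (cases "n < 2")
          case False
          have "((1 / real p) ^ 2 - (1 / real p) ^ Suc n) / (1 - 1 / real p) \<le> (1 / real p) ^ 2 / (1 / 2)"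
          proof (rule frac_le)
            show "1 / 2 \<le> 1 - 1 / real p" using p2 by (simp add: field_simps)
          qed auto
          then show ?thesis using False by simp
        qed simp
        finally show ?thesis by (simp add: power_divide)
      qed
      then have "ln (real p) * (\<Sum>k\<in>{2..n}. (1 / real p) ^ k) \<le> (2 * sqrt (real p)) * (2 / (real p)\<^sup>2)"
      proof (intro mult_mono)
        have "ln (sqrt (real p)) \<le> sqrt (real p)" using p2 ln_le_minus_one[of "sqrt (real p)"] by simp
        then show "ln (real p) \<le> 2 * sqrt (real p)" using p2 by (simp add: ln_sqrt)
      qed (auto intro!: sum_nonneg)
      also have "\<dots> = g p"
      proof -
        have "sqrt (real p) / (real p)\<^sup>2 = real p powr (1/2) / real p powr 2" using p2 by (simp add: powr_half_sqrt powr_numeral)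
        also have "\<dots> = real p powr (-3/2)" by (simp only: powr_diff[symmetric]) simp
        finally show ?thesis by (simp add: g_def)
      qed
      finally show "(\<Sum>k\<in>{2..n}. ln (real p) * (1 / real p) ^ k) \<le> g p" by (simp add: sum_distrib_left)
    qed
    also have "\<dots> \<le> suminf g" by (intro sum_le_suminf sg) (auto simp: g0)
    finally show ?thesis .
  qed
  then show ?thesis by blast
qed

text \<open>Between y and y^4 the weighted sum is at least 4 ln y - 2 ln y up to constants, hence at
  least ln y after removing higher prime powers. Each prime carries a weight of at most 4 ln y,
  which gives 1/4.\<close>

lemma sum_prime_reciprocals_ge:
  "eventually (\<lambda>y::nat. 1/4 \<le> (\<Sum>p\<in>{p\<in>{y<..y^4}. prime p}. 1 / real p)) at_top"
proof -
  obtain C where C: "\<And>n. (\<Sum>d\<in>{d\<in>{1..n}. \<not> prime d}. mangoldt d / real d) \<le> C"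
    using sum_nonprime_primepow_bounded by blast
  have "eventually (\<lambda>y::nat. C + 3 \<le> ln (real y)) at_top" by real_asymp
  then show ?thesis using eventually_ge_at_top[of 2]
  proof eventually_elim
    case (elim y)
    have lny: "ln (real y) > 0" using elim(2) by simp
    have le: "y \<le> y ^ 4" using elim(2) by (intro self_le_power) auto
    have "4 * ln (real y) - 1 \<le> (\<Sum>d=1..y^4. mangoldt d / real d)"
      using sum_mangoldt_lower[of "y ^ 4"] elim(2) by (simp add: ln_realpow)
    also have "{1..y^4} = {1..y} \<union> {y<..y^4}" using le by auto
    also have "(\<Sum>d\<in>{1..y} \<union> {y<..y^4}. mangoldt d / real d) = (\<Sum>d=1..y. mangoldt d / real d) + (\<Sum>d\<in>{y<..y^4}. mangoldt d / real d)"
      by (rule sum.union_disjoint) auto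
    also have "(\<Sum>d=1..y. mangoldt d / real d) \<le> 2 * ln (real y) + 2" using elim(2) by (intro sum_mangoldt_upper) auto
    finally have 1: "2 * ln (real y) - 3 \<le> (\<Sum>d\<in>{y<..y^4}. mangoldt d / real d)" by linarith
    have un: "{p\<in>{y<..y^4}. prime p} \<union> {d\<in>{y<..y^4}. \<not> prime d} = {y<..y^4}" by auto
    have "(\<Sum>d\<in>{p\<in>{y<..y^4}. prime p} \<union> {d\<in>{y<..y^4}. \<not> prime d}. mangoldt d / real d) = (\<Sum>d\<in>{p\<in>{y<..y^4}. prime p}. mangoldt d / real d) + (\<Sum>d\<in>{d\<in>{y<..y^4}. \<not> prime d}. mangoldt d / real d)"
      by (rule sum.union_disjoint) auto
    note this[unfolded un]
    moreover have "(\<Sum>d\<in>{d\<in>{y<..y^4}. \<not> prime d}. mangoldt d / real d) \<le> (\<Sum>d\<in>{d\<in>{1..y^4}. \<not> prime d}. mangoldt d / real d)"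
      by (rule sum_mono2) (auto intro!: divide_nonneg_nonneg mangoldt_nonneg)
    moreover have "(\<Sum>d\<in>{p\<in>{y<..y^4}. prime p}. mangoldt d / real d) \<le> (\<Sum>p\<in>{p\<in>{y<..y^4}. prime p}. 4 * ln (real y) * (1 / real p))"
    proof (intro sum_mono)
      fix p assume p: "p \<in> {p\<in>{y<..y^4}. prime p}"
      then have "ln (real p) \<le> ln (real (y ^ 4))" by (auto intro!: ln_mono simp: prime_gt_0_nat simp flip: of_nat_power)
      then have "mangoldt p \<le> 4 * ln (real y)" using p elim(2) by (simp add: ln_realpow)
      then show "mangoldt p / real p \<le> 4 * ln (real y) * (1 / real p)" by (simp add: divide_right_mono)
    qed
    ultimately have "ln (real y) \<le> (\<Sum>p\<in>{p\<in>{y<..y^4}. prime p}. 4 * ln (real y) * (1 / real p))"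
      using 1 C[of "y ^ 4"] elim(1) by linarith
    also have "\<dots> = 4 * ln (real y) * (\<Sum>p\<in>{p\<in>{y<..y^4}. prime p}. 1 / real p)" by (simp only: sum_distrib_left)
    finally show ?case using lny by simp
  qed
qed

section \<open>Elementary symmetric sums\<close>

definition esym :: "('a \<Rightarrow> real) \<Rightarrow> 'a set \<Rightarrow> nat \<Rightarrow> real" where
  "esym w P k = (\<Sum>T\<in>{T. T \<subseteq> P \<and> card T = k}. \<Prod>p\<in>T. w p)"

lemma esym_0: "finite P \<Longrightarrow> esym w P 0 = 1"
proof -
  assume "finite P"
  then have "{T. T \<subseteq> P \<and> card T = 0} = {{}}" by (auto dest: finite_subset)
  then show ?thesis by (simp add: esym_def)
qed

text \<open>Double counting of pairs (G, p) with p outside the k-set G: every (k+1)-set arises k + 1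
  times, and the elements outside G weigh at least the total minus k times the maximal
  weight.\<close>

lemma esym_step:
  assumes "finite P" "\<And>p. p \<in> P \<Longrightarrow> 0 \<le> w p \<and> w p \<le> \<delta>" "0 \<le> \<delta>"
  shows "((\<Sum>p\<in>P. w p) - real k * \<delta>) * esym w P k \<le> real (Suc k) * esym w P (Suc k)"
proof -
  let ?A = "\<lambda>k. {T. T \<subseteq> P \<and> card T = k}"
  have finA: "finite (?A k)" for k using assms(1) by auto
  have finT: "finite T" if "T \<subseteq> P" for T using that assms(1) finite_subset by blast
  let ?W = "\<lambda>T. \<Prod>p\<in>T. w p"
  have W0: "0 \<le> ?W T" if "T \<subseteq> P" for T using that assms(2) by (intro prod_nonneg) auto
  have "real (Suc k) * esym w P (Suc k) = (\<Sum>T\<in>?A (Suc k). \<Sum>p\<in>T. ?W T)"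
    unfolding esym_def sum_distrib_left by (intro sum.cong refl) auto
  also have "\<dots> = (\<Sum>x\<in>(SIGMA T:?A (Suc k). T). ?W (fst x))"
    using finA finT by (subst sum.Sigma) (auto simp: case_prod_beta)
  also have "\<dots> = (\<Sum>x\<in>(SIGMA G:?A k. P - G). ?W (fst x) * w (snd x))"
  proof (rule sum.reindex_bij_witness[of _ "\<lambda>x. (insert (snd x) (fst x), snd x)" "\<lambda>x. (fst x - {snd x}, snd x)"])
    fix x assume x: "x \<in> (SIGMA T:?A (Suc k). T)"
    then obtain T p where Tp: "x = (T, p)" "T \<subseteq> P" "card T = Suc k" "p \<in> T" by auto
    note f = finT[OF Tp(2)]
    show "(insert (snd (fst x - {snd x}, snd x)) (fst (fst x - {snd x}, snd x)), snd (fst x - {snd x}, snd x)) = x"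
      using Tp by auto
    show "(fst x - {snd x}, snd x) \<in> (SIGMA G:?A k. P - G)" using Tp f by auto
    show "?W (fst (fst x - {snd x}, snd x)) * w (snd (fst x - {snd x}, snd x)) = ?W (fst x)"
      using Tp prod.remove[OF f Tp(4), of w] by (simp add: mult.commute)
  next
    fix x assume "x \<in> (SIGMA G:?A k. P - G)"
    then obtain G p where Gp: "x = (G, p)" "G \<subseteq> P" "card G = k" "p \<in> P" "p \<notin> G" by auto
    note f = finT[OF Gp(2)]
    show "(fst (insert (snd x) (fst x), snd x) - {snd (insert (snd x) (fst x), snd x)}, snd (insert (snd x) (fst x), snd x)) = x"
      using Gp by auto
    show "(insert (snd x) (fst x), snd x) \<in> (SIGMA T:?A (Suc k). T)" using Gp f by auto
  qed
  also have "\<dots> = (\<Sum>G\<in>?A k. \<Sum>p\<in>P - G. ?W G * w p)"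
    using finA assms(1) by (subst sum.Sigma) (auto simp: case_prod_beta)
  also have "\<dots> = (\<Sum>G\<in>?A k. ?W G * (\<Sum>p\<in>P - G. w p))" by (simp only: sum_distrib_left)
  finally have eq: "real (Suc k) * esym w P (Suc k) = (\<Sum>G\<in>?A k. ?W G * (\<Sum>p\<in>P - G. w p))" .
  have "((\<Sum>p\<in>P. w p) - real k * \<delta>) * esym w P k = (\<Sum>G\<in>?A k. ?W G * ((\<Sum>p\<in>P. w p) - real k * \<delta>))"
    unfolding esym_def sum_distrib_left by (simp add: mult.commute)
  also have "\<dots> \<le> (\<Sum>G\<in>?A k. ?W G * (\<Sum>p\<in>P - G. w p))"
  proof (intro sum_mono mult_left_mono)
    fix G assume G: "G \<in> ?A k"
    have "(\<Sum>p\<in>P. w p) = (\<Sum>p\<in>P - G. w p) + (\<Sum>p\<in>G. w p)" using G assms(1) by (intro sum.subset_diff) auto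
    moreover have "(\<Sum>p\<in>G. w p) \<le> (\<Sum>p\<in>G. \<delta>)" using G assms(2) by (intro sum_mono) auto
    ultimately show "(\<Sum>p\<in>P. w p) - real k * \<delta> \<le> (\<Sum>p\<in>P - G. w p)" using G by simp
    show "0 \<le> ?W G" using W0 G by auto
  qed
  finally show ?thesis unfolding eq .
qed

lemma esym_nonneg: "(\<And>p. p \<in> P \<Longrightarrow> 0 \<le> w p) \<Longrightarrow> 0 \<le> esym w P k"
  unfolding esym_def by (intro sum_nonneg prod_nonneg) auto

text \<open>Each application of \<open>esym_step\<close> at a level j < k gains at least s /
  k.\<close>

lemma esym_ratio:
  assumes "finite P" "\<And>p. p \<in> P \<Longrightarrow> 0 \<le> w p \<and> w p \<le> \<delta>" "0 \<le> \<delta>"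
    "s + real k * \<delta> \<le> (\<Sum>p\<in>P. w p)" "0 \<le> s" "i \<le> k"
  shows "(s / real k) ^ i * esym w P (k - i) \<le> esym w P k"
  using assms(6)
proof (induction i)
  case (Suc i)
  have e0: "0 \<le> esym w P j" for j using assms(2) by (intro esym_nonneg) auto
  define j where "j = k - Suc i"
  have j: "k - i = Suc j" "Suc j \<le> k" using Suc.prems unfolding j_def by auto
  have "real j * \<delta> \<le> real k * \<delta>" using j assms(3) by (intro mult_right_mono) auto
  then have "s * esym w P j \<le> ((\<Sum>p\<in>P. w p) - real j * \<delta>) * esym w P j"
    using assms(4) e0 by (intro mult_right_mono) auto
  also have "\<dots> \<le> real (Suc j) * esym w P (Suc j)" by (rule esym_step[OF assms(1-3)]) auto
  also have "\<dots> \<le> real k * esym w P (Suc j)" using j e0 by (intro mult_right_mono) auto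
  finally have "s / real k * esym w P j \<le> esym w P (Suc j)" using j by (simp add: pos_divide_le_eq mult.commute)
  then have "(s / real k) ^ i * (s / real k * esym w P j) \<le> (s / real k) ^ i * esym w P (Suc j)"
    using assms(5) by (intro mult_left_mono) auto
  also have "\<dots> \<le> esym w P k" using Suc j by simp
  finally show ?case by (simp add: j_def mult_ac)
qed simp

text \<open>The gain of the resonator: this is the size of the normalised diagonal sum.\<close>
lemma resonance_ratio:
  assumes "finite P" "\<And>p. p \<in> P \<Longrightarrow> 0 \<le> w p \<and> w p \<le> \<delta>" "0 \<le> \<delta>"
    "s + real k * \<delta> \<le> (\<Sum>p\<in>P. w p)" "0 < s" "1 \<le> i" "i \<le> k"
  shows "0 < esym w P k" "0 < esym w P (k - i)"
    "sqrt (real k * s / (real i)\<^sup>2) ^ i \<le> real (k choose i) * sqrt (esym w P k / esym w P (k - i))"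
proof -
  have pos: "0 < esym w P j" if "j \<le> k" for j
  proof -
    have "real j * \<delta> \<le> real k * \<delta>" using that assms(3) by (intro mult_right_mono) auto
    then have "(s / real j) ^ j * esym w P (j - j) \<le> esym w P j"
      using assms by (intro esym_ratio[where \<delta> = \<delta>]) auto
    moreover have "0 < (s / real j) ^ j" using assms(5) by (cases "j = 0") auto
    ultimately show ?thesis using esym_0[OF assms(1), of w] by simp
  qed
  show p1: "0 < esym w P k" and p2: "0 < esym w P (k - i)" using pos by auto
  have "(s / real k) ^ i * esym w P (k - i) \<le> esym w P k"
    using assms by (intro esym_ratio[where \<delta> = \<delta>]) auto
  then have "(s / real k) ^ i \<le> esym w P k / esym w P (k - i)" using p2 by (simp add: pos_le_divide_eq)
  then have "sqrt ((s / real k) ^ i) \<le> sqrt (esym w P k / esym w P (k - i))" by simp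
  \<comment> \<open>Together with (s / k)^(i/2) from the ratio, this binomial bound combines to (k s
    / i^2)^(i/2).\<close>
  moreover have "(real k / real i) ^ i \<le> real (k choose i)" using binomial_ge_n_over_k_pow_k[OF assms(7), where 'a = real] .
  ultimately have "(real k / real i) ^ i * sqrt ((s / real k) ^ i) \<le> real (k choose i) * sqrt (esym w P k / esym w P (k - i))"
    using assms(5) by (intro mult_mono) auto
  moreover have "(real k / real i) ^ i * sqrt ((s / real k) ^ i) = sqrt (real k * s / (real i)\<^sup>2) ^ i"
  proof -
    have "real k / real i * sqrt (s / real k) = sqrt ((real k / real i)\<^sup>2 * (s / real k))"
      by (simp only: real_sqrt_mult real_sqrt_abs) simp
    also have "(real k / real i)\<^sup>2 * (s / real k) = real k * s / (real i)\<^sup>2"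
      using assms(6,7) by (simp add: power2_eq_square)
    finally show ?thesis by (simp only: real_sqrt_power power_mult_distrib[symmetric])
  qed
  ultimately show "sqrt (real k * s / (real i)\<^sup>2) ^ i \<le> real (k choose i) * sqrt (esym w P k / esym w P (k - i))" by simp
qed

section \<open>The resonance method\<close>

lemma squarefree_part_square [simp]: "n > 0 \<Longrightarrow> squarefree_part ((n::nat)\<^sup>2) = 1"
proof -
  assume n: "n > 0"
  have "square_part (n\<^sup>2) = n" using square_part_even_power[of 2 n] by simp
  then show ?thesis using squarefree_decompose[of "n\<^sup>2"] n by simp
qed

text \<open>Transfers \<open>family_average_bound\<close> to weights depending on N, at the cost of
  their total variation.\<close>

lemma sum_norm_abel:
  fixes f :: "nat \<Rightarrow> real"
  assumes "a \<le> b" "\<bar>f b\<bar> + (\<Sum>N=a..<b. \<bar>f (Suc N) - f N\<bar>) \<le> V" "\<not> near_square h" "h > 0"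
  shows "\<bar>\<Sum>N\<in>{N\<in>{a..b}. N mod 16 = 7 \<and> c\<^sup>2 dvd N}. f N * real_of_int (jac (int h) N)\<bar> \<le> V * (2 * pv_bound h)"
proof -
  define g where "g N = (if N mod 16 = 7 \<and> c\<^sup>2 dvd N then real_of_int (jac (int h) N) else 0)" for N
  have ps: "norm (\<Sum>N=a..t. g N) \<le> 2 * pv_bound h" for t
  proof -
    have "(\<Sum>N=a..t. g N) = (\<Sum>N\<in>{N\<in>{a..t}. N mod 16 = 7 \<and> c\<^sup>2 dvd N}. real_of_int (jac (int h) N))"
      unfolding g_def by (rule sum.inter_filter[symmetric]) simp
    then show ?thesis using family_average_bound[OF assms(3,4), of a t c] by simp
  qed
  have "(\<Sum>N\<in>{N\<in>{a..b}. N mod 16 = 7 \<and> c\<^sup>2 dvd N}. f N * real_of_int (jac (int h) N)) = (\<Sum>N=a..b. f N *\<^sub>R g N)"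
    by (subst sum.inter_filter) (auto simp: g_def intro!: sum.cong)
  also have "norm \<dots> \<le> 2 * pv_bound h * (\<bar>f b\<bar> + (\<Sum>N=a..<b. \<bar>f (Suc N) - f N\<bar>))"
    by (rule abel_bound[OF assms(1) ps])
  also have "\<dots> \<le> 2 * pv_bound h * V" using assms(2,4) pv_bound_nonneg[of h] by (intro mult_left_mono) auto
  finally show ?thesis by (simp add: mult.commute)
qed

definition pr :: "nat set \<Rightarrow> nat" where "pr T = \<Prod>T"

lemma pr_empty [simp]: "pr {} = 1" by (simp add: pr_def)

lemma inverse_pr: "1 / real (pr T) = (\<Prod>p\<in>T. 1 / real p)" by (simp add: pr_def prod_dividef)

text \<open>The weights \<open>f n N\<close> are either \<open>1\<close> (short sums) or the dual kernel (long sums). The sieve for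
  squarefree \<open>N\<close> is truncated at \<open>A\<close>; the conductors divisible by a larger square are few, and \<open>B\<close> bounds
  their contribution. \<open>V\<close> bounds the total variation in \<open>N\<close>, which is what partial summation costs.\<close>
locale resonator =
  fixes P :: "nat set" and k i :: nat and M lam :: real
    and a b nm A :: nat and f :: "nat \<Rightarrow> nat \<Rightarrow> real" and V :: "nat \<Rightarrow> real" and B w0 c0 :: real
  assumes finP: "finite P" and primeP: "\<And>p. p \<in> P \<Longrightarrow> prime p \<and> odd p"
    and prodM: "\<And>T. T \<subseteq> P \<Longrightarrow> card T \<le> k \<Longrightarrow> real (pr T) \<le> M"
    and i1: "1 \<le> i" and ik: "i \<le> k"
    and ek: "0 < esym (\<lambda>p. 1 / real p) P k" and eki: "0 < esym (\<lambda>p. 1 / real p) P (k - i)"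
    and a0: "1 \<le> a" and ab: "a \<le> b" and nm: "1 \<le> nm" and A1: "1 \<le> A"
    and f0: "\<And>n N. n \<in> {1..nm} \<Longrightarrow> N \<in> {a..b} \<Longrightarrow> 0 \<le> f n N"
    and TV: "\<And>n. n \<in> {1..nm} \<Longrightarrow> \<bar>f n b\<bar> + (\<Sum>N=a..<b. \<bar>f n (Suc N) - f n N\<bar>) \<le> V n"
    and lam: "2 * (1 + ln (M\<^sup>2 * real nm)) \<le> lam"
    and tailF: "\<And>N c. N \<in> {a..b} \<Longrightarrow> N mod 16 = 7 \<Longrightarrow> A < c \<Longrightarrow> c\<^sup>2 dvd N \<Longrightarrow>
        \<bar>\<Sum>n=1..nm. f n N * real_of_int (jac (int n) N)\<bar> \<le> B"
    and tailD: "\<And>N h. N \<in> {a..b} \<Longrightarrow> h > 0 \<Longrightarrow> (\<Sum>n\<in>{n\<in>{1..nm}. near_square (n * h)}. f n N) \<le> B"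
    and w0: "0 \<le> w0" and c0: "0 \<le> c0"
    and main: "\<And>T N. T \<subseteq> P \<Longrightarrow> card T = i \<Longrightarrow> N \<in> {a..b} \<Longrightarrow> N mod 16 = 7 \<Longrightarrow> squarefree N \<Longrightarrow>
        w0 / sqrt (real (pr T)) \<le> (\<Sum>l\<in>{l\<in>{1..nm}. coprime l N \<and> pr T * l\<^sup>2 \<le> nm}. f (pr T * l\<^sup>2) N)"
    and count: "\<And>T. T \<subseteq> P \<Longrightarrow> card T = k \<Longrightarrow>
        c0 \<le> real (card {N\<in>{a..b}. N mod 16 = 7 \<and> squarefree N \<and> coprime N (pr T)})"
begin

abbreviation "ek \<equiv> esym (\<lambda>p. 1 / real p) P k"
abbreviation "ei \<equiv> esym (\<lambda>p. 1 / real p) P (k - i)"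

definition Ts :: "nat set set" where "Ts = {T. T \<subseteq> P \<and> (card T = k \<or> card T = k - i)}"

text \<open>Only two layers of products carry mass. The diagonal terms used pair a product of \<open>k\<close> primes with
  one of its divisors having \<open>k - i\<close> primes, against \<open>n\<close> equal to the quotient times a square.\<close>
definition r :: "nat set \<Rightarrow> real" where
  "r T = (if card T = k then 1 / sqrt (real (pr T) * ek) else 1 / sqrt (real (pr T) * ei))"

definition fam :: "nat set" where "fam = {N\<in>{a..b}. N mod 16 = 7}"

abbreviation J :: "nat \<Rightarrow> nat \<Rightarrow> real" where "J h N \<equiv> real_of_int (jac (int h) N)"

definition Rs :: "nat \<Rightarrow> real" where "Rs N = (\<Sum>T\<in>Ts. r T * J (pr T) N)"

definition Fs :: "nat \<Rightarrow> real" where "Fs N = (\<Sum>n=1..nm. f n N * J n N)"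

text \<open>Indices (T, U, n) of the expansion of the squared resonator times \<open>Fs N\<close>;
  \<open>hh\<close> is the argument n pr T pr U of the resulting symbol.\<close>

definition Ix where "Ix = Ts \<times> Ts \<times> {1..nm}"
definition hh :: "nat set \<times> nat set \<times> nat \<Rightarrow> nat" where "hh x = snd (snd x) * (pr (fst x) * pr (fst (snd x)))"
definition trm :: "nat \<Rightarrow> nat set \<times> nat set \<times> nat \<Rightarrow> real" where
  "trm N x = r (fst x) * r (fst (snd x)) * (f (snd (snd x)) N * J (hh x) N)"

lemma finTs [simp]: "finite Ts"
  unfolding Ts_def by (rule finite_subset[of _ "Pow P"]) (use finP in auto)

lemma finfam [simp]: "finite fam" unfolding fam_def by simp

lemma finIx [simp]: "finite Ix" unfolding Ix_def by simp

lemma TsD: assumes "T \<in> Ts"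
  shows "T \<subseteq> P" "finite T" "card T \<le> k" "real (pr T) \<le> M" "pr T > 0" "\<And>p. p \<in> T \<Longrightarrow> prime p \<and> odd p"
proof -
  show T: "T \<subseteq> P" and c: "card T \<le> k" using assms by (auto simp: Ts_def)
  show f: "finite T" using T finP finite_subset by blast
  show "real (pr T) \<le> M" using prodM T c by blast
  show p: "\<And>p. p \<in> T \<Longrightarrow> prime p \<and> odd p" using T primeP by blast
  show "pr T > 0" unfolding pr_def using p f by (intro prime_factors_prod_primes(3)) auto
qed

lemma fam_odd: "N \<in> fam \<Longrightarrow> odd N" "N \<in> fam \<Longrightarrow> N > 0" "N \<in> fam \<Longrightarrow> N mod 16 = 7" "N \<in> fam \<Longrightarrow> N \<in> {a..b}"
  using mod16_7D a0 by (auto simp: fam_def)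

lemma esym_member: assumes "T \<subseteq> P" shows "1 / real (pr T) \<le> esym (\<lambda>p. 1 / real p) P (card T)"
proof -
  have "(\<Prod>p\<in>T. 1 / real p) \<le> esym (\<lambda>p. 1 / real p) P (card T)"
    unfolding esym_def by (rule member_le_sum) (use assms finP in \<open>auto intro!: prod_nonneg\<close>)
  then show ?thesis by (simp only: inverse_pr)
qed

lemma r_bounds: assumes "T \<in> Ts" shows "0 \<le> r T" "r T \<le> 1"
proof -
  note T = TsD[OF assms]
  have p: "real (pr T) > 0" using T(5) by simp
  have *: "1 / sqrt (real (pr T) * e) \<le> 1" if "1 / real (pr T) \<le> e" for e
  proof -
    have "1 \<le> real (pr T) * e" using that p by (simp add: pos_divide_le_eq mult.commute)
    then show ?thesis by simp
  qed
  show "0 \<le> r T" using ek eki by (simp add: r_def)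
  show "r T \<le> 1" using esym_member[OF T(1)] assms * unfolding r_def Ts_def by auto
qed

text \<open>Each of the two layers is normalised to total square 1.\<close>

lemma sum_r_squared: "(\<Sum>T\<in>Ts. (r T)\<^sup>2) = 2"
proof -
  have kk: "k \<noteq> k - i" using i1 ik by simp
  let ?K = "\<lambda>j. {T. T \<subseteq> P \<and> card T = j}"
  have fin: "finite (?K j)" for j using finP by auto
  have "Ts = ?K k \<union> ?K (k - i)" by (auto simp: Ts_def)
  then have "(\<Sum>T\<in>Ts. (r T)\<^sup>2) = (\<Sum>T\<in>?K k. (r T)\<^sup>2) + (\<Sum>T\<in>?K (k - i). (r T)\<^sup>2)"
    using fin kk by (simp only:) (rule sum.union_disjoint, auto)
  also have "(\<Sum>T\<in>?K k. (r T)\<^sup>2) = (\<Sum>T\<in>?K k. (\<Prod>p\<in>T. 1 / real p) / ek)"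
    using ek by (intro sum.cong refl) (auto simp: r_def power_divide inverse_pr[symmetric])
  also have "\<dots> = 1" using ek by (simp add: esym_def sum_divide_distrib[symmetric])
  also have "(\<Sum>T\<in>?K (k - i). (r T)\<^sup>2) = (\<Sum>T\<in>?K (k - i). (\<Prod>p\<in>T. 1 / real p) / ei)"
    using eki kk by (intro sum.cong refl) (auto simp: r_def power_divide inverse_pr[symmetric])
  also have "\<dots> = 1" using eki by (simp add: esym_def sum_divide_distrib[symmetric])
  finally show ?thesis by simp
qed

text \<open>A set T is recovered from the integer \<open>pr T\<close>, which is at most M.\<close>

lemma card_Ts: "real (card Ts) \<le> M"
proof -
  have "inj_on (\<lambda>T. pr T) Ts"
  proof (rule inj_onI)
    fix T U assume TU: "T \<in> Ts" "U \<in> Ts" "pr T = pr U"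
    have "prime_factors (pr T) = T" "prime_factors (pr U) = U"
      unfolding pr_def using TsD[OF TU(1)] TsD[OF TU(2)] by (auto intro!: prime_factors_prod_primes(1))
    then show "T = U" using TU(3) by metis
  qed
  moreover have "(\<lambda>T. pr T) ` Ts \<subseteq> {1..nat \<lfloor>M\<rfloor>}"
    using TsD by (force simp: le_nat_floor Suc_le_eq)
  ultimately have "card Ts \<le> card {1..nat \<lfloor>M\<rfloor>}" by (rule card_inj_on_le) simp
  then have "real (card Ts) \<le> real (nat \<lfloor>M\<rfloor>)" by simp
  also have "\<dots> \<le> M"
  proof -
    have "{} \<subseteq> P" "card ({}::nat set) \<le> k" by auto
    then have "real (pr {}) \<le> M" by (rule prodM)
    then show ?thesis by (intro of_nat_floor) simp
  qed
  finally show ?thesis .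
qed

lemma M1: "1 \<le> M"
proof -
  have "{} \<subseteq> P" "card ({}::nat set) \<le> k" by auto
  then have "real (pr {}) \<le> M" by (rule prodM)
  then show ?thesis by simp
qed

lemma lam0: "0 \<le> lam"
proof -
  have "1 \<le> M\<^sup>2 * real nm" using M1 nm mult_mono[of 1 "M\<^sup>2" 1 "real nm"] by simp
  then have "0 \<le> ln (M\<^sup>2 * real nm)" by simp
  then show ?thesis using lam by argo
qed

lemma J_mult: "N \<in> fam \<Longrightarrow> J (m * n) N = J m N * J n N"
  using fam_odd(1) by (simp add: jac_mult_left)

lemma Ix_sum: "(\<Sum>x\<in>Ix. F (fst x) (fst (snd x)) (snd (snd x))) = (\<Sum>T\<in>Ts. \<Sum>U\<in>Ts. \<Sum>n=1..nm. (F T U n :: real))"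
  unfolding Ix_def by (simp add: sum.cartesian_product case_prod_beta)

lemma trm_sum: assumes "N \<in> fam" shows "(Rs N)\<^sup>2 * Fs N = (\<Sum>x\<in>Ix. trm N x)"
proof -
  have "(\<Sum>x\<in>Ix. trm N x) = (\<Sum>T\<in>Ts. \<Sum>U\<in>Ts. \<Sum>n=1..nm. r T * r U * (f n N * J (n * (pr T * pr U)) N))"
    unfolding trm_def hh_def by (rule Ix_sum[of "\<lambda>T U n. r T * r U * (f n N * J (n * (pr T * pr U)) N)"])
  also have "\<dots> = (\<Sum>T\<in>Ts. \<Sum>U\<in>Ts. \<Sum>n=1..nm. (r T * J (pr T) N) * ((r U * J (pr U) N) * (f n N * J n N)))"
    by (intro sum.cong refl) (simp only: J_mult[OF assms], simp add: mult_ac)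
  also have "\<dots> = (\<Sum>T\<in>Ts. (r T * J (pr T) N) * (\<Sum>U\<in>Ts. (r U * J (pr U) N) * Fs N))"
    unfolding Fs_def by (simp only: sum_distrib_left)
  also have "\<dots> = Rs N * (Rs N * Fs N)"
    unfolding Rs_def by (simp only: sum_distrib_right)
  finally show ?thesis by (simp add: power2_eq_square mult.assoc)
qed

lemma IxD: assumes "x \<in> Ix"
  shows "fst x \<in> Ts" "fst (snd x) \<in> Ts" "snd (snd x) \<in> {1..nm}" "hh x > 0"
    "sqrt (real (hh x)) \<le> M * sqrt (real (snd (snd x)))" "2 * pv_bound (hh x) \<le> M * sqrt (real (snd (snd x))) * lam"
proof -
  show T: "fst x \<in> Ts" and U: "fst (snd x) \<in> Ts" and n: "snd (snd x) \<in> {1..nm}" using assms by (auto simp: Ix_def)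
  show h: "hh x > 0" unfolding hh_def using TsD(5)[OF T] TsD(5)[OF U] n by auto
  have le: "real (hh x) \<le> real (snd (snd x)) * (M * M)"
    unfolding hh_def of_nat_mult using TsD(4)[OF T] TsD(4)[OF U] M1 by (intro mult_mono) auto
  have "sqrt (real (hh x)) \<le> sqrt (real (snd (snd x)) * (M * M))" using le by simp
  then show s: "sqrt (real (hh x)) \<le> M * sqrt (real (snd (snd x)))" using M1 by (simp add: real_sqrt_mult mult.commute)
  have "real (snd (snd x)) * (M * M) \<le> real nm * (M * M)" using n by (intro mult_right_mono) auto
  then have "real (hh x) \<le> M\<^sup>2 * real nm" using le by (simp add: power2_eq_square mult.commute)
  then have "ln (real (hh x)) \<le> ln (M\<^sup>2 * real nm)" using h by (intro ln_mono) auto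
  then have l: "2 * (1 + ln (real (hh x))) \<le> lam" using lam by argo
  have "2 * pv_bound (hh x) = sqrt (real (hh x)) * (2 * (1 + ln (real (hh x))))" by (simp add: pv_bound_def)
  also have "\<dots> \<le> (M * sqrt (real (snd (snd x)))) * lam"
    using s l h M1 by (intro mult_mono) auto
  finally show "2 * pv_bound (hh x) \<le> M * sqrt (real (snd (snd x))) * lam" by simp
qed

lemma V0: "n \<in> {1..nm} \<Longrightarrow> 0 \<le> V n"
proof -
  assume n: "n \<in> {1..nm}"
  have "0 \<le> (\<Sum>N=a..<b. \<bar>f n (Suc N) - f n N\<bar>)" by (intro sum_nonneg) auto
  then show ?thesis using TV[OF n] by linarith
qed

text \<open>Terms whose symbol is 0 or 1 for every N of the family; those collected in
  \<open>Nd\<close> cancel on average.\<close>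

definition Dg where "Dg N = (\<Sum>x\<in>{x\<in>Ix. near_square (hh x)}. trm N x)"
definition Nd where "Nd N = (\<Sum>x\<in>{x\<in>Ix. \<not> near_square (hh x)}. trm N x)"

lemma Dg_Nd: assumes "N \<in> fam" shows "(Rs N)\<^sup>2 * Fs N = Dg N + Nd N"
proof -
  have "Ix = {x\<in>Ix. near_square (hh x)} \<union> {x\<in>Ix. \<not> near_square (hh x)}" by auto
  then have "(\<Sum>x\<in>Ix. trm N x) = Dg N + Nd N"
    unfolding Dg_def Nd_def by (subst sum.union_disjoint[symmetric]) (auto intro!: sum.cong)
  then show ?thesis using trm_sum[OF assms] by simp
qed

text \<open>Each of at most M^2 pairs of sets contributes, for every n, one application of
  \<open>sum_norm_abel\<close>, with coefficients at most 1.\<close>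

lemma Nd_average:
  "\<bar>\<Sum>N\<in>{N\<in>fam. c\<^sup>2 dvd N}. Nd N\<bar> \<le> M\<^sup>2 * (M * lam * (\<Sum>n=1..nm. V n * sqrt (real n)))"
proof -
  let ?X = "{x\<in>Ix. \<not> near_square (hh x)}" and ?F = "{N\<in>fam. c\<^sup>2 dvd N}"
  have Feq: "?F = {N\<in>{a..b}. N mod 16 = 7 \<and> c\<^sup>2 dvd N}" by (auto simp: fam_def)
  have sw: "(\<Sum>N\<in>?F. Nd N) = (\<Sum>x\<in>?X. \<Sum>N\<in>?F. trm N x)" unfolding Nd_def by (rule sum.swap)
  have "\<bar>\<Sum>N\<in>?F. Nd N\<bar> \<le> (\<Sum>x\<in>?X. V (snd (snd x)) * (M * sqrt (real (snd (snd x))) * lam))"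
    unfolding sw
  proof (rule order_trans[OF sum_abs], rule sum_mono)
    fix x assume "x \<in> ?X"
    then have x: "x \<in> Ix" "\<not> near_square (hh x)" by auto
    note xD = IxD[OF x(1)]
    have "(\<Sum>N\<in>?F. trm N x) = r (fst x) * r (fst (snd x)) * (\<Sum>N\<in>?F. f (snd (snd x)) N * J (hh x) N)"
      unfolding trm_def by (simp only: sum_distrib_left)
    then have "\<bar>\<Sum>N\<in>?F. trm N x\<bar> = r (fst x) * r (fst (snd x)) * \<bar>\<Sum>N\<in>?F. f (snd (snd x)) N * J (hh x) N\<bar>"
      using r_bounds[OF xD(1)] r_bounds[OF xD(2)] by (simp add: abs_mult)
    also have "\<dots> \<le> 1 * 1 * (V (snd (snd x)) * (2 * pv_bound (hh x)))"
      unfolding Feq using r_bounds[OF xD(1)] r_bounds[OF xD(2)] sum_norm_abel[OF ab TV[OF xD(3)] x(2) xD(4), of c]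
      by (intro mult_mono) auto
    also have "\<dots> \<le> V (snd (snd x)) * (M * sqrt (real (snd (snd x))) * lam)"
      using xD(6) V0[OF xD(3)] by (simp add: mult_left_mono)
    finally show "\<bar>\<Sum>N\<in>?F. trm N x\<bar> \<le> V (snd (snd x)) * (M * sqrt (real (snd (snd x))) * lam)" .
  qed
  also have "\<dots> \<le> (\<Sum>x\<in>Ix. V (snd (snd x)) * (M * sqrt (real (snd (snd x))) * lam))"
    by (rule sum_mono2) (use V0 M1 lam0 IxD(3) in \<open>auto intro!: mult_nonneg_nonneg\<close>)
  also have "\<dots> = (\<Sum>T\<in>Ts. \<Sum>U\<in>Ts. \<Sum>n=1..nm. V n * (M * sqrt (real n) * lam))"
    by (rule Ix_sum[of "\<lambda>T U n. V n * (M * sqrt (real n) * lam)"])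
  also have "\<dots> = (real (card Ts))\<^sup>2 * (\<Sum>n=1..nm. V n * (M * sqrt (real n) * lam))"
    by (simp add: power2_eq_square)
  also have "\<dots> \<le> M\<^sup>2 * (\<Sum>n=1..nm. V n * (M * sqrt (real n) * lam))"
    using card_Ts V0 M1 lam0 by (intro mult_right_mono power_mono sum_nonneg mult_nonneg_nonneg) auto
  also have "(\<Sum>n=1..nm. V n * (M * sqrt (real n) * lam)) = M * lam * (\<Sum>n=1..nm. V n * sqrt (real n))"
    by (simp add: sum_distrib_left mult_ac)
  finally show ?thesis .
qed

lemma Rs_abs_le: "\<bar>Rs N\<bar> \<le> M"
proof -
  have "\<bar>Rs N\<bar> \<le> (\<Sum>T\<in>Ts. 1)"
    unfolding Rs_def
  proof (intro order_trans[OF sum_abs] sum_mono)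
    fix T assume "T \<in> Ts"
    then have "\<bar>r T * J (pr T) N\<bar> \<le> 1 * 1"
      unfolding abs_mult using r_bounds[of T] by (intro mult_mono jac_abs_le) auto
    then show "\<bar>r T * J (pr T) N\<bar> \<le> 1" by simp
  qed
  then show ?thesis using card_Ts by simp
qed

lemma trm_nonneg:
  assumes "N \<in> fam" "x \<in> Ix" "near_square (hh x)" shows "0 \<le> trm N x" "trm N x \<le> f (snd (snd x)) N"
proof -
  note xD = IxD[OF assms(2)]
  have j: "0 \<le> J (hh x) N" "J (hh x) N \<le> 1" using jac_near_square[OF fam_odd(3)[OF assms(1)] assms(3)] by auto
  have f: "0 \<le> f (snd (snd x)) N" using f0 xD(3) fam_odd(4)[OF assms(1)] by blast
  show "0 \<le> trm N x"
    unfolding trm_def using r_bounds[OF xD(1)] r_bounds[OF xD(2)] j f by (intro mult_nonneg_nonneg) auto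
  have "trm N x \<le> (1 * 1) * (f (snd (snd x)) N * 1)"
    unfolding trm_def using r_bounds[OF xD(1)] r_bounds[OF xD(2)] j f by (intro mult_mono mult_nonneg_nonneg) auto
  then show "trm N x \<le> f (snd (snd x)) N" by simp
qed

lemma B0: "0 \<le> B"
proof -
  have "0 \<le> (\<Sum>n\<in>{n\<in>{1..nm}. near_square (n * 1)}. f n a)" using f0 ab by (intro sum_nonneg) auto
  also have "\<dots> \<le> B" using tailD[of a 1] ab by simp
  finally show ?thesis .
qed

lemma Dg_bounds: assumes "N \<in> fam" shows "0 \<le> Dg N" "Dg N \<le> M\<^sup>2 * B"
proof -
  show "0 \<le> Dg N" unfolding Dg_def using trm_nonneg(1)[OF assms] by (intro sum_nonneg) auto
  have "Dg N \<le> (\<Sum>x\<in>{x\<in>Ix. near_square (hh x)}. f (snd (snd x)) N)"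
    unfolding Dg_def using trm_nonneg(2)[OF assms] by (intro sum_mono) auto
  also have "\<dots> = (\<Sum>x\<in>Ix. if near_square (hh x) then f (snd (snd x)) N else 0)" by (rule sum.inter_filter) simp
  also have "\<dots> = (\<Sum>T\<in>Ts. \<Sum>U\<in>Ts. \<Sum>n=1..nm. if near_square (n * (pr T * pr U)) then f n N else 0)"
    unfolding hh_def by (rule Ix_sum[of "\<lambda>T U n. if near_square (n * (pr T * pr U)) then f n N else 0"])
  also have "\<dots> \<le> (\<Sum>T\<in>Ts. \<Sum>U\<in>Ts. B)"
  proof (intro sum_mono)
    fix T U assume TU: "T \<in> Ts" "U \<in> Ts"
    have "(\<Sum>n=1..nm. if near_square (n * (pr T * pr U)) then f n N else 0) = (\<Sum>n\<in>{n\<in>{1..nm}. near_square (n * (pr T * pr U))}. f n N)"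
      by (rule sum.inter_filter[symmetric]) simp
    also have "\<dots> \<le> B" using tailD[of N "pr T * pr U"] fam_odd(4)[OF assms] TsD(5)[OF TU(1)] TsD(5)[OF TU(2)] by simp
    finally show "(\<Sum>n=1..nm. if near_square (n * (pr T * pr U)) then f n N else 0) \<le> B" .
  qed
  also have "\<dots> = (real (card Ts))\<^sup>2 * B" by (simp add: power2_eq_square)
  also have "\<dots> \<le> M\<^sup>2 * B" using card_Ts B0 by (intro mult_right_mono power_mono) auto
  finally show "Dg N \<le> M\<^sup>2 * B" .
qed

text \<open>For the sparse N with a large square divisor no averaging is possible. The off-diagonal
  part is bounded as the whole minus the diagonal, and each of these is at most M^2 B in absolute
  value.\<close>

lemma Nd_bound:
  assumes "N \<in> fam" "A < c" "c\<^sup>2 dvd N" shows "\<bar>Nd N\<bar> \<le> 2 * M\<^sup>2 * B"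
proof -
  have "\<bar>Fs N\<bar> \<le> B" unfolding Fs_def using tailF assms fam_odd[OF assms(1)] by blast
  moreover have "(Rs N)\<^sup>2 \<le> M\<^sup>2" using Rs_abs_le[of N] M1 by (simp add: abs_le_square_iff[symmetric])
  ultimately have "\<bar>(Rs N)\<^sup>2 * Fs N\<bar> \<le> M\<^sup>2 * B" unfolding abs_mult by (intro mult_mono) auto
  then show ?thesis using Dg_Nd[OF assms(1)] Dg_bounds[OF assms(1)] by linarith
qed

text \<open>Bound for the number of pairs (N, c) with c > A and c^2 dividing N: the sum of (b - a) /
  c^2 + 1 over A < c <= sqrt b.\<close>

definition tl :: real where "tl = real (b - a) / real A + sqrt (real b)"

lemma pairs_bound:
  "(\<Sum>N\<in>fam. real (card {c. A < c \<and> c\<^sup>2 dvd N})) \<le> tl"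
proof -
  define C where "C = nat \<lfloor>sqrt (real b)\<rfloor>"
  have cC: "c \<le> C" if "N \<in> fam" "c\<^sup>2 dvd N" for N c
  proof -
    have "c\<^sup>2 \<le> N" using that fam_odd(2)[OF that(1)] dvd_imp_le by blast
    then have "c\<^sup>2 \<le> b" using fam_odd(4)[OF that(1)] by simp
    then have "real (c\<^sup>2) \<le> real b" by (rule of_nat_mono)
    then have "real c \<le> sqrt (real b)" by (intro real_le_rsqrt) simp
    then show ?thesis unfolding C_def by (simp add: le_nat_floor)
  qed
  have "(\<Sum>N\<in>fam. real (card {c. A < c \<and> c\<^sup>2 dvd N})) = (\<Sum>N\<in>fam. \<Sum>c\<in>{A<..C}. if c\<^sup>2 dvd N then 1 else 0)"
  proof (intro sum.cong refl)
    fix N assume N: "N \<in> fam"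
    have "{c. A < c \<and> c\<^sup>2 dvd N} = {c\<in>{A<..C}. c\<^sup>2 dvd N}" using cC[OF N] by auto
    then show "real (card {c. A < c \<and> c\<^sup>2 dvd N}) = (\<Sum>c\<in>{A<..C}. if c\<^sup>2 dvd N then 1 else 0)"
      by (simp add: sum.inter_filter[symmetric])
  qed
  also have "\<dots> = (\<Sum>c\<in>{A<..C}. \<Sum>N\<in>fam. if c\<^sup>2 dvd N then 1 else 0)" by (rule sum.swap)
  also have "\<dots> \<le> (\<Sum>c\<in>{A<..C}. real (b - a) * (1 / (real c)\<^sup>2) + 1)"
  proof (intro sum_mono)
    fix c assume c: "c \<in> {A<..C}"
    have "(\<Sum>N\<in>fam. if c\<^sup>2 dvd N then 1 else (0::real)) = real (card {N\<in>fam. c\<^sup>2 dvd N})"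
      by (simp add: sum.inter_filter[symmetric])
    also have "\<dots> \<le> real (card {N\<in>{a..b}. c\<^sup>2 dvd N})" by (intro of_nat_mono card_mono) (auto simp: fam_def)
    also have "\<dots> \<le> real (b - a) / real (c\<^sup>2) + 1" using c ab by (intro card_dvd_le) auto
    finally show "(\<Sum>N\<in>fam. if c\<^sup>2 dvd N then 1 else (0::real)) \<le> real (b - a) * (1 / (real c)\<^sup>2) + 1" by simp
  qed
  also have "\<dots> = real (b - a) * (\<Sum>c\<in>{A<..C}. 1 / (real c)\<^sup>2) + real (C - A)"
    by (simp add: sum.distrib sum_distrib_left)
  also have "\<dots> \<le> real (b - a) * (1 / real A) + sqrt (real b)"
  proof (intro add_mono mult_left_mono sum_inverse_squares_tail A1)
    have "real (C - A) \<le> real C" by simp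
    also have "\<dots> \<le> sqrt (real b)" unfolding C_def by (simp add: of_nat_floor)
    finally show "real (C - A) \<le> sqrt (real b)" .
  qed auto
  finally show ?thesis by (simp add: tl_def)
qed

text \<open>One average for each Moebius index up to A, plus the pointwise bound for all pairs
  counted by \<open>tl\<close>.\<close>

definition Err :: real where
  "Err = real A * (M\<^sup>2 * (M * lam * (\<Sum>n=1..nm. V n * sqrt (real n)))) + 2 * M\<^sup>2 * B * tl"

text \<open>The indicator of squarefree N is written as the sum of mu(c) over c^2 dividing N. Small
  c are treated by \<open>Nd_average\<close>, large c by \<open>Nd_bound\<close> and
  \<open>pairs_bound\<close>.\<close>

lemma Nd_squarefree_average: "\<bar>\<Sum>N\<in>{N\<in>fam. squarefree N}. Nd N\<bar> \<le> Err"
proof -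
  have mu_split: "(if squarefree N then 1 else (0::real)) = (\<Sum>c=1..A. if c\<^sup>2 dvd N then real_of_int (mu c) else 0) + (\<Sum>c | A < c \<and> c\<^sup>2 dvd N. real_of_int (mu c))"
    if N: "N \<in> fam" for N
  proof -
    have fin: "finite {c. c\<^sup>2 dvd N}" 
    proof (rule finite_subset[of _ "{..N}"])
      show "{c. c\<^sup>2 dvd N} \<subseteq> {..N}"
      proof
        fix c assume "c \<in> {c. c\<^sup>2 dvd N}"
        then have "c dvd N" by (auto intro: dvd_trans[of c "c\<^sup>2"])
        then show "c \<in> {..N}" using fam_odd(2)[OF N] dvd_imp_le by auto
      qed
    qed simp
    have c1: "1 \<le> c" if "c\<^sup>2 dvd N" for c using that fam_odd(2)[OF N] by (cases "c = 0") auto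
    have U: "{c\<in>{1..A}. c\<^sup>2 dvd N} \<union> {c. A < c \<and> c\<^sup>2 dvd N} = {c. c\<^sup>2 dvd N}" using c1 by auto
    have "(\<Sum>c\<in>{c\<in>{1..A}. c\<^sup>2 dvd N} \<union> {c. A < c \<and> c\<^sup>2 dvd N}. real_of_int (mu c)) = (\<Sum>c\<in>{c\<in>{1..A}. c\<^sup>2 dvd N}. real_of_int (mu c)) + (\<Sum>c | A < c \<and> c\<^sup>2 dvd N. real_of_int (mu c))"
      by (rule sum.union_disjoint) (auto intro: finite_subset[OF _ fin])
    moreover have "(\<Sum>c\<in>{c\<in>{1..A}. c\<^sup>2 dvd N}. real_of_int (mu c)) = (\<Sum>c=1..A. if c\<^sup>2 dvd N then real_of_int (mu c) else 0)"
      by (rule sum.inter_filter) simp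
    moreover have "(\<Sum>c | c\<^sup>2 dvd N. real_of_int (mu c)) = (if squarefree N then 1 else 0)"
      using sum_mu_square_divisors[OF fam_odd(2)[OF N]] by (simp flip: of_int_sum)
    ultimately show ?thesis unfolding U by simp
  qed
  have "(\<Sum>N\<in>{N\<in>fam. squarefree N}. Nd N) = (\<Sum>N\<in>fam. (if squarefree N then 1 else 0) * Nd N)"
    by (subst sum.inter_filter) (auto intro!: sum.cong)
  also have "\<dots> = (\<Sum>N\<in>fam. (\<Sum>c=1..A. if c\<^sup>2 dvd N then real_of_int (mu c) else 0) * Nd N + (\<Sum>c | A < c \<and> c\<^sup>2 dvd N. real_of_int (mu c)) * Nd N)"
    by (intro sum.cong refl) (simp only: mu_split distrib_right)
  also have "\<dots> = (\<Sum>N\<in>fam. \<Sum>c=1..A. (if c\<^sup>2 dvd N then real_of_int (mu c) else 0) * Nd N) + (\<Sum>N\<in>fam. (\<Sum>c | A < c \<and> c\<^sup>2 dvd N. real_of_int (mu c)) * Nd N)"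
    by (simp only: sum.distrib sum_distrib_right)
  also have "(\<Sum>N\<in>fam. \<Sum>c=1..A. (if c\<^sup>2 dvd N then real_of_int (mu c) else 0) * Nd N) = (\<Sum>c=1..A. real_of_int (mu c) * (\<Sum>N\<in>{N\<in>fam. c\<^sup>2 dvd N}. Nd N))"
  proof (subst sum.swap, intro sum.cong refl)
    fix c
    have "(\<Sum>N\<in>fam. (if c\<^sup>2 dvd N then real_of_int (mu c) else 0) * Nd N) = (\<Sum>N\<in>fam. if c\<^sup>2 dvd N then real_of_int (mu c) * Nd N else 0)"
      by (intro sum.cong refl) auto
    also have "\<dots> = (\<Sum>N\<in>{N\<in>fam. c\<^sup>2 dvd N}. real_of_int (mu c) * Nd N)" by (rule sum.inter_filter[symmetric]) simp
    finally show "(\<Sum>N\<in>fam. (if c\<^sup>2 dvd N then real_of_int (mu c) else 0) * Nd N) = real_of_int (mu c) * (\<Sum>N\<in>{N\<in>fam. c\<^sup>2 dvd N}. Nd N)"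
      by (simp only: sum_distrib_left)
  qed
  finally have eq: "(\<Sum>N\<in>{N\<in>fam. squarefree N}. Nd N) = (\<Sum>c=1..A. real_of_int (mu c) * (\<Sum>N\<in>{N\<in>fam. c\<^sup>2 dvd N}. Nd N)) + (\<Sum>N\<in>fam. (\<Sum>c | A < c \<and> c\<^sup>2 dvd N. real_of_int (mu c)) * Nd N)" .
  let ?E = "M\<^sup>2 * (M * lam * (\<Sum>n=1..nm. V n * sqrt (real n)))"
  have "\<bar>\<Sum>c=1..A. real_of_int (mu c) * (\<Sum>N\<in>{N\<in>fam. c\<^sup>2 dvd N}. Nd N)\<bar> \<le> (\<Sum>c=1..A. ?E)"
  proof (intro order_trans[OF sum_abs] sum_mono)
    fix c
    have "\<bar>real_of_int (mu c) * (\<Sum>N\<in>{N\<in>fam. c\<^sup>2 dvd N}. Nd N)\<bar> \<le> 1 * ?E"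
      unfolding abs_mult by (intro mult_mono mu_abs_le Nd_average) auto
    then show "\<bar>real_of_int (mu c) * (\<Sum>N\<in>{N\<in>fam. c\<^sup>2 dvd N}. Nd N)\<bar> \<le> ?E" by simp
  qed
  then have 1: "\<bar>\<Sum>c=1..A. real_of_int (mu c) * (\<Sum>N\<in>{N\<in>fam. c\<^sup>2 dvd N}. Nd N)\<bar> \<le> real A * ?E" by simp
  have "\<bar>\<Sum>N\<in>fam. (\<Sum>c | A < c \<and> c\<^sup>2 dvd N. real_of_int (mu c)) * Nd N\<bar> \<le> (\<Sum>N\<in>fam. real (card {c. A < c \<and> c\<^sup>2 dvd N}) * (2 * M\<^sup>2 * B))"
  proof (intro order_trans[OF sum_abs] sum_mono)
    fix N assume N: "N \<in> fam"
    let ?C = "{c. A < c \<and> c\<^sup>2 dvd N}"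
    show "\<bar>(\<Sum>c\<in>?C. real_of_int (mu c)) * Nd N\<bar> \<le> real (card ?C) * (2 * M\<^sup>2 * B)"
    proof (cases "?C = {}")
      case False
      then obtain c where c: "A < c" "c\<^sup>2 dvd N" by auto
      have "\<bar>\<Sum>c\<in>?C. real_of_int (mu c)\<bar> \<le> (\<Sum>c\<in>?C. 1)" by (intro order_trans[OF sum_abs] sum_mono mu_abs_le)
      then have "\<bar>\<Sum>c\<in>?C. real_of_int (mu c)\<bar> \<le> real (card ?C)" by simp
      then show ?thesis unfolding abs_mult using Nd_bound[OF N c] by (intro mult_mono) auto
    next
      case True
      then show ?thesis unfolding True by simp
    qed
  qed
  also have "\<dots> = (\<Sum>N\<in>fam. real (card {c. A < c \<and> c\<^sup>2 dvd N})) * (2 * M\<^sup>2 * B)" by (simp only: sum_distrib_right)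
  also have "\<dots> \<le> tl * (2 * M\<^sup>2 * B)" using B0 by (intro mult_right_mono pairs_bound) auto
  finally have 2: "\<bar>\<Sum>N\<in>fam. (\<Sum>c | A < c \<and> c\<^sup>2 dvd N. real_of_int (mu c)) * Nd N\<bar> \<le> 2 * M\<^sup>2 * B * tl" by (simp only: mult.commute)
  show ?thesis unfolding eq Err_def using 1 2 by linarith
qed

end

section \<open>Lower bound for the diagonal and the resonance inequality\<close>

context resonator begin

lemma pr_split: "A' \<subseteq> T \<Longrightarrow> finite T \<Longrightarrow> pr T = pr A' * pr (T - A')"
  unfolding pr_def using prod.subset_diff[of A' T id] by (simp add: mult.commute)

text \<open>Only the triples (T, T - A', pr A' l^2) with A' an i-subset of T are kept. Their
  argument is the square of l pr T, so the symbol is 1. T, A' and l can be read off the triple, and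
  the discarded terms are non-negative.\<close>

lemma Dg_lower:
  assumes N: "N \<in> fam" and sq: "squarefree N"
  shows "(\<Sum>T\<in>{T. T \<subseteq> P \<and> card T = k}. if coprime N (pr T) then real (k choose i) * w0 / (real (pr T) * sqrt (ek * ei)) else 0) \<le> Dg N"
proof -
  let ?K = "{T. T \<subseteq> P \<and> card T = k}"
  let ?TN = "{T\<in>?K. coprime N (pr T)}"
  let ?AA = "\<lambda>T. {A'. A' \<subseteq> T \<and> card A' = i}"
  let ?L = "\<lambda>A'. {l\<in>{1..nm}. coprime l N \<and> pr A' * l\<^sup>2 \<le> nm}"
  let ?S = "SIGMA T:?TN. SIGMA A':?AA T. ?L A'"
  define \<phi> where "\<phi> y = (fst y, fst y - fst (snd y), pr (fst (snd y)) * (snd (snd y))\<^sup>2)" for y :: "nat set \<times> nat set \<times> nat"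
  have finK: "finite ?TN" using finP by auto
  have finT: "finite T" if "T \<in> ?TN" for T using that finP finite_subset by blast
  have finAA: "finite (?AA T)" if "T \<in> ?TN" for T using finT[OF that] by auto
  have kk: "k - i \<noteq> k" using i1 ik by simp
  have prpos: "pr T > 0" if "T \<subseteq> P" for T
    unfolding pr_def using that primeP finP finite_subset[OF that] by (intro prime_factors_prod_primes(3)) auto
  have Sy: "fst (\<phi> y) \<in> Ts \<and> fst (snd (\<phi> y)) \<in> Ts \<and> \<phi> y \<in> Ix \<and> near_square (hh (\<phi> y)) \<and>
      trm N (\<phi> y) = r (fst y) * r (fst y - fst (snd y)) * f (pr (fst (snd y)) * (snd (snd y))\<^sup>2) N"
    if y: "y \<in> ?S" for y
  proof -
    obtain T A' l where y': "y = (T, A', l)" by (cases y) auto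
    have T: "T \<subseteq> P" "card T = k" "coprime N (pr T)" and A': "A' \<subseteq> T" "card A' = i"
      and l: "1 \<le> l" "coprime l N" "pr A' * l\<^sup>2 \<le> nm" using y y' by auto
    have fT: "finite T" using T(1) finP finite_subset by blast
    have fA: "finite A'" using fT A'(1) finite_subset by blast
    have c: "card (T - A') = k - i" using A' T fA by (simp add: card_Diff_subset)
    have TU: "T \<in> Ts" "T - A' \<in> Ts" using T c by (auto simp: Ts_def)
    have pA: "pr A' > 0" using A' T by (intro prpos) auto
    have n: "pr A' * l\<^sup>2 \<in> {1..nm}" using l pA by (auto simp: Suc_le_eq)
    have ix: "\<phi> y \<in> Ix" using TU n by (simp add: Ix_def \<phi>_def y')
    have h: "hh (\<phi> y) = (l * pr T)\<^sup>2"
      using pr_split[OF A'(1) fT] by (simp add: hh_def \<phi>_def y' power2_eq_square mult_ac)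
    have pos: "l * pr T > 0" using l prpos[OF T(1)] by simp
    have d: "near_square (hh (\<phi> y))" unfolding h near_square_def using squarefree_part_square[OF pos] by simp
    have "coprime (int (l * pr T)) (int N)" using l(2) T(3) by (simp add: coprime_commute)
    then have "jac (int (hh (\<phi> y))) N = 1"
      unfolding h using jac_square[OF fam_odd(1)[OF N], of "int (l * pr T)"] by simp
    then show ?thesis using TU ix d by (simp add: trm_def \<phi>_def y')
  qed
  have inj: "inj_on \<phi> ?S"
  proof (rule inj_onI)
    fix y z assume yz: "y \<in> ?S" "z \<in> ?S" "\<phi> y = \<phi> z"
    obtain T A' l where y': "y = (T, A', l)" by (cases y) auto
    obtain U C m where z': "z = (U, C, m)" by (cases z) auto
    have e: "T = U" "T - A' = U - C" "pr A' * l\<^sup>2 = pr C * m\<^sup>2" using yz(3) by (auto simp: \<phi>_def y' z')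
    have s: "A' \<subseteq> T" "C \<subseteq> U" "T \<subseteq> P" using yz y' z' by auto
    then have "A' = C" using e by blast
    moreover have "pr A' > 0" using s by (intro prpos) auto
    ultimately have "l\<^sup>2 = m\<^sup>2" using e(3) by simp
    then have "l = m" by simp
    then show "y = z" using y' z' e(1) \<open>A' = C\<close> by simp
  qed
  have "(\<Sum>T\<in>?K. if coprime N (pr T) then real (k choose i) * w0 / (real (pr T) * sqrt (ek * ei)) else 0)
      = (\<Sum>T\<in>?TN. real (k choose i) * w0 / (real (pr T) * sqrt (ek * ei)))"
    by (rule sum.inter_filter[symmetric]) (use finP in auto)
  also have "\<dots> = (\<Sum>T\<in>?TN. \<Sum>A'\<in>?AA T. w0 / (real (pr T) * sqrt (ek * ei)))"
  proof (intro sum.cong refl)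
    fix T assume T: "T \<in> ?TN"
    then have "card (?AA T) = k choose i" using n_subsets[OF finT[OF T], of i] by simp
    then show "real (k choose i) * w0 / (real (pr T) * sqrt (ek * ei)) = (\<Sum>A'\<in>?AA T. w0 / (real (pr T) * sqrt (ek * ei)))" by simp
  qed
  also have "\<dots> \<le> (\<Sum>T\<in>?TN. \<Sum>A'\<in>?AA T. \<Sum>l\<in>?L A'. r T * r (T - A') * f (pr A' * l\<^sup>2) N)"
  proof (intro sum_mono)
    fix T A' assume T: "T \<in> ?TN" and A': "A' \<in> ?AA T"
    have AP: "A' \<subseteq> P" "card A' = i" using T A' by auto
    have fT: "finite T" by (rule finT[OF T])
    have c: "card (T - A') = k - i" using T A' fT finite_subset[of A' T] by (simp add: card_Diff_subset)
    have pT: "pr T = pr A' * pr (T - A')" using A' fT by (intro pr_split) auto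
    have p: "real (pr A') > 0" "real (pr (T - A')) > 0" "real (pr T) > 0"
      using prpos[of A'] prpos[of "T - A'"] prpos[of T] T AP by auto
    \<comment> \<open>The weight w0 / sqrt (pr A') complements the two coefficients to an expression
      free of A', so that the sum over A' just contributes the binomial coefficient.\<close>
    have "r T * r (T - A') * (w0 / sqrt (real (pr A'))) = w0 / (real (pr T) * sqrt (ek * ei))"
    proof -
      have "r T = 1 / sqrt (real (pr T) * ek)" "r (T - A') = 1 / sqrt (real (pr (T - A')) * ei)"
        using T c kk by (auto simp: r_def)
      moreover have "sqrt (real (pr T) * ek) * sqrt (real (pr (T - A')) * ei) * sqrt (real (pr A')) = real (pr T) * sqrt (ek * ei)"
      proof -
        have "sqrt (real (pr T) * ek) * sqrt (real (pr (T - A')) * ei) * sqrt (real (pr A')) = sqrt (real (pr T) * real (pr A' * pr (T - A'))) * sqrt (ek * ei)"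
          by (simp add: real_sqrt_mult)
        also have "\<dots> = sqrt (real (pr T) * real (pr T)) * sqrt (ek * ei)" by (simp only: pT[symmetric])
        finally show ?thesis using p by simp
      qed
      moreover have "1 / x * (1 / y) * (w0 / z) = w0 / (x * y * z)" for x y z :: real by simp
      ultimately show ?thesis by (simp only:)
    qed
    then have "w0 / (real (pr T) * sqrt (ek * ei)) = r T * r (T - A') * (w0 / sqrt (real (pr A')))" by simp
    also have "\<dots> \<le> r T * r (T - A') * (\<Sum>l\<in>?L A'. f (pr A' * l\<^sup>2) N)"
    proof (intro mult_left_mono mult_nonneg_nonneg)
      show "w0 / sqrt (real (pr A')) \<le> (\<Sum>l\<in>?L A'. f (pr A' * l\<^sup>2) N)"
        using main[OF AP] fam_odd[OF N] sq by blast
      have "T \<in> Ts" "T - A' \<in> Ts" unfolding Ts_def using T c by auto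
      then show "0 \<le> r T" "0 \<le> r (T - A')" by (simp_all add: r_bounds(1))
    qed
    also have "\<dots> = (\<Sum>l\<in>?L A'. r T * r (T - A') * f (pr A' * l\<^sup>2) N)" by (simp only: sum_distrib_left)
    finally show "w0 / (real (pr T) * sqrt (ek * ei)) \<le> (\<Sum>l\<in>?L A'. r T * r (T - A') * f (pr A' * l\<^sup>2) N)" .
  qed
  also have "\<dots> = (\<Sum>T\<in>?TN. \<Sum>z\<in>(SIGMA A':?AA T. ?L A'). r T * r (T - fst z) * f (pr (fst z) * (snd z)\<^sup>2) N)"
    using finAA by (intro sum.cong refl) (subst sum.Sigma, auto simp: case_prod_beta)
  also have "\<dots> = (\<Sum>y\<in>?S. r (fst y) * r (fst y - fst (snd y)) * f (pr (fst (snd y)) * (snd (snd y))\<^sup>2) N)"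
    using finK finAA by (subst sum.Sigma) (auto simp: case_prod_beta intro!: finite_SigmaI)
  also have "\<dots> = (\<Sum>y\<in>?S. trm N (\<phi> y))" by (intro sum.cong refl) (simp only: Sy)
  also have "\<dots> = (\<Sum>x\<in>\<phi> ` ?S. trm N x)" by (simp only: sum.reindex[OF inj] o_def)
  also have "\<dots> \<le> Dg N"
    unfolding Dg_def
  proof (rule sum_mono2)
    show "\<phi> ` ?S \<subseteq> {x\<in>Ix. near_square (hh x)}" using Sy by blast
    fix x assume "x \<in> {x\<in>Ix. near_square (hh x)} - \<phi> ` ?S"
    then show "0 \<le> trm N x" using trm_nonneg(1)[OF N] by blast
  qed simp
  finally show ?thesis .
qed

text \<open>After interchanging the sums, \<open>count\<close> bounds the number of N for each T.
  The sum of 1 / pr T over the k-sets is \<open>ek\<close>, which turns 1 / sqrt (ek ei) into sqrt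
  (ek / ei).\<close>

lemma main_lower:
  "w0 * c0 * (real (k choose i) * sqrt (ek / ei)) \<le> (\<Sum>N\<in>{N\<in>fam. squarefree N}. Dg N)"
proof -
  let ?K = "{T. T \<subseteq> P \<and> card T = k}" and ?F = "{N\<in>fam. squarefree N}"
  let ?g = "\<lambda>T. real (k choose i) * w0 / (real (pr T) * sqrt (ek * ei))"
  have g0: "0 \<le> ?g T" for T using w0 ek eki by simp
  have "w0 * c0 * (real (k choose i) * sqrt (ek / ei)) = (\<Sum>T\<in>?K. ?g T * c0)"
  proof -
    have "(\<Sum>T\<in>?K. ?g T * c0) = (\<Sum>T\<in>?K. real (k choose i) * w0 * c0 / sqrt (ek * ei) * (1 / real (pr T)))"
      by (intro sum.cong refl) (simp add: field_simps)
    also have "\<dots> = real (k choose i) * w0 * c0 / sqrt (ek * ei) * ek"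
      unfolding esym_def inverse_pr[symmetric] by (simp only: sum_distrib_left)
    also have "real (k choose i) * w0 * c0 / sqrt (ek * ei) * ek = w0 * c0 * (real (k choose i) * (ek / sqrt (ek * ei)))"
      by simp
    also have "ek / sqrt (ek * ei) = sqrt (ek / ei)"
    proof -
      have "ek / sqrt (ek * ei) = (sqrt ek * sqrt ek) / (sqrt ek * sqrt ei)" using ek by (simp add: real_sqrt_mult)
      also have "\<dots> = sqrt ek / sqrt ei" by (rule mult_divide_mult_cancel_left) (use ek in simp)
      finally show ?thesis by (simp only: real_sqrt_divide)
    qed
    finally show ?thesis ..
  qed
  also have "\<dots> \<le> (\<Sum>T\<in>?K. ?g T * real (card {N\<in>?F. coprime N (pr T)}))"
  proof (intro sum_mono mult_left_mono g0)
    fix T assume "T \<in> ?K"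
    then have "c0 \<le> real (card {N\<in>{a..b}. N mod 16 = 7 \<and> squarefree N \<and> coprime N (pr T)})" using count by blast
    also have "{N\<in>{a..b}. N mod 16 = 7 \<and> squarefree N \<and> coprime N (pr T)} = {N\<in>?F. coprime N (pr T)}" by (auto simp: fam_def)
    finally show "c0 \<le> real (card {N\<in>?F. coprime N (pr T)})" .
  qed
  also have "\<dots> = (\<Sum>T\<in>?K. \<Sum>N\<in>?F. if coprime N (pr T) then ?g T else 0)"
    by (intro sum.cong refl) (simp add: sum.inter_filter[symmetric] mult.commute)
  also have "\<dots> = (\<Sum>N\<in>?F. \<Sum>T\<in>?K. if coprime N (pr T) then ?g T else 0)" by (rule sum.swap)
  also have "\<dots> \<le> (\<Sum>N\<in>?F. Dg N)" using Dg_lower by (intro sum_mono) auto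
  finally show ?thesis .
qed

text \<open>Pairs T = U give the main term by \<open>sum_r_squared\<close>. For T different from U
  the product is not a near square and the average cancels. Working with the whole family avoids the
  sieve here.\<close>

lemma denominator: "(\<Sum>N\<in>fam. (Rs N)\<^sup>2) \<le> 2 * real (card fam) + M\<^sup>2 * (M * lam)"
proof -
  have "(\<Sum>N\<in>fam. (Rs N)\<^sup>2) = (\<Sum>N\<in>fam. \<Sum>T\<in>Ts. \<Sum>U\<in>Ts. r T * r U * J (pr T * pr U) N)"
  proof (intro sum.cong refl)
    fix N assume N: "N \<in> fam"
    have "(Rs N)\<^sup>2 = (\<Sum>T\<in>Ts. \<Sum>U\<in>Ts. (r T * J (pr T) N) * (r U * J (pr U) N))"
      unfolding Rs_def power2_eq_square by (rule sum_product)
    also have "\<dots> = (\<Sum>T\<in>Ts. \<Sum>U\<in>Ts. r T * r U * J (pr T * pr U) N)"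
      by (intro sum.cong refl) (simp only: J_mult[OF N], simp)
    finally show "(Rs N)\<^sup>2 = (\<Sum>T\<in>Ts. \<Sum>U\<in>Ts. r T * r U * J (pr T * pr U) N)" .
  qed
  also have "\<dots> = (\<Sum>T\<in>Ts. \<Sum>N\<in>fam. \<Sum>U\<in>Ts. r T * r U * J (pr T * pr U) N)" by (rule sum.swap)
  also have "\<dots> = (\<Sum>T\<in>Ts. \<Sum>U\<in>Ts. \<Sum>N\<in>fam. r T * r U * J (pr T * pr U) N)" by (intro sum.cong refl sum.swap)
  also have "\<dots> \<le> (\<Sum>T\<in>Ts. \<Sum>U\<in>Ts. (if T = U then (r T)\<^sup>2 * real (card fam) else 0) + M * lam)"
  proof (intro sum_mono)
    fix T U assume TU: "T \<in> Ts" "U \<in> Ts"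
    have ml: "0 \<le> M * lam" using M1 lam0 by simp
    have eq: "(\<Sum>N\<in>fam. r T * r U * J (pr T * pr U) N) = r T * r U * (\<Sum>N\<in>fam. J (pr T * pr U) N)"
      by (simp only: sum_distrib_left)
    show "(\<Sum>N\<in>fam. r T * r U * J (pr T * pr U) N) \<le> (if T = U then (r T)\<^sup>2 * real (card fam) else 0) + M * lam"
    proof (cases "T = U")
      case True
      have "(\<Sum>N\<in>fam. J (pr T * pr U) N) \<le> (\<Sum>N\<in>fam. 1)"
      proof (rule sum_mono)
        fix N
        show "J (pr T * pr U) N \<le> 1" using jac_abs_le[of "int (pr T * pr U)" N] by linarith
      qed
      then have "r T * r U * (\<Sum>N\<in>fam. J (pr T * pr U) N) \<le> r T * r U * real (card fam)"
        using r_bounds[OF TU(1)] r_bounds[OF TU(2)] by (intro mult_left_mono mult_nonneg_nonneg) auto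
      then show ?thesis using True ml unfolding eq by (simp add: power2_eq_square)
    next
      case False
      note T = TsD[OF TU(1)] and U = TsD[OF TU(2)]
      have nd: "\<not> near_square (pr T * pr U)"
      proof
        assume "near_square (pr T * pr U)"
        then have "T = U" unfolding pr_def using T U by (intro near_square_prod_primes) auto
        then show False using False by simp
      qed
      have ix: "(T, U, 1) \<in> Ix" using TU nm by (simp add: Ix_def)
      have h: "hh (T, U, 1) = pr T * pr U" by (simp add: hh_def)
      have fe: "fam = {N\<in>{a..b}. N mod 16 = 7 \<and> 1\<^sup>2 dvd N}" by (auto simp: fam_def)
      have "\<bar>\<Sum>N\<in>fam. J (pr T * pr U) N\<bar> \<le> 2 * pv_bound (pr T * pr U)"
        unfolding fe by (rule family_average_bound[OF nd]) (use T(5) U(5) in simp)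
      also have "\<dots> \<le> M * lam" using IxD(6)[OF ix] unfolding h by simp
      finally have b: "\<bar>\<Sum>N\<in>fam. J (pr T * pr U) N\<bar> \<le> M * lam" .
      have "\<bar>r T * r U * (\<Sum>N\<in>fam. J (pr T * pr U) N)\<bar> \<le> (1 * 1) * (M * lam)"
        unfolding abs_mult using r_bounds[OF TU(1)] r_bounds[OF TU(2)] b by (intro mult_mono mult_nonneg_nonneg) auto
      then show ?thesis using False unfolding eq by (simp add: abs_le_iff)
    qed
  qed
  also have "\<dots> = (\<Sum>T\<in>Ts. (r T)\<^sup>2 * real (card fam)) + (real (card Ts))\<^sup>2 * (M * lam)"
    by (simp add: sum.distrib power2_eq_square)
  also have "(\<Sum>T\<in>Ts. (r T)\<^sup>2 * real (card fam)) = 2 * real (card fam)"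
    using sum_r_squared by (simp add: sum_distrib_right[symmetric])
  also have "(real (card Ts))\<^sup>2 * (M * lam) \<le> M\<^sup>2 * (M * lam)"
    using card_Ts M1 lam0 by (intro mult_right_mono power_mono) auto
  finally show ?thesis by simp
qed

text \<open>The average of \<open>Fs\<close> with the weights \<open>(Rs N)^2\<close> over
  squarefree N does not exceed its maximum.\<close>

lemma resonance:
  assumes "Err < w0 * c0 * (real (k choose i) * sqrt (ek / ei))"
  shows "\<exists>N\<in>{a..b}. N mod 16 = 7 \<and> squarefree N \<and>
    w0 * c0 * (real (k choose i) * sqrt (ek / ei)) - Err
      \<le> (\<Sum>n=1..nm. f n N * real_of_int (jac (int n) N)) * (2 * real (card {N\<in>{a..b}. N mod 16 = 7}) + M\<^sup>2 * (M * lam))"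
proof -
  let ?F = "{N\<in>fam. squarefree N}"
  let ?Num = "w0 * c0 * (real (k choose i) * sqrt (ek / ei)) - Err"
  have fin: "finite ?F" by simp
  have "(\<Sum>N\<in>?F. (Rs N)\<^sup>2 * Fs N) = (\<Sum>N\<in>?F. Dg N) + (\<Sum>N\<in>?F. Nd N)"
    unfolding sum.distrib[symmetric] by (intro sum.cong refl Dg_Nd) auto
  then have num: "?Num \<le> (\<Sum>N\<in>?F. (Rs N)\<^sup>2 * Fs N)" using main_lower Nd_squarefree_average by linarith
  have ne: "?F \<noteq> {}"
  proof
    assume e: "?F = {}"
    have "?Num \<le> 0" using num unfolding e by simp
    then show False using assms by linarith
  qed
  define mx where "mx = Max (Fs ` ?F)"
  have "mx \<in> Fs ` ?F" unfolding mx_def using fin ne by (intro Max_in) auto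
  then obtain N where N: "N \<in> ?F" "Fs N = mx" by auto
  have le: "Fs N' \<le> mx" if "N' \<in> ?F" for N' unfolding mx_def using fin that by (intro Max_ge) auto
  have "(\<Sum>N\<in>?F. (Rs N)\<^sup>2 * Fs N) \<le> (\<Sum>N\<in>?F. (Rs N)\<^sup>2 * mx)" by (intro sum_mono mult_left_mono le) auto
  also have "\<dots> = mx * (\<Sum>N\<in>?F. (Rs N)\<^sup>2)" by (simp add: sum_distrib_left mult.commute)
  finally have 1: "?Num \<le> mx * (\<Sum>N\<in>?F. (Rs N)\<^sup>2)" using num by linarith
  have s0: "0 \<le> (\<Sum>N\<in>?F. (Rs N)\<^sup>2)" by (intro sum_nonneg) auto
  \<comment> \<open>Positivity of the numerator makes the maximum non-negative, which permits
    enlarging the denominator from squarefree N to the whole family.\<close>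
  have mx0: "0 \<le> mx"
  proof (rule ccontr)
    assume "\<not> 0 \<le> mx"
    then have "mx * (\<Sum>N\<in>?F. (Rs N)\<^sup>2) \<le> 0" using s0 by (intro mult_nonpos_nonneg) auto
    then show False using 1 assms by linarith
  qed
  have "(\<Sum>N\<in>?F. (Rs N)\<^sup>2) \<le> (\<Sum>N\<in>fam. (Rs N)\<^sup>2)" by (intro sum_mono2) auto
  also have "\<dots> \<le> 2 * real (card fam) + M\<^sup>2 * (M * lam)" by (rule denominator)
  finally have "mx * (\<Sum>N\<in>?F. (Rs N)\<^sup>2) \<le> mx * (2 * real (card fam) + M\<^sup>2 * (M * lam))" using mx0 by (intro mult_left_mono)
  then have "?Num \<le> Fs N * (2 * real (card fam) + M\<^sup>2 * (M * lam))" unfolding N(2) by (rule order_trans[OF 1])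
  then show ?thesis using N(1) unfolding Fs_def fam_def by blast
qed

end

section \<open>Choice of the resonator\<close>

text \<open>Inclusion bound with Q = (b - a) / 16: squares of odd c > 2 remove at most Q / 2, and
  the k primes of T, all above y >= 8 k, at most Q / 8. What remains is 3 Q / 8.\<close>

lemma count_squarefree_coprime:
  fixes y k :: nat
  assumes "1 \<le> a" "a \<le> b" "1 \<le> y" "8 * k \<le> y" "finite T" "card T = k" "\<And>p. p \<in> T \<Longrightarrow> prime p \<and> odd p \<and> y < p"
  shows "3 * real (b - a) / 128 - 1 - sqrt (real b) - real k
    \<le> real (card {N\<in>{a..b}. N mod 16 = 7 \<and> squarefree N \<and> coprime N (pr T)})"
proof -
  define C where "C = nat \<lfloor>sqrt (real b)\<rfloor>"
  let ?F = "{N\<in>{a..b}. N mod 16 = 7}"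
  let ?G = "{N\<in>{a..b}. N mod 16 = 7 \<and> squarefree N \<and> coprime N (pr T)}"
  let ?D = "\<lambda>e. {N\<in>{a..b}. N mod 16 = 7 \<and> e dvd N}"
  let ?I = "{c\<in>{2<..C}. odd c}"
  define Q where "Q = real (b - a) / 16"
  have Q0: "0 \<le> Q" by (simp add: Q_def)
  have "?F \<subseteq> ?G \<union> (\<Union>c\<in>?I. ?D (c\<^sup>2)) \<union> (\<Union>p\<in>T. ?D p)"
  proof
    fix N assume N: "N \<in> ?F"
    then have o: "odd N" and N0: "N > 0" using mod16_7D[of N] assms(1) by auto
    show "N \<in> ?G \<union> (\<Union>c\<in>?I. ?D (c\<^sup>2)) \<union> (\<Union>p\<in>T. ?D p)"
    proof (cases "squarefree N")
      case False
      then obtain c where c: "c\<^sup>2 dvd N" "\<not> c dvd 1" by (rule not_squarefreeE)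
      have oc: "odd c" using c(1) o by (auto intro: dvd_trans)
      have "c \<noteq> 1" "c \<noteq> 0" "c \<noteq> 2" using c(2) oc by (auto intro: ccontr)
      then have "2 < c" by linarith
      moreover have "c \<le> C"
      proof -
        have "c\<^sup>2 \<le> b" using c(1) N N0 dvd_imp_le[of "c\<^sup>2" N] by auto
        then have "real (c\<^sup>2) \<le> real b" by (rule of_nat_mono)
        then have "real c \<le> sqrt (real b)" by (intro real_le_rsqrt) simp
        then show ?thesis unfolding C_def by (simp add: le_nat_floor)
      qed
      ultimately have "c \<in> ?I" using oc by simp
      then show ?thesis using N c(1) by blast
    next
      case True
      show ?thesis
      proof (cases "coprime N (pr T)")
        case False
        have "\<exists>p\<in>T. p dvd N"
        proof (rule ccontr)
          assume *: "\<not> (\<exists>p\<in>T. p dvd N)"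
          have "coprime N (pr T)" unfolding pr_def
          proof (rule prod_coprime_right)
            fix p assume "p \<in> T"
            then have "prime p" "\<not> p dvd N" using * assms(7) by auto
            then show "coprime N p" using prime_imp_coprime coprime_commute by blast
          qed
          then show False using False by simp
        qed
        then show ?thesis using N by blast
      qed (use N True in blast)
    qed
  qed
  then have "card ?F \<le> card (?G \<union> (\<Union>c\<in>?I. ?D (c\<^sup>2)) \<union> (\<Union>p\<in>T. ?D p))"
    by (rule card_mono[rotated]) (use assms(5) in auto)
  also have "\<dots> \<le> card ?G + card (\<Union>c\<in>?I. ?D (c\<^sup>2)) + card (\<Union>p\<in>T. ?D p)"
    by (intro order_trans[OF card_Un_le] add_mono card_Un_le order_refl)
  also have "\<dots> \<le> card ?G + (\<Sum>c\<in>?I. card (?D (c\<^sup>2))) + (\<Sum>p\<in>T. card (?D p))"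
    by (intro add_mono card_UN_le assms(5)) auto
  finally have le: "real (card ?F) \<le> real (card ?G) + (\<Sum>c\<in>?I. real (card (?D (c\<^sup>2)))) + (\<Sum>p\<in>T. real (card (?D p)))"
    by (metis (mono_tags, lifting) of_nat_add of_nat_le_iff of_nat_sum sum.cong)
  have "(\<Sum>c\<in>?I. real (card (?D (c\<^sup>2)))) \<le> (\<Sum>c\<in>?I. Q * (1 / (real c)\<^sup>2) + 1)"
  proof (rule sum_mono)
    fix c assume "c \<in> ?I"
    then have "odd (c\<^sup>2)" by simp
    from card_family_dvd_le[OF this assms(2)] show "real (card (?D (c\<^sup>2))) \<le> Q * (1 / (real c)\<^sup>2) + 1"
      by (simp add: Q_def)
  qed
  also have "\<dots> \<le> (\<Sum>c\<in>{2<..C}. Q * (1 / (real c)\<^sup>2) + 1)" using Q0 by (intro sum_mono2) auto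
  also have "\<dots> = Q * (\<Sum>c\<in>{2<..C}. 1 / (real c)\<^sup>2) + real (C - 2)" by (simp add: sum.distrib sum_distrib_left)
  also have "\<dots> \<le> Q * (1 / real 2) + sqrt (real b)"
  proof (intro add_mono mult_left_mono sum_inverse_squares_tail Q0)
    have "real (C - 2) \<le> real C" by simp
    also have "\<dots> \<le> sqrt (real b)" unfolding C_def by (simp add: of_nat_floor)
    finally show "real (C - 2) \<le> sqrt (real b)" .
  qed auto
  finally have s1: "(\<Sum>c\<in>?I. real (card (?D (c\<^sup>2)))) \<le> Q / 2 + sqrt (real b)" by simp
  have "(\<Sum>p\<in>T. real (card (?D p))) \<le> (\<Sum>p\<in>T. Q / real y + 1)"
  proof (rule sum_mono)
    fix p assume p: "p \<in> T"
    then have op: "odd p" using assms(7) by blast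
    have "real (card (?D p)) \<le> Q / real p + 1" using card_family_dvd_le[OF op assms(2)] by (simp add: Q_def)
    also have "\<dots> \<le> Q / real y + 1" using p assms(3,7) Q0 by (auto intro!: divide_left_mono mult_pos_pos simp: less_imp_le prime_gt_0_nat)
    finally show "real (card (?D p)) \<le> Q / real y + 1" .
  qed
  also have "\<dots> = Q * (real k / real y) + real k" using assms(6) by (simp add: algebra_simps)
  also have "\<dots> \<le> Q * (1 / 8) + real k"
  proof (intro add_mono mult_left_mono Q0 order_refl)
    have "8 * real k \<le> real y" using assms(4) by linarith
    then show "real k / real y \<le> 1 / 8" using assms(3) by (simp add: field_simps)
  qed
  finally have s2: "(\<Sum>p\<in>T. real (card (?D p))) \<le> Q / 8 + real k" by simp
  have "Q - 1 \<le> real (card ?F)" using card_family_ge[OF assms(2)] by (simp add: Q_def)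
  then have "Q - 1 - (Q / 2 + sqrt (real b)) - (Q / 8 + real k) \<le> real (card ?G)" using le s1 s2 by linarith
  moreover have "3 * real (b - a) / 128 = Q - Q / 2 - Q / 8" by (simp add: Q_def)
  ultimately show ?thesis by linarith
qed

abbreviation "LL q \<equiv> sqrt (ln q)"
abbreviation "UU q \<equiv> sqrt (ln q) / ln (ln q)"
abbreviation "lo q \<equiv> nat \<lceil>q::real\<rceil>"
abbreviation "hi q \<equiv> nat \<lfloor>2 * q::real\<rfloor>"
text \<open>Bound for the products in the resonator. The exponent is tiny so that the powers of
  \<open>MM q\<close> in the error terms stay below the savings in both ranges, down to q^0.01 for
  long sums.\<close>

abbreviation "MM q \<equiv> q powr (1 / 2000)"

lemma lo_hi:
  assumes "q \<ge> (2::real)"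
  shows "1 \<le> lo q" "lo q \<le> hi q" "real (hi q - lo q) \<le> q" "q - 2 \<le> real (hi q - lo q)" "real (hi q) \<le> 2 * q" "q \<le> real (lo q)"
proof -
  have l: "real (lo q) = of_int \<lceil>q\<rceil>" "real (hi q) = of_int \<lfloor>2 * q\<rfloor>" using assms by auto
  then have b: "q \<le> real (lo q)" "real (lo q) < q + 1" "real (hi q) \<le> 2 * q" "2 * q - 1 < real (hi q)" by linarith+
  then show "real (hi q) \<le> 2 * q" "q \<le> real (lo q)" by auto
  have "real (lo q) < real (hi q) + 1" using b assms by linarith
  then have "lo q < hi q + 1" by linarith
  then show le: "lo q \<le> hi q" by linarith
  show "1 \<le> lo q" using b(1) assms by linarith
  have "real (hi q - lo q) = real (hi q) - real (lo q)" using le by (simp add: of_nat_diff)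
  then show "real (hi q - lo q) \<le> q" "q - 2 \<le> real (hi q - lo q)" using b by linarith+
qed

lemma pr_le_power:
  assumes "finite T" "\<And>p. p \<in> T \<Longrightarrow> real p \<le> z" "1 \<le> z" "card T \<le> k"
  shows "real (pr T) \<le> z ^ k"
proof -
  have "real (pr T) = (\<Prod>p\<in>T. real p)" by (simp add: pr_def)
  also have "\<dots> \<le> (\<Prod>p\<in>T. z)" using assms(2) by (intro prod_mono) auto
  also have "\<dots> = z ^ card T" by simp
  also have "\<dots> \<le> z ^ k" using assms(3,4) by (intro power_increasing)
  finally show ?thesis .
qed

text \<open>Everything about the resonator that depends on q alone, so that one choice serves all
  x.\<close>

definition good_resonator :: "real \<Rightarrow> nat set \<Rightarrow> nat \<Rightarrow> nat \<Rightarrow> bool" where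
  "good_resonator q P k i \<longleftrightarrow> finite P \<and> (\<forall>p\<in>P. prime p \<and> odd p) \<and>
     (\<forall>T. T \<subseteq> P \<longrightarrow> card T \<le> k \<longrightarrow> real (pr T) \<le> MM q) \<and>
     (\<forall>T. T \<subseteq> P \<longrightarrow> card T = i \<longrightarrow> real (pr T) \<le> exp (LL q / 2)) \<and>
     1 \<le> i \<and> i \<le> k \<and> 0 < esym (\<lambda>p. 1 / real p) P k \<and> 0 < esym (\<lambda>p. 1 / real p) P (k - i) \<and>
     exp (2 * UU q) \<le> real (k choose i) * sqrt (esym (\<lambda>p. 1 / real p) P k / esym (\<lambda>p. 1 / real p) P (k - i)) \<and>
     (\<forall>T. T \<subseteq> P \<longrightarrow> card T = k \<longrightarrow>
        q / 64 \<le> real (card {N\<in>{lo q..hi q}. N mod 16 = 7 \<and> squarefree N \<and> coprime N (pr T)}))"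

text \<open>With l = ln L, where ln ln q = 2 l, the quantity k s / i^2 is at least l / 1000 and thus
  unbounded. The gain is a power with exponent i >= L / (48 l), so a base e^48 suffices for exp (L /
  l), which is \<open>exp (2 * UU q)\<close>.\<close>

lemma eventually_good_resonator: "eventually (\<lambda>q. \<exists>P k i. good_resonator q P k i) at_top"
proof -
  obtain y0 where y0: "\<And>y. y \<ge> y0 \<Longrightarrow> 1/4 \<le> (\<Sum>p\<in>{p\<in>{y<..y^4}. prime p}. 1 / real p)"
    using sum_prime_reciprocals_ge unfolding eventually_sequentially by blast
  have "eventually (\<lambda>q::real. real y0 + 1 \<le> LL q ^ 3) at_top" by real_asymp
  moreover have "eventually (\<lambda>q::real. 8 * (LL q)\<^sup>2 + 10 \<le> LL q ^ 3) at_top" by real_asymp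
  moreover have "eventually (\<lambda>q::real. 2 \<le> LL q / (24 * ln (LL q))) at_top" by real_asymp
  moreover have "eventually (\<lambda>q::real. LL q / (24 * ln (LL q)) + 1 \<le> (LL q)\<^sup>2 / (24000 * ln (LL q))) at_top" by real_asymp
  \<comment> \<open>96 is twice 48, because the gain involves the square root of k s / i^2.\<close>
  moreover have "eventually (\<lambda>q::real. exp 96 * 1000 \<le> ln (LL q)) at_top" by real_asymp
  moreover have "eventually (\<lambda>q::real. q / 64 \<le> 3 * (q - 2) / 128 - 1 - sqrt (2 * q) - (LL q)\<^sup>2) at_top" by real_asymp
  moreover have "eventually (\<lambda>q::real. q \<ge> 100 \<and> LL q \<ge> 100) at_top"
    by (intro eventually_conj; real_asymp)
  ultimately show ?thesis
  proof eventually_elim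
    case (elim q)
    define L where "L = LL q"
    define l where "l = ln L"
    have L2: "L\<^sup>2 = ln q" unfolding L_def using elim(7) by simp
    have l0: "l \<ge> 1"
    proof -
      have "exp 96 * 1000 \<ge> (1::real)" using exp_ge_add_one_self[of "96::real"] by simp
      then show ?thesis using elim(5) unfolding l_def L_def by linarith
    qed
    have LLl: "ln (ln q) = 2 * l" using L2 elim(7) unfolding l_def L_def by (simp add: ln_sqrt)
    \<comment> \<open>L^3 exceeds 8 k, so k times the largest weight 1 / y is at most 1/8. Half of
      the reciprocal sum 1/4 remains as s.\<close>
    define y where "y = nat \<lfloor>L ^ 3\<rfloor>"
    \<comment> \<open>The primes are at most L^12 = exp (12 l). As 24000 = 12 * 2000, products of k
      of them stay below exp (L^2 / 2000), which is \<open>MM q\<close>.\<close>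
    define k where "k = nat \<lfloor>L\<^sup>2 / (24000 * l)\<rfloor>"
    \<comment> \<open>As 24 = 12 * 2, products of i primes are at most exp (L / 2), well below the
      shortest lengths, which are about exp L.\<close>
    define i where "i = nat \<lfloor>L / (24 * l)\<rfloor>"
    have L100: "L \<ge> 100" using elim(7) unfolding L_def by simp
    have ry: "real y \<le> L ^ 3" "L ^ 3 - 1 < real y"
    proof -
      have "real y = of_int \<lfloor>L ^ 3\<rfloor>" unfolding y_def using L100 by simp
      then show "real y \<le> L ^ 3" "L ^ 3 - 1 < real y" by linarith+
    qed
    have rk: "real k \<le> L\<^sup>2 / (24000 * l)" "L\<^sup>2 / (24000 * l) - 1 < real k"
    proof -
      have "real k = of_int \<lfloor>L\<^sup>2 / (24000 * l)\<rfloor>" unfolding k_def using l0 by simp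
      then show "real k \<le> L\<^sup>2 / (24000 * l)" "L\<^sup>2 / (24000 * l) - 1 < real k" by linarith+
    qed
    have ri: "real i \<le> L / (24 * l)" "L / (24 * l) - 1 < real i"
    proof -
      have "real i = of_int \<lfloor>L / (24 * l)\<rfloor>" unfolding i_def using l0 L100 by simp
      then show "real i \<le> L / (24 * l)" "L / (24 * l) - 1 < real i" by linarith+
    qed
    note el = elim[folded L_def, folded l_def]
    have i2: "L / (48 * l) \<le> real i" "1 \<le> i"
    proof -
      have "L / (48 * l) = L / (24 * l) / 2" by simp
      then show "L / (48 * l) \<le> real i" using el(3) ri by linarith
      show "1 \<le> i" using el(3) ri by linarith
    qed
    have ik: "i \<le> k" using el(4) ri rk by linarith
    have k2: "L\<^sup>2 / (48000 * l) \<le> real k"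
    proof -
      have "L\<^sup>2 / (48000 * l) = L\<^sup>2 / (24000 * l) / 2" by simp
      then show ?thesis using el(3,4) rk by linarith
    qed
    have kL: "real k \<le> L\<^sup>2"
    proof -
      have "L\<^sup>2 / (24000 * l) \<le> L\<^sup>2 / 1" using l0 by (intro divide_left_mono) auto
      then show ?thesis using rk by simp
    qed
    have ky: "8 * k \<le> y" using kL ry el(2) by linarith
    have y10: "10 \<le> y"
    proof -
      have "9 < real y" using ry(2) el(2) zero_le_power2[of L] by linarith
      then show ?thesis by linarith
    qed
    then have yy: "y \<ge> y0" "y \<ge> 1" using ry el(1) by linarith+
    define P where "P = {p\<in>{y<..y^4}. prime p}"
    have finP: "finite P" unfolding P_def by simp
    have P: "prime p \<and> odd p \<and> y < p \<and> real p \<le> L ^ 12" if "p \<in> P" for p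
    proof -
      have p: "prime p" "y < p" "p \<le> y ^ 4" using that by (auto simp: P_def)
      have "odd p" using p prime_odd_nat[of p] y10 by simp
      moreover have "real p \<le> L ^ 12"
      proof -
        have "real p \<le> real (y ^ 4)" using p(3) by (rule of_nat_mono)
        also have "\<dots> = real y ^ 4" by simp
        also have "\<dots> \<le> (L ^ 3) ^ 4" using ry by (intro power_mono) auto
        finally show ?thesis by (simp add: power_mult[symmetric])
      qed
      ultimately show ?thesis using p by blast
    qed
    have Lpow: "(L ^ 12) ^ j = exp (12 * l * real j)" for j
    proof -
      have "L ^ 12 = exp (12 * l)" unfolding l_def using L100 exp_of_nat_mult[of 12 "ln L"] by simp
      then show ?thesis by (simp add: exp_of_nat_mult[symmetric] mult.commute)
    qed
    have L12: "1 \<le> L ^ 12" using L100 by simp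
    have prodM: "real (pr T) \<le> MM q" if "T \<subseteq> P" "card T \<le> k" for T
    proof -
      have "real (pr T) \<le> (L ^ 12) ^ k"
        by (rule pr_le_power) (use that P finP finite_subset L12 in auto)
      also have "\<dots> \<le> exp (L\<^sup>2 / 2000)" unfolding Lpow using rk(1) l0 by (simp add: field_simps)
      also have "\<dots> = MM q" unfolding L2 powr_def using elim(7) by simp
      finally show ?thesis .
    qed
    have prodi: "real (pr T) \<le> exp (L / 2)" if "T \<subseteq> P" "card T = i" for T
    proof -
      have "real (pr T) \<le> (L ^ 12) ^ i"
        by (rule pr_le_power) (use that P finP finite_subset L12 in auto)
      also have "\<dots> \<le> exp (L / 2)" unfolding Lpow using ri(1) l0 by (simp add: field_simps)
      finally show ?thesis .
    qed
    have w: "0 \<le> 1 / real p \<and> 1 / real p \<le> 1 / real y" if "p \<in> P" for p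
      using P[OF that] yy by (auto intro!: divide_left_mono mult_pos_pos)
    have s: "1 / 8 + real k * (1 / real y) \<le> (\<Sum>p\<in>P. 1 / real p)"
    proof -
      have "real k * (1 / real y) \<le> 1 / 8" using ky yy(2) by (simp add: field_simps)
      moreover have "1 / 4 \<le> (\<Sum>p\<in>P. 1 / real p)" unfolding P_def by (rule y0[OF yy(1)])
      ultimately show ?thesis by linarith
    qed
    note R = resonance_ratio[OF finP w _ s _ i2(2) ik]
    have e1: "0 < esym (\<lambda>p. 1 / real p) P k" and e2: "0 < esym (\<lambda>p. 1 / real p) P (k - i)"
      and e3: "sqrt (real k * (1/8) / (real i)\<^sup>2) ^ i \<le> real (k choose i) * sqrt (esym (\<lambda>p. 1 / real p) P k / esym (\<lambda>p. 1 / real p) P (k - i))"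
      using R by auto
    have "exp (2 * UU q) \<le> sqrt (real k * (1/8) / (real i)\<^sup>2) ^ i"
    proof -
      have i0: "real i > 0" using i2 by simp
      have "exp 96 \<le> real k * (1/8) / (real i)\<^sup>2"
      proof -
        have "exp 96 \<le> l / 1000" using el(5) by simp
        also have "\<dots> \<le> (L\<^sup>2 / (48000 * l)) * (1/8) / (L / (24 * l))\<^sup>2"
          using l0 L100 by (simp add: field_simps power2_eq_square)
        also have "\<dots> \<le> real k * (1/8) / (real i)\<^sup>2"
          using k2 ri(1) i0 by (intro frac_le mult_right_mono power_mono) auto
        finally show ?thesis .
      qed
      then have "sqrt (exp 96) \<le> sqrt (real k * (1/8) / (real i)\<^sup>2)" by simp
      moreover have "sqrt (exp 96) = exp (48::real)"
      proof -
        have "exp 96 = (exp (48::real))\<^sup>2" by (simp add: power2_eq_square exp_add[symmetric])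
        then show ?thesis by simp
      qed
      ultimately have "exp 48 ^ i \<le> sqrt (real k * (1/8) / (real i)\<^sup>2) ^ i" by (intro power_mono) auto
      moreover have "exp (2 * UU q) \<le> exp (48::real) ^ i"
      proof -
        have "2 * UU q = L / l" unfolding LLl L_def by simp
        also have "\<dots> = 48 * (L / (48 * l))" by simp
        also have "\<dots> \<le> 48 * real i" using i2(1) by (intro mult_left_mono) auto
        finally show ?thesis by (simp add: exp_of_nat_mult[symmetric] mult.commute)
      qed
      ultimately show ?thesis by linarith
    qed
    then have e4: "exp (2 * UU q) \<le> real (k choose i) * sqrt (esym (\<lambda>p. 1 / real p) P k / esym (\<lambda>p. 1 / real p) P (k - i))"
      using e3 by linarith
    have cnt: "q / 64 \<le> real (card {N\<in>{lo q..hi q}. N mod 16 = 7 \<and> squarefree N \<and> coprime N (pr T)})" if "T \<subseteq> P" "card T = k" for T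
    proof -
      have q2: "q \<ge> 2" using elim(7) by simp
      note lh = lo_hi[OF q2]
      have "3 * real (hi q - lo q) / 128 - 1 - sqrt (real (hi q)) - real k \<le> real (card {N\<in>{lo q..hi q}. N mod 16 = 7 \<and> squarefree N \<and> coprime N (pr T)})"
        using that P finP finite_subset[OF that(1)] by (intro count_squarefree_coprime[OF lh(1,2) yy(2) ky]) auto
      moreover have "sqrt (real (hi q)) \<le> sqrt (2 * q)" using lh(5) by simp
      ultimately show ?thesis using el(6) kL lh(4) by argo
    qed
    have "good_resonator q P k i" unfolding good_resonator_def
      using finP P prodM prodi i2(2) ik e1 e2 e4 cnt unfolding L_def by blast
    then show ?case by blast
  qed
qed

text \<open>The resonance inequality with all parameters but the weights fixed. The quantifiers over
  lengths and weights stand inside the eventuality, which makes the threshold for q uniform in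
  x.\<close>

lemma eventually_resonance:
  "eventually (\<lambda>q. \<forall>nm A f V B w0. 1 \<le> nm \<longrightarrow> real nm \<le> 2 * q \<longrightarrow> 1 \<le> A \<longrightarrow> real A \<le> sqrt q \<longrightarrow> 0 < w0 \<longrightarrow>
     (\<forall>n\<in>{1..nm}. \<forall>N\<in>{lo q..hi q}. (0::real) \<le> f n N) \<longrightarrow>
     (\<forall>n\<in>{1..nm}. \<bar>f n (hi q)\<bar> + (\<Sum>N=lo q..<hi q. \<bar>f n (Suc N) - f n N\<bar>) \<le> V n) \<longrightarrow>
     (\<forall>N\<in>{lo q..hi q}. \<forall>c. N mod 16 = 7 \<longrightarrow> A < c \<longrightarrow> c\<^sup>2 dvd N \<longrightarrow> \<bar>\<Sum>n=1..nm. f n N * real_of_int (jac (int n) N)\<bar> \<le> B) \<longrightarrow>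
     (\<forall>N\<in>{lo q..hi q}. \<forall>h>0. (\<Sum>n\<in>{n\<in>{1..nm}. near_square (n * h)}. f n N) \<le> B) \<longrightarrow>
     (\<forall>N\<in>{lo q..hi q}. \<forall>\<alpha>\<ge>1. N mod 16 = 7 \<longrightarrow> squarefree N \<longrightarrow> real \<alpha> \<le> exp (LL q / 2) \<longrightarrow>
        w0 / sqrt (real \<alpha>) \<le> (\<Sum>l\<in>{l\<in>{1..nm}. coprime l N \<and> \<alpha> * l\<^sup>2 \<le> nm}. f (\<alpha> * l\<^sup>2) N)) \<longrightarrow>
     real A * (MM q ^ 3 * (8 * ln q) * (\<Sum>n=1..nm. V n * sqrt (real n))) + 6 * (MM q)\<^sup>2 * B * q / real A \<le> w0 * q / 128 \<longrightarrow>
     (\<exists>N\<in>{lo q..hi q}. N mod 16 = 7 \<and> squarefree N \<and>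
        w0 * exp (2 * UU q) / 128 \<le> (\<Sum>n=1..nm. f n N * real_of_int (jac (int n) N)))) at_top"
proof -
  have "eventually (\<lambda>q::real. (MM q)\<^sup>2 * (2 * q) \<le> q ^ 2) at_top" by real_asymp
  \<comment> \<open>The family has about q / 16 members, so the whole denominator is at most
    q.\<close>
  moreover have "eventually (\<lambda>q::real. 2 * (q / 16 + 1) + MM q ^ 3 * (8 * ln q) \<le> q) at_top" by real_asymp
  moreover have "eventually (\<lambda>q::real. 1 \<le> ln q) at_top" by real_asymp
  moreover have "eventually (\<lambda>q::real. 2 \<le> q) at_top" by real_asymp
  moreover note eventually_good_resonator
  ultimately show ?thesis
  proof eventually_elim
    case (elim q)
    note lh = lo_hi[OF elim(4)]
    obtain P k i where g: "good_resonator q P k i" using elim(5) by blast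
    show ?case
    proof (intro allI impI)
      fix nm A :: nat and f :: "nat \<Rightarrow> nat \<Rightarrow> real" and V :: "nat \<Rightarrow> real" and B w0 :: real
      assume nm: "1 \<le> nm" "real nm \<le> 2 * q" and A: "1 \<le> A" "real A \<le> sqrt q" and w0: "0 < w0"
        and f0: "\<forall>n\<in>{1..nm}. \<forall>N\<in>{lo q..hi q}. 0 \<le> f n N"
        and TV: "\<forall>n\<in>{1..nm}. \<bar>f n (hi q)\<bar> + (\<Sum>N=lo q..<hi q. \<bar>f n (Suc N) - f n N\<bar>) \<le> V n"
        and tF: "\<forall>N\<in>{lo q..hi q}. \<forall>c. N mod 16 = 7 \<longrightarrow> A < c \<longrightarrow> c\<^sup>2 dvd N \<longrightarrow> \<bar>\<Sum>n=1..nm. f n N * real_of_int (jac (int n) N)\<bar> \<le> B"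
        and tD: "\<forall>N\<in>{lo q..hi q}. \<forall>h>0. (\<Sum>n\<in>{n\<in>{1..nm}. near_square (n * h)}. f n N) \<le> B"
        and mn: "\<forall>N\<in>{lo q..hi q}. \<forall>\<alpha>\<ge>1. N mod 16 = 7 \<longrightarrow> squarefree N \<longrightarrow> real \<alpha> \<le> exp (LL q / 2) \<longrightarrow>
          w0 / sqrt (real \<alpha>) \<le> (\<Sum>l\<in>{l\<in>{1..nm}. coprime l N \<and> \<alpha> * l\<^sup>2 \<le> nm}. f (\<alpha> * l\<^sup>2) N)"
        and er: "real A * (MM q ^ 3 * (8 * ln q) * (\<Sum>n=1..nm. V n * sqrt (real n))) + 6 * (MM q)\<^sup>2 * B * q / real A \<le> w0 * q / 128"
      \<comment> \<open>The argument of the logarithm is at most q^2, whence 2 + 4 ln q <= 8 ln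
        q.\<close>
      have lam: "2 * (1 + ln ((MM q)\<^sup>2 * real nm)) \<le> 8 * ln q"
      proof -
        have "(MM q)\<^sup>2 * real nm \<le> (MM q)\<^sup>2 * (2 * q)" using nm by (intro mult_left_mono) auto
        then have "(MM q)\<^sup>2 * real nm \<le> q ^ 2" using elim(1) by linarith
        moreover have "0 < (MM q)\<^sup>2 * real nm" using nm elim(4) by simp
        ultimately have "ln ((MM q)\<^sup>2 * real nm) \<le> ln (q ^ 2)" by (intro ln_mono) auto
        also have "\<dots> = 2 * ln q" using elim(4) by (simp add: ln_realpow)
        finally show ?thesis using elim(3) by argo
      qed
      have prP: "1 \<le> pr T" if "T \<subseteq> P" for T
      proof -
        have "finite P" "\<forall>p\<in>P. prime p" using g by (auto simp: good_resonator_def)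
        then have "pr T > 0" unfolding pr_def using that finite_subset[of T P] by (intro prime_factors_prod_primes(3)) auto
        then show ?thesis by simp
      qed
      interpret R: resonator P k i "MM q" "8 * ln q" "lo q" "hi q" nm A f V B w0 "q / 64"
      proof unfold_locales
        show "finite P" "1 \<le> i" "i \<le> k" "0 < esym (\<lambda>p. 1 / real p) P k" "0 < esym (\<lambda>p. 1 / real p) P (k - i)"
          using g by (auto simp: good_resonator_def)
        show "1 \<le> lo q" "lo q \<le> hi q" by (rule lh)+
        show "1 \<le> nm" "1 \<le> A" "0 \<le> w0" "0 \<le> q / 64" using nm A w0 elim(4) by auto
        show "2 * (1 + ln ((MM q)\<^sup>2 * real nm)) \<le> 8 * ln q" by (rule lam)
        show "prime p \<and> odd p" if "p \<in> P" for p using g that unfolding good_resonator_def by blast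
        show "real (pr T) \<le> MM q" if "T \<subseteq> P" "card T \<le> k" for T using g that unfolding good_resonator_def by blast
        show "0 \<le> f n N" if "n \<in> {1..nm}" "N \<in> {lo q..hi q}" for n N using f0 that by blast
        show "\<bar>f n (hi q)\<bar> + (\<Sum>N=lo q..<hi q. \<bar>f n (Suc N) - f n N\<bar>) \<le> V n" if "n \<in> {1..nm}" for n
          using TV that by blast
        show "\<bar>\<Sum>n=1..nm. f n N * real_of_int (jac (int n) N)\<bar> \<le> B"
          if "N \<in> {lo q..hi q}" "N mod 16 = 7" "A < c" "c\<^sup>2 dvd N" for N c using tF that by blast
        show "(\<Sum>n\<in>{n\<in>{1..nm}. near_square (n * h)}. f n N) \<le> B" if "N \<in> {lo q..hi q}" "0 < h" for N h
          using tD that by blast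
        show "q / 64 \<le> real (card {N\<in>{lo q..hi q}. N mod 16 = 7 \<and> squarefree N \<and> coprime N (pr T)})"
          if "T \<subseteq> P" "card T = k" for T using g that unfolding good_resonator_def by blast
        show "w0 / sqrt (real (pr T)) \<le> (\<Sum>l\<in>{l\<in>{1..nm}. coprime l N \<and> pr T * l\<^sup>2 \<le> nm}. f (pr T * l\<^sup>2) N)"
          if "T \<subseteq> P" "card T = i" "N \<in> {lo q..hi q}" "N mod 16 = 7" "squarefree N" for T N
        proof -
          have "real (pr T) \<le> exp (LL q / 2)" using g that(1,2) unfolding good_resonator_def by blast
          then show ?thesis using mn that(3-5) prP[OF that(1)] by blast
        qed
      qed
      let ?rho = "real (k choose i) * sqrt (R.ek / R.ei)"
      have rho: "exp (2 * UU q) \<le> ?rho" using g by (simp add: good_resonator_def)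
      have "0 \<le> UU q" using elim(3) by simp
      then have "1 \<le> exp (2 * UU q)" by simp
      then have rho1: "1 \<le> ?rho" using rho by linarith
      have Anz: "0 < real A" using A by simp
      have tl: "R.tl \<le> 3 * q / real A"
      proof -
        have "real (hi q - lo q) / real A \<le> q / real A" using lh(3) by (intro divide_right_mono) auto
        moreover have "sqrt (real (hi q)) \<le> 2 * (q / real A)"
        proof -
          have "real (hi q) \<le> 4 * q" using lh(5) elim(4) by linarith
          then have "sqrt (real (hi q)) \<le> sqrt (4 * q)" by (rule real_sqrt_le_mono)
          also have "\<dots> = 2 * sqrt q" by (simp add: real_sqrt_mult)
          also have "sqrt q = q / sqrt q" using elim(4) by (simp add: real_div_sqrt)
          also have "q / sqrt q \<le> q / real A" using A elim(4) Anz by (intro divide_left_mono) auto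
          finally show ?thesis by simp
        qed
        ultimately show ?thesis unfolding R.tl_def by argo
      qed
      have "2 * (MM q)\<^sup>2 * B * R.tl \<le> 2 * (MM q)\<^sup>2 * B * (3 * q / real A)"
        using tl R.B0 by (intro mult_left_mono) auto
      also have "\<dots> = 6 * (MM q)\<^sup>2 * B * q / real A" by simp
      finally have "R.Err \<le> real A * (MM q ^ 3 * (8 * ln q) * (\<Sum>n=1..nm. V n * sqrt (real n))) + 6 * (MM q)\<^sup>2 * B * q / real A"
        unfolding R.Err_def by (simp add: power3_eq_cube power2_eq_square mult.assoc)
      then have Err: "R.Err \<le> w0 * q / 128" using er by linarith
      have "w0 * q / 128 * 1 \<le> w0 * q / 128 * ?rho" using rho1 w0 elim(4) by (intro mult_left_mono) auto
      then have E2: "R.Err \<le> w0 * q / 128 * ?rho" using Err by linarith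
      have "0 < w0 * q / 128" using w0 elim(4) by simp
      moreover have "0 < ?rho" using rho1 by linarith
      ultimately have pos: "0 < w0 * q / 128 * ?rho" by (rule mult_pos_pos)
      \<comment> \<open>Half of the main term pays for the error, hence 128 = 2 * 64 in the
        conclusion.\<close>
      have sp: "w0 * (q / 64) * ?rho = w0 * q / 128 * ?rho + w0 * q / 128 * ?rho" by simp
      have lt: "R.Err < w0 * (q / 64) * ?rho" using E2 pos sp by linarith
      obtain N where N: "N \<in> {lo q..hi q}" "N mod 16 = 7" "squarefree N"
        "w0 * (q / 64) * ?rho - R.Err \<le> (\<Sum>n=1..nm. f n N * real_of_int (jac (int n) N)) * (2 * real (card {N\<in>{lo q..hi q}. N mod 16 = 7}) + (MM q)\<^sup>2 * (MM q * (8 * ln q)))"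
        using R.resonance[OF lt] by blast
      let ?F = "\<Sum>n=1..nm. f n N * real_of_int (jac (int n) N)"
      let ?D = "2 * real (card {N\<in>{lo q..hi q}. N mod 16 = 7}) + (MM q)\<^sup>2 * (MM q * (8 * ln q))"
      have D: "?D \<le> q"
      proof -
        have "{N\<in>{lo q..hi q}. N mod 16 = 7} = {N\<in>{lo q..hi q}. N mod 16 = 7 \<and> 1 dvd N}" by auto
        then have "real (card {N\<in>{lo q..hi q}. N mod 16 = 7}) \<le> real (hi q - lo q) / (16 * real 1) + 1"
          using card_family_dvd_le[of 1 "lo q" "hi q"] lh(2) by simp
        then have "real (card {N\<in>{lo q..hi q}. N mod 16 = 7}) \<le> q / 16 + 1" using lh(3) by simp
        moreover have "(MM q)\<^sup>2 * (MM q * (8 * ln q)) = MM q ^ 3 * (8 * ln q)" by (simp add: power3_eq_cube power2_eq_square)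
        ultimately show ?thesis using elim(2) by argo
      qed
      have D0: "0 \<le> ?D" using elim(3) by simp
      have ge: "w0 * q / 128 * ?rho \<le> ?F * ?D" using N(4) E2 sp by linarith
      have F0: "0 \<le> ?F"
      proof (rule ccontr)
        assume "\<not> 0 \<le> ?F"
        then have "?F * ?D \<le> 0" using D0 by (intro mult_nonpos_nonneg) auto
        then show False using ge pos by linarith
      qed
      have "w0 * q / 128 * exp (2 * UU q) \<le> w0 * q / 128 * ?rho" using rho w0 elim(4) by (intro mult_left_mono) auto
      also have "\<dots> \<le> ?F * q" using ge mult_left_mono[OF D F0] by linarith
      finally have "(w0 * exp (2 * UU q) / 128) * q \<le> ?F * q" by (simp add: mult_ac)
      then have "w0 * exp (2 * UU q) / 128 \<le> ?F" using elim(4) by simp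
      then show "\<exists>N\<in>{lo q..hi q}. N mod 16 = 7 \<and> squarefree N \<and> w0 * exp (2 * UU q) / 128 \<le> (\<Sum>n=1..nm. f n N * real_of_int (jac (int n) N))"
        using N by blast
    qed
  qed
qed

text \<open>\<open>card_coprime_ge\<close> uniformly in N. Since Y is at least exp (L / 5), larger
  than any power of ln q, the prime powers sharing a factor with N are negligible.\<close>

lemma eventually_coprime_count:
  "eventually (\<lambda>q. \<forall>Y N. exp (LL q / 5) \<le> real Y \<longrightarrow> real Y \<le> 2 * q \<longrightarrow> 0 < N \<longrightarrow> real N \<le> 2 * q \<longrightarrow>
     real Y / (6 * ln q) \<le> real (card {l\<in>{1..Y}. coprime l N})) at_top"
proof -
  have "eventually (\<lambda>q::real. 2 * ln (2 * q) + 2 \<le> 4 * ln q) at_top" by real_asymp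
  moreover have "eventually (\<lambda>q::real. 288 * ln q ^ 3 \<le> exp (LL q / 5)) at_top" by real_asymp
  moreover have "eventually (\<lambda>q::real. 100 \<le> exp (LL q / 5)) at_top" by real_asymp
  moreover have "eventually (\<lambda>q::real. ln (2 * q) \<le> 3/2 * ln q) at_top" by real_asymp
  moreover have "eventually (\<lambda>q::real. 1 \<le> ln q) at_top" by real_asymp
  moreover have "eventually (\<lambda>q::real. 2 \<le> q) at_top" by real_asymp
  ultimately show ?thesis
  proof eventually_elim
    case (elim q)
    show ?case
    proof (intro allI impI)
      fix Y N :: nat
      assume Y: "exp (LL q / 5) \<le> real Y" "real Y \<le> 2 * q" and N: "0 < N" "real N \<le> 2 * q"
      define R where "R = nat \<lceil>log 2 (2 * q)\<rceil> + 1"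
      have lg: "log 2 (2 * q) \<ge> 0" using elim(6) by simp
      have R: "log 2 (2 * q) < real R" "real R \<le> log 2 (2 * q) + 2" unfolding R_def using lg by linarith+
      have "2 * q = 2 powr (log 2 (2 * q))" using elim(6) by simp
      also have "\<dots> < 2 powr (real R)" using R by simp
      also have "\<dots> = real (2 ^ R)" by (simp add: powr_realpow)
      finally have q2: "2 * q < real (2 ^ R)" .
      have "real Y < real (2 ^ R)" "real N < real (2 ^ R)" using q2 Y N by linarith+
      then have "Y < 2 ^ R" "N < 2 ^ R" by (simp_all only: of_nat_less_iff)
      moreover have Y100: "100 \<le> Y" using Y elim(3) by linarith
      ultimately have c: "real Y / (3 * ln (real Y)) - real (R * R) \<le> real (card {l\<in>{1..Y}. coprime l N})"
        using N by (intro card_coprime_ge) auto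
      have lY: "0 < ln (real Y)" "ln (real Y) \<le> 3/2 * ln q"
      proof -
        show "0 < ln (real Y)" using Y100 by simp
        have "ln (real Y) \<le> ln (2 * q)" using Y Y100 by (intro ln_mono) auto
        then show "ln (real Y) \<le> 3/2 * ln q" using elim(4) by linarith
      qed
      have "real Y / (9/2 * ln q) \<le> real Y / (3 * ln (real Y))" using lY elim(5) by (intro divide_left_mono mult_pos_pos) auto
      moreover have "real (R * R) \<le> real Y / (18 * ln q)"
      proof -
        have "ln (2 * q) / ln 2 \<le> ln (2 * q) / (1/2)"
          using elim(6) ln2_ge_two_thirds by (intro divide_left_mono) auto
        then have "log 2 (2 * q) \<le> 2 * ln (2 * q)" by (simp add: log_def)
        then have "real R \<le> 4 * ln q" using R elim(1) by linarith
        then have "real R * real R \<le> (4 * ln q) * (4 * ln q)" by (intro mult_mono) auto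
        also have "\<dots> = (288 * ln q ^ 3) / (18 * ln q)" using elim(5) by (simp add: power3_eq_cube)
        also have "\<dots> \<le> real Y / (18 * ln q)" using elim(2,5) Y by (intro divide_right_mono) auto
        finally show ?thesis by simp
      qed
      \<comment> \<open>2/9 - 1/18 = 1/6.\<close>
      moreover have "real Y / (9/2 * ln q) - real Y / (18 * ln q) = real Y / (6 * ln q)" using elim(5) by (simp add: field_simps)
      ultimately show "real Y / (6 * ln q) \<le> real (card {l\<in>{1..Y}. coprime l N})" using c by argo
    qed
  qed
qed

lemma nat_floor_half: "1 \<le> z \<Longrightarrow> z / 2 \<le> real (nat \<lfloor>z\<rfloor>) \<and> real (nat \<lfloor>z\<rfloor>) \<le> z \<and> 1 \<le> nat \<lfloor>z\<rfloor>"
proof -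
  assume z: "1 \<le> z"
  then have r: "real (nat \<lfloor>z\<rfloor>) = of_int \<lfloor>z\<rfloor>" by simp
  have "1 \<le> nat \<lfloor>z\<rfloor>" using z by (simp add: le_nat_floor)
  then have "1 \<le> real (nat \<lfloor>z\<rfloor>)" by simp
  then show ?thesis using r z by linarith
qed

section \<open>Short and long sums\<close>

text \<open>Constant weights have variation 1. With A near sqrt (q / X), the averaged error is
  smaller than the main term by about sqrt (X / q), and the sieve tail by about (X / q)^(1/4), up to
  powers of \<open>MM q\<close> and ln q. Up to q^0.93 both savings prevail.\<close>

lemma direct_range:
  "eventually (\<lambda>q. \<forall>X. exp (LL q) / 2 \<le> real X \<longrightarrow> real X \<le> q powr 0.93 \<longrightarrow>
     (\<exists>N\<in>{lo q..hi q}. N mod 16 = 7 \<and> squarefree N \<and>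
        sqrt (real X) * exp (2 * UU q) / (1536 * ln q) \<le> (\<Sum>n=1..X. real_of_int (jac (int n) N)))) at_top"
proof -
  \<comment> \<open>The square root is of size exp (L / 4), which leaves room for the lower limit
    exp (L / 5) of \<open>eventually_coprime_count\<close>.\<close>
  have "eventually (\<lambda>q::real. exp (LL q / 5) * 2 \<le> sqrt (exp (LL q) / 2 / exp (LL q / 2))) at_top" by real_asymp
  moreover have "eventually (\<lambda>q::real. q powr 0.93 \<le> q) at_top" by real_asymp
  moreover have "eventually (\<lambda>q::real. 2 * (1 + ln (2 * q)) \<le> 4 * ln q) at_top" by real_asymp
  moreover have "eventually (\<lambda>q::real. 8 * MM q ^ 3 * ln q * (sqrt q * sqrt (q powr 0.93)) \<le> q / (3072 * ln q)) at_top" by real_asymp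
  moreover have "eventually (\<lambda>q::real. 12 * (MM q)\<^sup>2 * ((8 * ln q * sqrt q * sqrt (2 / sqrt (q / q powr 0.93)) + 2 * sqrt (q powr 0.93)) * sqrt q) \<le> q / (3072 * ln q)) at_top" by real_asymp
  moreover have "eventually (\<lambda>q::real. 1 \<le> ln q) at_top" by real_asymp
  moreover have "eventually (\<lambda>q::real. 2 \<le> q) at_top" by real_asymp
  moreover have "eventually (\<lambda>q::real. 1 \<le> exp (LL q / 5)) at_top" by real_asymp
  moreover note eventually_resonance eventually_coprime_count
  ultimately show ?thesis
  proof eventually_elim
    case (elim q)
    note lh = lo_hi[OF elim(7)]
    show ?case
    proof (intro allI impI)
      fix X :: nat
      assume X: "exp (LL q) / 2 \<le> real X" "real X \<le> q powr 0.93"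
      have X0: "0 < real X" using X(1) exp_gt_zero[of "LL q"] by linarith
      then have X1: "1 \<le> X" by simp
      have Xq: "real X \<le> q" using X elim(2) by linarith
      define s where "s = sqrt (q / real X)"
      have s1: "1 \<le> s" unfolding s_def using Xq X0 by simp
      have sq: "sqrt q = s * sqrt (real X)" unfolding s_def using X0 by (simp add: real_sqrt_divide)
      define A where "A = nat \<lfloor>s\<rfloor>"
      have A: "s / 2 \<le> real A" "real A \<le> s" "1 \<le> A" using nat_floor_half[OF s1] unfolding A_def by auto
      have sX: "1 \<le> sqrt (real X)" using X1 by simp
      have "s * 1 \<le> s * sqrt (real X)" using s1 sX by (intro mult_left_mono) auto
      then have Aq: "real A \<le> sqrt q" using A(2) sq by linarith
      \<comment> \<open>First summand: Polya-Vinogradov for N divisible by the square of some c > A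
        >= s / 2. Second summand: the count of near squares.\<close>
      define B where "B = 8 * ln q * sqrt q * sqrt (2 / s) + 2 * sqrt (real X)"
      \<comment> \<open>12 = 2 * 6: rounding down z may halve it, and the coprimality count costs 6
        ln q.\<close>
      define w0 where "w0 = sqrt (real X) / (12 * ln q)"
      have w00: "0 < w0" unfolding w0_def using X0 elim(6) by simp
      have tF: "\<bar>\<Sum>n=1..X. 1 * real_of_int (jac (int n) N)\<bar> \<le> B"
        if "N \<in> {lo q..hi q}" "N mod 16 = 7" "A < c" "c\<^sup>2 dvd N" for N c
      proof -
        have "\<bar>\<Sum>n=1..X. real_of_int (jac (int n) N)\<bar> \<le> 2 * pv_bound N / sqrt (real c)"
          using that by (intro character_sum_bound) auto
        also have "\<dots> \<le> 2 * (4 * ln q * sqrt q) / sqrt (s / 2)"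
        proof (rule frac_le)
          have "real N \<le> 2 * q" using that(1) lh(5) by (auto intro: order_trans)
          moreover have "1 \<le> N"
          proof -
            have "lo q \<le> N" using that(1) unfolding atLeastAtMost_iff by blast
            then show ?thesis using lh(1) by linarith
          qed
          ultimately have "pv_bound N \<le> sqrt (2 * q) * (1 + ln (2 * q))"
            unfolding pv_bound_def by (intro mult_mono add_mono ln_mono) auto
          also have "\<dots> \<le> (2 * sqrt q) * (1 + ln (2 * q))"
          proof (intro mult_right_mono)
            have "sqrt (2 * q) \<le> sqrt (4 * q)" using elim(7) by simp
            then show "sqrt (2 * q) \<le> 2 * sqrt q" by (simp add: real_sqrt_mult)
            show "0 \<le> 1 + ln (2 * q)" using elim(7) by simp
          qed
          also have "\<dots> = (2 * (1 + ln (2 * q))) * sqrt q" by simp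
          also have "\<dots> \<le> 4 * ln q * sqrt q" using elim(3,7) by (intro mult_right_mono) auto
          finally show "2 * pv_bound N \<le> 2 * (4 * ln q * sqrt q)" by (simp add: mult_ac)
          have "s / 2 \<le> real c" using A(1) that(3) by linarith
          then show "sqrt (s / 2) \<le> sqrt (real c)" by simp
        qed (use s1 elim(6,7) in auto)
        also have "\<dots> = 8 * ln q * sqrt q * sqrt (2 / s)" using s1 by (simp add: real_sqrt_divide)
        also have "\<dots> \<le> B" unfolding B_def by simp
        finally show ?thesis by simp
      qed
      have tD: "(\<Sum>n\<in>{n\<in>{1..X}. near_square (n * h)}. 1) \<le> B" if "h > 0" for h
      proof -
        have "(\<Sum>n\<in>{n\<in>{1..X}. near_square (n * h)}. 1) = real (card {n\<in>{1..X}. near_square (n * h)})" by simp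
        also have "\<dots> \<le> 2 * sqrt (real X)" by (rule card_near_square_le[OF that])
        also have "\<dots> \<le> B" unfolding B_def using elim(6,7) s1 by simp
        finally show ?thesis .
      qed
      have mn: "w0 / sqrt (real \<alpha>) \<le> (\<Sum>l\<in>{l\<in>{1..X}. coprime l N \<and> \<alpha> * l\<^sup>2 \<le> X}. 1)"
        if N: "N \<in> {lo q..hi q}" and \<alpha>: "\<alpha> \<ge> 1" "real \<alpha> \<le> exp (LL q / 2)" for N \<alpha>
      proof -
        define z where "z = sqrt (real X / real \<alpha>)"
        have "exp (LL q) / 2 / exp (LL q / 2) \<le> real X / real \<alpha>" using X(1) \<alpha> by (intro frac_le) auto
        then have "sqrt (exp (LL q) / 2 / exp (LL q / 2)) \<le> z" unfolding z_def by simp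
        then have z: "exp (LL q / 5) * 2 \<le> z" using elim(1) by linarith
        then have z1: "1 \<le> z" using elim(8) by linarith
        define Y where "Y = nat \<lfloor>z\<rfloor>"
        have Y: "z / 2 \<le> real Y" "real Y \<le> z" using nat_floor_half[OF z1] unfolding Y_def by auto
        have Yl: "\<alpha> * l\<^sup>2 \<le> X" if "l \<le> Y" for l
        proof -
          have "real l \<le> z" using that Y(2) by linarith
          then have "(real l)\<^sup>2 \<le> z\<^sup>2" by (intro power_mono) auto
          also have "z\<^sup>2 = real X / real \<alpha>" unfolding z_def by simp
          finally have "real (\<alpha> * l\<^sup>2) \<le> real X" using \<alpha> by (simp add: field_simps)
          then show ?thesis by (simp only: of_nat_le_iff)
        qed
        have YX: "l \<le> X" if "l \<le> Y" for l
        proof -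
          have "l \<le> l\<^sup>2" by (simp add: power2_eq_square)
          also have "\<dots> \<le> \<alpha> * l\<^sup>2" using \<alpha> by simp
          finally show ?thesis using Yl[OF that] by simp
        qed
        have "real Y \<le> real X" using YX[of Y] by simp
        then have Y2: "real Y \<le> 2 * q" using Xq elim(7) by linarith
        have Y1: "exp (LL q / 5) \<le> real Y" using z Y(1) by linarith
        have "lo q \<le> N" "N \<le> hi q" using N unfolding atLeastAtMost_iff by blast+
        then have N0: "0 < N" "real N \<le> real (hi q)" using lh(1) by linarith+
        then have N2: "real N \<le> 2 * q" using lh(5) by linarith
        have c: "real Y / (6 * ln q) \<le> real (card {l\<in>{1..Y}. coprime l N})"
          by (rule elim(10)[rule_format, OF Y1 Y2 N0(1) N2])
        have "w0 / sqrt (real \<alpha>) = z / (12 * ln q)" unfolding w0_def z_def by (simp add: real_sqrt_divide)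
        also have "\<dots> = (z / 2) / (6 * ln q)" by simp
        also have "\<dots> \<le> real Y / (6 * ln q)" using Y(1) elim(6) by (intro divide_right_mono) auto
        also have "\<dots> \<le> real (card {l\<in>{1..Y}. coprime l N})" by (rule c)
        also have "\<dots> \<le> real (card {l\<in>{1..X}. coprime l N \<and> \<alpha> * l\<^sup>2 \<le> X})"
          using Yl YX by (intro of_nat_mono card_mono) auto
        also have "\<dots> = (\<Sum>l\<in>{l\<in>{1..X}. coprime l N \<and> \<alpha> * l\<^sup>2 \<le> X}. 1)" by simp
        finally show ?thesis .
      qed
      have er: "real A * (MM q ^ 3 * (8 * ln q) * (\<Sum>n=1..X. 1 * sqrt (real n))) + 6 * (MM q)\<^sup>2 * B * q / real A \<le> w0 * q / 128"
      proof -
        have "(\<Sum>n=1..X. 1 * sqrt (real n)) \<le> (\<Sum>n=1..X. sqrt (real X))" by (intro sum_mono) auto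
        then have sm: "(\<Sum>n=1..X. 1 * sqrt (real n)) \<le> real X * sqrt (real X)" by simp
        have sXb: "sqrt (real X) \<le> sqrt (q powr 0.93)" using X(2) by simp
        have "real A * (MM q ^ 3 * (8 * ln q) * (\<Sum>n=1..X. 1 * sqrt (real n))) \<le> s * (MM q ^ 3 * (8 * ln q) * (real X * sqrt (real X)))"
          using A(2) sm elim(6) by (intro mult_mono mult_left_mono) (auto intro!: sum_nonneg mult_nonneg_nonneg)
        also have "\<dots> = 8 * MM q ^ 3 * ln q * (sqrt q * sqrt (real X)) * sqrt (real X)"
          unfolding sq using X0 by (simp add: mult_ac)
        also have "\<dots> \<le> 8 * MM q ^ 3 * ln q * (sqrt q * sqrt (q powr 0.93)) * sqrt (real X)"
          using sXb elim(6,7) by (intro mult_right_mono mult_left_mono) auto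
        also have "\<dots> \<le> q / (3072 * ln q) * sqrt (real X)" using elim(4) by (intro mult_right_mono) auto
        finally have t1: "real A * (MM q ^ 3 * (8 * ln q) * (\<Sum>n=1..X. 1 * sqrt (real n))) \<le> q / (3072 * ln q) * sqrt (real X)" .
        have Bb: "B \<le> 8 * ln q * sqrt q * sqrt (2 / sqrt (q / q powr 0.93)) + 2 * sqrt (q powr 0.93)"
        proof -
          have "q / q powr 0.93 \<le> q / real X" using X X0 elim(7) by (intro divide_left_mono) auto
          then have "sqrt (q / q powr 0.93) \<le> s" unfolding s_def by simp
          then have "2 / s \<le> 2 / sqrt (q / q powr 0.93)" using elim(7) s1 by (intro divide_left_mono mult_pos_pos) auto
          then show ?thesis unfolding B_def using sXb elim(6,7) by (intro add_mono mult_left_mono) auto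
        qed
        have B0: "0 \<le> B" unfolding B_def using elim(6,7) s1 by simp
        have qA: "q / real A \<le> 2 * (sqrt q * sqrt (real X))"
        proof -
          have "q / real A \<le> q / (s / 2)" using A elim(7) s1 by (intro divide_left_mono mult_pos_pos) auto
          also have "\<dots> = 2 * ((sqrt q * sqrt q) / s)" using elim(7) by simp
          also have "(sqrt q * sqrt q) / s = sqrt q * sqrt (real X)"
          proof -
            have "sqrt q / s = sqrt (real X)" using sq s1 by simp
            then show ?thesis by (metis times_divide_eq_right)
          qed
          finally show ?thesis .
        qed
        have "6 * (MM q)\<^sup>2 * B * q / real A = 6 * (MM q)\<^sup>2 * B * (q / real A)" by simp
        also have "\<dots> \<le> 6 * (MM q)\<^sup>2 * B * (2 * (sqrt q * sqrt (real X)))" using qA B0 by (intro mult_left_mono) auto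
        also have "\<dots> = 12 * (MM q)\<^sup>2 * (B * sqrt q) * sqrt (real X)" by simp
        also have "\<dots> \<le> 12 * (MM q)\<^sup>2 * ((8 * ln q * sqrt q * sqrt (2 / sqrt (q / q powr 0.93)) + 2 * sqrt (q powr 0.93)) * sqrt q) * sqrt (real X)"
          using Bb elim(7) by (intro mult_right_mono mult_left_mono) auto
        also have "\<dots> \<le> q / (3072 * ln q) * sqrt (real X)" using elim(5) by (intro mult_right_mono) auto
        finally have t2: "6 * (MM q)\<^sup>2 * B * q / real A \<le> q / (3072 * ln q) * sqrt (real X)" .
        have "w0 * q / 128 = q / (3072 * ln q) * sqrt (real X) + q / (3072 * ln q) * sqrt (real X)"
          unfolding w0_def using elim(6) by (simp add: field_simps)
        then show ?thesis using t1 t2 by linarith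
      qed
      have "\<exists>N\<in>{lo q..hi q}. N mod 16 = 7 \<and> squarefree N \<and> w0 * exp (2 * UU q) / 128 \<le> (\<Sum>n=1..X. 1 * real_of_int (jac (int n) N))"
        by (rule elim(9)[rule_format, where f = "\<lambda>n N. 1" and V = "\<lambda>n. 1" and B = B and A = A])
          (use X1 Xq elim(7) A Aq w00 tF tD mn er in auto)
      moreover have "w0 * exp (2 * UU q) / 128 = sqrt (real X) * exp (2 * UU q) / (1536 * ln q)"
        unfolding w0_def by simp
      ultimately show "\<exists>N\<in>{lo q..hi q}. N mod 16 = 7 \<and> squarefree N \<and>
        sqrt (real X) * exp (2 * UU q) / (1536 * ln q) \<le> (\<Sum>n=1..X. real_of_int (jac (int n) N))" by (simp only: mult_1)
    qed
  qed
qed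

lemma sum_inverse_sqrt_le: "(\<Sum>n=1..m. 1 / sqrt (real n)) \<le> 2 * sqrt (real m)"
proof (induction m)
  case (Suc m)
  have "1 / sqrt (real (Suc m)) \<le> 2 * (sqrt (real (Suc m)) - sqrt (real m))"
  proof -
    let ?a = "sqrt (real (Suc m))" and ?b = "sqrt (real m)"
    have "?b * ?a \<le> (?b\<^sup>2 + ?a\<^sup>2) / 2" using sum_squares_bound[of ?b ?a] by simp
    also have "\<dots> = (2 * real m + 1) / 2" by simp
    finally have "1 \<le> (2 * (?a - ?b)) * ?a" by (simp add: algebra_simps)
    then show ?thesis by (simp add: pos_divide_le_eq)
  qed
  then show ?case using Suc by simp
qed simp

text \<open>The j-th smallest element is at least j. The dual kernel grows like l^2, while for the l
  coprime to N only their number is known.\<close>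

lemma sum_squares_ge_card_cube:
  fixes S :: "nat set"
  assumes "finite S" "\<And>l. l \<in> S \<Longrightarrow> 1 \<le> l"
  shows "(real (card S))^3 / 3 \<le> (\<Sum>l\<in>S. (real l)\<^sup>2)"
  using assms
proof (induction S rule: finite_linorder_max_induct)
  case (insert b S)
  have sub: "S \<subseteq> {1..<b}" using insert by force
  then have "card S \<le> b - 1" using card_mono[OF _ sub] by simp
  moreover have "1 \<le> b" using insert by simp
  ultimately have c: "real (card S) + 1 \<le> real b" by linarith
  have "(real (card S) + 1)^3 / 3 \<le> (real (card S))^3 / 3 + (real (card S) + 1)\<^sup>2"
    by (simp add: power3_eq_cube power2_eq_square algebra_simps)
  also have "(real (card S) + 1)\<^sup>2 \<le> (real b)\<^sup>2" using c by (intro power_mono) auto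
  also have "(real (card S))^3 / 3 \<le> (\<Sum>l\<in>S. (real l)\<^sup>2)" using insert by simp
  finally have "(real (card S) + 1)^3 / 3 \<le> (\<Sum>l\<in>S. (real l)\<^sup>2) + (real b)\<^sup>2" by simp
  moreover have "b \<notin> S" using insert(2) by blast
  ultimately show ?case using insert(1) by (simp add: add.commute)
qed simp

text \<open>The main term comes from l up to z, where the kernel is of order alpha l^2 X^2 / q. The
  sum of about z^3 produces w0 / sqrt alpha, and the count of coprime l enters cubed, hence ln q ^
  3. The subtracted 4 collects the losses from averaging and truncation.\<close>

lemma dual_range:
  "eventually (\<lambda>q. \<forall>X. q powr 0.93 \<le> real X \<longrightarrow> real X \<le> q / exp (LL q) \<longrightarrow>
     (\<exists>N\<in>{lo q..hi q}. N mod 16 = 7 \<and> squarefree N \<and>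
        sqrt (real X) * (exp (2 * UU q) / (53084160 * ln q ^ 3) - 4) \<le> (\<Sum>n=1..X. real_of_int (jac (int n) N)))) at_top"
proof -
  have "eventually (\<lambda>q::real. exp (LL q / 5) * 2 \<le> sqrt (exp (LL q) / 4 / exp (LL q / 2))) at_top" by real_asymp
  moreover have "eventually (\<lambda>q::real. 2 * q * (1 + ln q) \<le> 4 * q * ln q) at_top" by real_asymp
  moreover have "eventually (\<lambda>q::real. q powr 0.01 / q powr 0.93 * (MM q ^ 3 * (8 * ln q) * (8 * q * sqrt q + 4 * q powr 1.53 * sqrt (q powr 1.53 / q powr 0.93))) \<le> q / (53084160 * ln q ^ 3)) at_top" by real_asymp
  moreover have "eventually (\<lambda>q::real. 48 * (MM q)\<^sup>2 * q * ln q / q powr 0.01 \<le> q / (53084160 * ln q ^ 3)) at_top" by real_asymp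
  moreover have "eventually (\<lambda>q::real. 1 \<le> ln q) at_top" by real_asymp
  moreover have "eventually (\<lambda>q::real. 100 \<le> q) at_top" by real_asymp
  moreover have "eventually (\<lambda>q::real. 1 \<le> exp (LL q / 5)) at_top" by real_asymp
  moreover have "eventually (\<lambda>q::real. 16 \<le> q powr 0.93) at_top" by real_asymp
  moreover have "eventually (\<lambda>q::real. q powr 0.01 * sqrt (q / q powr 0.93) \<le> sqrt q) at_top" by real_asymp
  moreover have "eventually (\<lambda>q::real. q / 4 \<le> q powr 1.53) at_top" by real_asymp
  moreover have "eventually (\<lambda>q::real. q\<^sup>2 * 4 / q powr 1.53 \<le> 4 * sqrt q) at_top" by real_asymp
  moreover have "eventually (\<lambda>q::real. 4 \<le> exp (2 * UU q) / (26542080 * ln q ^ 3)) at_top" by real_asymp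
  moreover have "eventually (\<lambda>q::real. 1 \<le> q powr 0.01) at_top" by real_asymp
  moreover note eventually_resonance eventually_coprime_count
  ultimately show ?thesis
  proof eventually_elim
    case (elim q)
    have q2: "2 \<le> q" using elim(6) by simp
    have q1: "1 \<le> q" using elim(6) by simp
    note lh = lo_hi[OF q2]
    show ?case
    proof (intro allI impI)
      fix X :: nat
      assume X: "q powr 0.93 \<le> real X" "real X \<le> q / exp (LL q)"
      have X16: "16 \<le> real X" using X(1) elim(8) by linarith
      have X0: "0 < real X" using X16 by linarith
      have eX: "exp (LL q) \<le> q / real X" using X(2) X0 by (simp add: field_simps)
      have "1 \<le> exp (LL q)" using elim(5) by simp
      then have qX1: "1 \<le> q / real X" using eX by linarith
      then have Xq: "real X \<le> q" using X0 by (simp add: field_simps)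
      define s where "s = sqrt (q / real X)"
      have s1: "1 \<le> s" unfolding s_def using qX1 by simp
      \<comment> \<open>The loss W in \<open>dual_lower\<close> is then of the trivial size sqrt
        X.\<close>
      define W where "W = nat \<lfloor>sqrt (real X)\<rfloor>"
      define r where "r = sqrt (real X)"
      have rr: "r * r = real X" unfolding r_def by simp
      have r4: "4 \<le> r" unfolding r_def using X16 by (intro real_le_rsqrt) simp
      have W: "r / 2 \<le> real W" "real W \<le> r" "1 \<le> W" using nat_floor_half[of r] r4 unfolding W_def r_def[symmetric] by linarith+
      have W2: "2 * W \<le> X"
      proof -
        have "2 * r \<le> r * r" using r4 by (intro mult_right_mono) auto
        then have "2 * real W \<le> real X" using W(2) rr by linarith
        then show ?thesis by linarith
      qed
      then have WX: "W \<le> X" by simp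
      \<comment> \<open>An exponent above 1.5 keeps the truncation error N^2 / (W Z) within O(sqrt
        (q X)). Then Z is at most q^0.6 and the variation sum of order q^1.83, which is still
        affordable.\<close>
      define Z where "Z = q powr 1.53 / real X"
      have Zq: "q / (4 * real X) \<le> Z"
      proof -
        have "q / (4 * real X) = (q / 4) / real X" by simp
        also have "\<dots> \<le> Z" unfolding Z_def using elim(10) by (intro divide_right_mono) auto
        finally show ?thesis .
      qed
      have "1 \<le> q powr 1.53 / real X"
      proof -
        have "q powr 1 \<le> q powr 1.53" using q1 by (intro powr_mono) auto
        then have "real X \<le> q powr 1.53" using Xq q1 by simp
        then show ?thesis using X0 by simp
      qed
      then have Z1: "1 \<le> Z" unfolding Z_def .
      \<comment> \<open>The kernel vanishes for n > N / 2, and N <= 2 q, so about q terms capture it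
        completely.\<close>
      define nm where "nm = nat \<lfloor>q\<rfloor>"
      have nm: "real nm \<le> q" "q - 1 < real nm" "1 \<le> nm"
      proof -
        have "real nm = of_int \<lfloor>q\<rfloor>" unfolding nm_def using q1 by simp
        then show 1: "real nm \<le> q" "q - 1 < real nm" by linarith+
        show "1 \<le> nm" using 1 elim(6) by linarith
      qed
      \<comment> \<open>The extra q^0.01 over s lets the sieve tail be estimated with the trivial
        bound B.\<close>
      define a where "a = s * q powr 0.01"
      have a1: "1 \<le> a"
      proof -
        have "1 * 1 \<le> a" unfolding a_def using s1 elim(13) by (intro mult_mono) auto
        then show ?thesis by simp
      qed
      define A where "A = nat \<lfloor>a\<rfloor>"
      have A: "a / 2 \<le> real A" "real A \<le> a" "1 \<le> A" using nat_floor_half[OF a1] unfolding A_def by auto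
      have Aq: "real A \<le> sqrt q"
      proof -
        have "q / real X \<le> q / q powr 0.93" using X q1 X0 by (intro divide_left_mono) auto
        then have "s \<le> sqrt (q / q powr 0.93)" unfolding s_def by simp
        then have "s * q powr 0.01 \<le> sqrt (q / q powr 0.93) * q powr 0.01" by (intro mult_right_mono) auto
        then have "a \<le> q powr 0.01 * sqrt (q / q powr 0.93)" unfolding a_def by (simp add: mult.commute)
        then show ?thesis using A(2) elim(9) by linarith
      qed
      define B where "B = 4 * q * ln q"
      \<comment> \<open>\<open>207360 = 5 * 3 * 12 ^ 3 * 8\<close>: the losses in the kernel, the sum of squares, the count and \<open>z ^ 3\<close>\<close>
      define w0 where "w0 = sqrt q * r / (207360 * ln q ^ 3)"
      \<comment> \<open>The value at the right end and at most q steps of the non-oscillating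
        variation account for 4 q / n, the oscillating phase for 4 X.\<close>
      define V where "V n = 4 * q / real n + (if real n \<le> Z then 4 * real X else 0)" for n :: nat
      have w00: "0 < w0" unfolding w0_def using r4 elim(5) q2 by (intro divide_pos_pos mult_pos_pos zero_less_power) auto
      have memN: "1 \<le> N \<and> q \<le> real N \<and> real N \<le> 2 * q" if "N \<in> {lo q..hi q}" for N
      proof -
        have "lo q \<le> N" "N \<le> hi q" using that unfolding atLeastAtMost_iff by blast+
        then have "real (lo q) \<le> real N" "real N \<le> real (hi q)" "1 \<le> N" using lh(1) by linarith+
        then show ?thesis using lh(5,6) by linarith
      qed
      let ?f = "\<lambda>n N. dual_kernel X W Z n N"
      have f0: "0 \<le> ?f n N" if "n \<in> {1..nm}" for n N using that W(3) WX by (intro dual_kernel_nonneg) auto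
      have fle: "?f n N \<le> 2 * q / real n" if "n \<in> {1..nm}" "N \<in> {lo q..hi q}" for n N
      proof -
        have "?f n N \<le> real N / real n" using that W(3) WX by (intro dual_kernel_le) auto
        also have "\<dots> \<le> 2 * q / real n" using memN[OF that(2)] by (intro divide_right_mono) auto
        finally show ?thesis .
      qed
      have tot: "(\<Sum>n=1..nm. 2 * q / real n) \<le> B"
      proof -
        have "(\<Sum>n=1..nm. 2 * q / real n) = 2 * q * harm nm" unfolding harm_def by (simp add: sum_distrib_left divide_inverse)
        also have "\<dots> \<le> 2 * q * (1 + ln (real nm))" using nm q1 by (intro mult_left_mono harm_le) auto
        also have "\<dots> \<le> 2 * q * (1 + ln q)" using nm q1 by (intro mult_left_mono add_left_mono ln_mono) auto
        also have "\<dots> \<le> B" unfolding B_def using elim(2) .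
        finally show ?thesis .
      qed
      have tF: "\<bar>\<Sum>n=1..nm. ?f n N * real_of_int (jac (int n) N)\<bar> \<le> B" if "N \<in> {lo q..hi q}" for N
      proof -
        have "\<bar>\<Sum>n=1..nm. ?f n N * real_of_int (jac (int n) N)\<bar> \<le> (\<Sum>n=1..nm. 2 * q / real n)"
        proof (intro order_trans[OF sum_abs] sum_mono)
          fix n assume n: "n \<in> {1..nm}"
          have "\<bar>real_of_int (jac (int n) N)\<bar> \<le> 1" using jac_abs_le[of "int n" N] by linarith
          then have "\<bar>?f n N * real_of_int (jac (int n) N)\<bar> \<le> ?f n N * 1"
            unfolding abs_mult using f0[OF n] by (intro mult_mono) auto
          then show "\<bar>?f n N * real_of_int (jac (int n) N)\<bar> \<le> 2 * q / real n" using fle[OF n that] by linarith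
        qed
        then show ?thesis using tot by linarith
      qed
      have tD: "(\<Sum>n\<in>{n\<in>{1..nm}. near_square (n * h)}. ?f n N) \<le> B" if "N \<in> {lo q..hi q}" for N h
      proof -
        have "(\<Sum>n\<in>{n\<in>{1..nm}. near_square (n * h)}. ?f n N) \<le> (\<Sum>n=1..nm. ?f n N)"
          using f0 by (intro sum_mono2) auto
        also have "\<dots> \<le> (\<Sum>n=1..nm. 2 * q / real n)" using fle that by (intro sum_mono) auto
        finally show ?thesis using tot by linarith
      qed
      have TV: "\<bar>?f n (hi q)\<bar> + (\<Sum>N=lo q..<hi q. \<bar>?f n (Suc N) - ?f n N\<bar>) \<le> V n" if n: "n \<in> {1..nm}" for n
      proof -
        have hq: "hi q \<in> {lo q..hi q}" using lh(2) by simp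
        have 1: "\<bar>?f n (hi q)\<bar> \<le> 2 * q / real n" using fle[OF n hq] f0[OF n, of "hi q"] by linarith
        let ?t = "2 / real n + (if real n \<le> Z then 4 * real X / q else 0)"
        have t0: "0 \<le> ?t" using q1 by simp
        have "(\<Sum>N=lo q..<hi q. \<bar>?f n (Suc N) - ?f n N\<bar>) \<le> (\<Sum>N=lo q..<hi q. ?t)"
        proof (rule sum_mono)
          fix N assume "N \<in> {lo q..<hi q}"
          then have "N \<in> {lo q..hi q}" by auto
          note N = memN[OF this]
          have "\<bar>?f n (Suc N) - ?f n N\<bar> \<le> 2 / real n + (if real n \<le> Z then 4 * real X / real N else 0)"
            using n N W(3) WX by (intro dual_kernel_diff) auto
          also have "\<dots> \<le> ?t"
          proof -
            have "4 * real X / real N \<le> 4 * real X / q" using N q1 by (intro divide_left_mono) auto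
            then show ?thesis by simp
          qed
          finally show "\<bar>?f n (Suc N) - ?f n N\<bar> \<le> ?t" .
        qed
        also have "\<dots> = real (hi q - lo q) * ?t" by simp
        also have "\<dots> \<le> q * ?t" using lh(3) t0 by (intro mult_right_mono)
        also have "\<dots> = 2 * q / real n + (if real n \<le> Z then 4 * real X else 0)" using q1 by (simp add: distrib_left)
        finally have "(\<Sum>N=lo q..<hi q. \<bar>?f n (Suc N) - ?f n N\<bar>) \<le> 2 * q / real n + (if real n \<le> Z then 4 * real X else 0)" .
        moreover have "4 * q / real n = 2 * q / real n + 2 * q / real n" by simp
        ultimately show ?thesis unfolding V_def using 1 by linarith
      qed
      have mn: "w0 / sqrt (real \<alpha>) \<le> (\<Sum>l\<in>{l\<in>{1..nm}. coprime l N \<and> \<alpha> * l\<^sup>2 \<le> nm}. ?f (\<alpha> * l\<^sup>2) N)"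
        if Nm: "N \<in> {lo q..hi q}" and \<alpha>: "\<alpha> \<ge> 1" "real \<alpha> \<le> exp (LL q / 2)" for N \<alpha>
      proof -
        note N = memN[OF Nm]
        define b where "b = sqrt (real \<alpha>)"
        have b: "0 < b" "b * b = real \<alpha>" unfolding b_def using \<alpha> by auto
        \<comment> \<open>z^2 = q / (4 X alpha), so that alpha l^2 <= q / (4 X) for l <= z, the
          region where \<open>dual_kernel_lower\<close> applies.\<close>
        define z where "z = s / (2 * b)"
        have z2: "z\<^sup>2 = q / (4 * real X * real \<alpha>)"
        proof -
          have "s\<^sup>2 = q / real X" unfolding s_def using qX1 by simp
          then show ?thesis unfolding z_def power_divide power_mult_distrib b(2)[symmetric]
            by (simp add: power2_eq_square)
        qed
        have z0: "0 < z" unfolding z_def using s1 b by simp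
        have "exp (LL q) / 4 / exp (LL q / 2) \<le> (q / real X) / 4 / real \<alpha>" using eX \<alpha> qX1 by (intro frac_le divide_right_mono) auto
        also have "\<dots> = z\<^sup>2" unfolding z2 by simp
        finally have "sqrt (exp (LL q) / 4 / exp (LL q / 2)) \<le> sqrt (z\<^sup>2)" by (rule real_sqrt_le_mono)
        then have "sqrt (exp (LL q) / 4 / exp (LL q / 2)) \<le> z" using z0 by simp
        then have z: "exp (LL q / 5) * 2 \<le> z" using elim(1) by linarith
        then have z1: "1 \<le> z" using elim(7) by linarith
        define Y where "Y = nat \<lfloor>z\<rfloor>"
        have Y: "z / 2 \<le> real Y" "real Y \<le> z" using nat_floor_half[OF z1] unfolding Y_def by auto
        have Yl: "real (\<alpha> * l\<^sup>2) \<le> q / (4 * real X)" if "l \<le> Y" for l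
        proof -
          have "real l \<le> z" using that Y(2) by linarith
          then have "(real l)\<^sup>2 \<le> z\<^sup>2" by (intro power_mono) auto
          then have "real \<alpha> * (real l)\<^sup>2 \<le> real \<alpha> * (q / (4 * real X * real \<alpha>))" unfolding z2 by (intro mult_left_mono) auto
          also have "\<dots> = q / (4 * real X)" using \<alpha> by simp
          finally show ?thesis by simp
        qed
        have q4: "q / (4 * real X) \<le> q / 4"
        proof -
          have "q / (4 * real X) \<le> q / (4 * 1)" using q1 X16 by (intro divide_left_mono) auto
          then show ?thesis by simp
        qed
        have Yn: "4 * real (\<alpha> * l\<^sup>2) \<le> q \<and> \<alpha> * l\<^sup>2 \<le> nm \<and> l \<le> nm" if "l \<le> Y" for l
        proof -
          have 1: "4 * real (\<alpha> * l\<^sup>2) \<le> q" using Yl[OF that] q4 by linarith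
          then have "real (\<alpha> * l\<^sup>2) \<le> real nm" using nm elim(6) by linarith
          then have 2: "\<alpha> * l\<^sup>2 \<le> nm" by (simp only: of_nat_le_iff)
          have "l \<le> l\<^sup>2" by (simp add: power2_eq_square)
          also have "\<dots> \<le> \<alpha> * l\<^sup>2" using \<alpha> by simp
          finally show ?thesis using 1 2 by simp
        qed
        have "real Y \<le> real nm" using Yn[of Y] by simp
        then have Y2: "real Y \<le> 2 * q" using nm q1 by linarith
        have Y1: "exp (LL q / 5) \<le> real Y" using z Y(1) by linarith
        have N0: "0 < N" "real N \<le> 2 * q" using N by auto
        have c: "real Y / (6 * ln q) \<le> real (card {l\<in>{1..Y}. coprime l N})"
          by (rule elim(15)[rule_format, OF Y1 Y2 N0])
        let ?S = "{l\<in>{1..Y}. coprime l N}"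
        let ?K = "real \<alpha> * (real X)\<^sup>2 / (5 * q)"
        have kl: "?K * (real l)\<^sup>2 \<le> ?f (\<alpha> * l\<^sup>2) N" if "l \<in> ?S" for l
        proof -
          have l: "l \<le> Y" "1 \<le> l" using that by auto
          have "2 * real (\<alpha> * l\<^sup>2) * real X \<le> 2 * (q / (4 * real X)) * real X"
            using Yl[OF l(1)] by (intro mult_left_mono mult_right_mono) auto
          also have "\<dots> = q / 2" using X0 by simp
          also have "\<dots> \<le> real N" using N q1 by linarith
          finally have "real (2 * (\<alpha> * l\<^sup>2) * X) \<le> real N" by simp
          then have k2: "2 * (\<alpha> * l\<^sup>2) * X \<le> N" by (simp only: of_nat_le_iff)
          have k1: "4 * (\<alpha> * l\<^sup>2) \<le> N"
          proof -
            have "4 * real (\<alpha> * l\<^sup>2) \<le> real N" using Yn[OF l(1)] N by linarith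
            then have "real (4 * (\<alpha> * l\<^sup>2)) \<le> real N" by simp
            then show ?thesis by (simp only: of_nat_le_iff)
          qed
          have k3: "real (\<alpha> * l\<^sup>2) \<le> Z" using Yl[OF l(1)] Zq by linarith
          have k0: "1 \<le> \<alpha> * l\<^sup>2" using \<alpha> l by simp
          have "?K * (real l)\<^sup>2 = real (\<alpha> * l\<^sup>2) * (real X)\<^sup>2 / (5 * q)" by simp
          also have "\<dots> = 2 * real (\<alpha> * l\<^sup>2) * (real X)\<^sup>2 / (5 * (2 * q))" by simp
          also have "\<dots> \<le> 2 * real (\<alpha> * l\<^sup>2) * (real X)\<^sup>2 / (5 * real N)"
            using N q1 by (intro divide_left_mono mult_pos_pos) auto
          also have "\<dots> \<le> ?f (\<alpha> * l\<^sup>2) N" by (rule dual_kernel_lower[OF k0 k1 k2 k3 W(3) W2])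
          finally show ?thesis .
        qed
        have c3: "(z / (12 * ln q)) ^ 3 / 3 \<le> (\<Sum>l\<in>?S. (real l)\<^sup>2)"
        proof -
          have "z / (12 * ln q) = (z / 2) / (6 * ln q)" by simp
          also have "\<dots> \<le> real Y / (6 * ln q)" using Y(1) elim(5) by (intro divide_right_mono) auto
          also have "\<dots> \<le> real (card ?S)" by (rule c)
          finally have "(z / (12 * ln q)) ^ 3 \<le> real (card ?S) ^ 3" using z0 elim(5) by (intro power_mono) auto
          moreover have "(real (card ?S))^3 / 3 \<le> (\<Sum>l\<in>?S. (real l)\<^sup>2)" by (rule sum_squares_ge_card_cube) auto
          ultimately show ?thesis by linarith
        qed
        have "w0 / b = ?K * ((z / (12 * ln q)) ^ 3 / 3)"
        proof -
          have "s * r = sqrt q" unfolding s_def r_def using X0 by (simp add: real_sqrt_divide)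
          then have e1: "sqrt q = s * r" by simp
          have "sqrt q * sqrt q = q" using q1 by simp
          then have e2: "q = s * r * (s * r)" unfolding e1 by simp
          have gen: "s * r * r / (207360 * u ^ 3) / b = (b * b) * (r * r)\<^sup>2 / (5 * (s * r * (s * r))) * ((s / (2 * b) / (12 * u)) ^ 3 / 3)" if "u > 0" for u :: real
            using that b(1) s1 r4 by (simp add: field_simps power3_eq_cube power2_eq_square)
          have "0 < ln q" using elim(5) by linarith
          from gen[OF this] show ?thesis unfolding w0_def z_def e1 b(2) rr e2[symmetric] .
        qed
        also have "\<dots> \<le> ?K * (\<Sum>l\<in>?S. (real l)\<^sup>2)" using c3 q1 by (intro mult_left_mono) auto
        also have "\<dots> = (\<Sum>l\<in>?S. ?K * (real l)\<^sup>2)" by (rule sum_distrib_left)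
        also have "\<dots> \<le> (\<Sum>l\<in>?S. ?f (\<alpha> * l\<^sup>2) N)" by (rule sum_mono) (rule kl)
        also have "\<dots> \<le> (\<Sum>l\<in>{l\<in>{1..nm}. coprime l N \<and> \<alpha> * l\<^sup>2 \<le> nm}. ?f (\<alpha> * l\<^sup>2) N)"
        proof (rule sum_mono2)
          show "?S \<subseteq> {l\<in>{1..nm}. coprime l N \<and> \<alpha> * l\<^sup>2 \<le> nm}" using Yn by auto
          show "0 \<le> ?f (\<alpha> * l\<^sup>2) N" if "l \<in> {l\<in>{1..nm}. coprime l N \<and> \<alpha> * l\<^sup>2 \<le> nm} - ?S" for l
            using that \<alpha> W(3) WX by (intro dual_kernel_nonneg) auto
        qed simp
        finally show ?thesis unfolding b_def .
      qed
      have VS: "(\<Sum>n=1..nm. V n * sqrt (real n)) \<le> 8 * q * sqrt q + 4 * q powr 1.53 * sqrt (q powr 1.53 / q powr 0.93)"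
      proof -
        have one: "V n * sqrt (real n) = 4 * q * (1 / sqrt (real n)) + (if real n \<le> Z then 4 * real X * sqrt (real n) else 0)" if "n \<in> {1..nm}" for n
        proof -
          have "sqrt (real n) / real n = 1 / sqrt (real n)" using that by (simp add: real_divide_square_eq sqrt_divide_self_eq inverse_eq_divide)
          then have "4 * q / real n * sqrt (real n) = 4 * q * (1 / sqrt (real n))" by (metis times_divide_eq_left times_divide_eq_right)
          then show ?thesis unfolding V_def by (simp add: distrib_right)
        qed
        have "(\<Sum>n=1..nm. V n * sqrt (real n)) = (\<Sum>n=1..nm. 4 * q * (1 / sqrt (real n)) + (if real n \<le> Z then 4 * real X * sqrt (real n) else 0))"
          by (rule sum.cong[OF refl one])
        also have "\<dots> = 4 * q * (\<Sum>n=1..nm. 1 / sqrt (real n)) + (\<Sum>n=1..nm. if real n \<le> Z then 4 * real X * sqrt (real n) else 0)"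
          by (simp only: sum.distrib sum_distrib_left)
        also have "4 * q * (\<Sum>n=1..nm. 1 / sqrt (real n)) \<le> 4 * q * (2 * sqrt q)"
        proof (rule mult_left_mono)
          have "2 * sqrt (real nm) \<le> 2 * sqrt q" using nm by simp
          then show "(\<Sum>n=1..nm. 1 / sqrt (real n)) \<le> 2 * sqrt q" using sum_inverse_sqrt_le[of nm] by linarith
        qed (use q1 in auto)
        also have "(\<Sum>n=1..nm. if real n \<le> Z then 4 * real X * sqrt (real n) else 0) \<le> Z * (4 * real X * sqrt Z)"
        proof -
          have "(\<Sum>n=1..nm. if real n \<le> Z then 4 * real X * sqrt (real n) else 0) = (\<Sum>n\<in>{n\<in>{1..nm}. real n \<le> Z}. 4 * real X * sqrt (real n))"
            by (rule sum.inter_filter[symmetric]) simp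
          also have "\<dots> \<le> (\<Sum>n\<in>{n\<in>{1..nm}. real n \<le> Z}. 4 * real X * sqrt Z)"
            by (intro sum_mono mult_left_mono) auto
          also have "\<dots> = real (card {n\<in>{1..nm}. real n \<le> Z}) * (4 * real X * sqrt Z)" by simp
          also have "\<dots> \<le> Z * (4 * real X * sqrt Z)"
          proof (rule mult_right_mono)
            have "{n\<in>{1..nm}. real n \<le> Z} \<subseteq> {1..nat \<lfloor>Z\<rfloor>}" by (auto simp: le_nat_floor)
            then have "card {n\<in>{1..nm}. real n \<le> Z} \<le> card {1..nat \<lfloor>Z\<rfloor>}" by (intro card_mono) auto
            then have "real (card {n\<in>{1..nm}. real n \<le> Z}) \<le> real (nat \<lfloor>Z\<rfloor>)" by simp
            then show "real (card {n\<in>{1..nm}. real n \<le> Z}) \<le> Z" using nat_floor_half[OF Z1] by linarith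
          qed (use Z1 in auto)
          finally show ?thesis .
        qed
        also have "Z * (4 * real X * sqrt Z) = 4 * q powr 1.53 * sqrt Z" unfolding Z_def using X0 by simp
        also have "\<dots> \<le> 4 * q powr 1.53 * sqrt (q powr 1.53 / q powr 0.93)"
        proof -
          have "Z \<le> q powr 1.53 / q powr 0.93" unfolding Z_def using X q1 X0 by (intro divide_left_mono) auto
          then show ?thesis by (intro mult_left_mono) auto
        qed
        finally show ?thesis by simp
      qed
      have er: "real A * (MM q ^ 3 * (8 * ln q) * (\<Sum>n=1..nm. V n * sqrt (real n))) + 6 * (MM q)\<^sup>2 * B * q / real A \<le> w0 * q / 128"
      proof -
        define G where "G = 8 * q * sqrt q + 4 * q powr 1.53 * sqrt (q powr 1.53 / q powr 0.93)"
        have G0: "0 \<le> G" unfolding G_def using q1 by simp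
        have sx: "s = sqrt q * r / real X" unfolding s_def r_def using X0 by (simp add: real_sqrt_divide field_simps)
        have sle: "s \<le> sqrt q * r / q powr 0.93" unfolding sx using X r4 q1 X0 by (intro divide_left_mono) auto
        have V0: "0 \<le> (\<Sum>n=1..nm. V n * sqrt (real n))" unfolding V_def using q1 by (intro sum_nonneg mult_nonneg_nonneg) auto
        have M0: "0 \<le> MM q ^ 3 * (8 * ln q)" using elim(5) by simp
        have "real A * (MM q ^ 3 * (8 * ln q) * (\<Sum>n=1..nm. V n * sqrt (real n))) \<le> (sqrt q * r / q powr 0.93 * q powr 0.01) * (MM q ^ 3 * (8 * ln q) * G)"
        proof (rule mult_mono)
          have "a \<le> sqrt q * r / q powr 0.93 * q powr 0.01" unfolding a_def using sle by (intro mult_right_mono) auto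
          then show "real A \<le> sqrt q * r / q powr 0.93 * q powr 0.01" using A(2) by linarith
          show "MM q ^ 3 * (8 * ln q) * (\<Sum>n=1..nm. V n * sqrt (real n)) \<le> MM q ^ 3 * (8 * ln q) * G"
            using VS M0 unfolding G_def by (intro mult_left_mono) auto
        qed (use r4 q1 V0 M0 in auto)
        also have "\<dots> = (q powr 0.01 / q powr 0.93 * (MM q ^ 3 * (8 * ln q) * G)) * (sqrt q * r)" by (simp add: mult_ac)
        also have "\<dots> \<le> q / (53084160 * ln q ^ 3) * (sqrt q * r)"
          using elim(3) r4 q1 unfolding G_def by (intro mult_right_mono) auto
        finally have t1: "real A * (MM q ^ 3 * (8 * ln q) * (\<Sum>n=1..nm. V n * sqrt (real n))) \<le> q / (53084160 * ln q ^ 3) * (sqrt q * r)" .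
        have qA: "q / real A \<le> 2 / q powr 0.01 * (sqrt q * r)"
        proof -
          have "q / real A \<le> q / (a / 2)" using A a1 q1 by (intro divide_left_mono mult_pos_pos) auto
          also have "\<dots> = 2 / q powr 0.01 * (q / s)" unfolding a_def by (simp add: mult.commute)
          also have "q / s = sqrt q * r"
          proof -
            have "s * (sqrt q * r) = (s * r) * sqrt q" by simp
            also have "s * r = sqrt q" unfolding s_def r_def using X0 by (simp add: real_sqrt_divide)
            finally have "s * (sqrt q * r) = q" using q1 by simp
            then show ?thesis using s1 by (simp add: field_simps)
          qed
          finally show ?thesis .
        qed
        have "6 * (MM q)\<^sup>2 * B * q / real A = 6 * (MM q)\<^sup>2 * B * (q / real A)" by simp
        also have "\<dots> \<le> 6 * (MM q)\<^sup>2 * B * (2 / q powr 0.01 * (sqrt q * r))"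
          using qA q1 elim(5) unfolding B_def by (intro mult_left_mono) auto
        also have "\<dots> = (48 * (MM q)\<^sup>2 * q * ln q / q powr 0.01) * (sqrt q * r)" unfolding B_def by (simp add: mult_ac)
        also have "\<dots> \<le> q / (53084160 * ln q ^ 3) * (sqrt q * r)" using elim(4) r4 q1 by (intro mult_right_mono) auto
        finally have t2: "6 * (MM q)\<^sup>2 * B * q / real A \<le> q / (53084160 * ln q ^ 3) * (sqrt q * r)" .
        have "w0 * q / 128 = q / (53084160 * ln q ^ 3) * (sqrt q * r) + q / (53084160 * ln q ^ 3) * (sqrt q * r)"
          unfolding w0_def using elim(5) by (simp add: field_simps)
        then show ?thesis using t1 t2 by linarith
      qed
      have nm2: "real nm \<le> 2 * q" using nm q1 by linarith
      have "\<exists>N\<in>{lo q..hi q}. N mod 16 = 7 \<and> squarefree N \<and> w0 * exp (2 * UU q) / 128 \<le> (\<Sum>n=1..nm. ?f n N * real_of_int (jac (int n) N))"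
        by (rule elim(14)[rule_format, where V = V and B = B and A = A, OF nm(3) nm2 A(3) Aq w00 f0 TV tF tD mn er])
      then obtain N where N: "N \<in> {lo q..hi q}" "N mod 16 = 7" "squarefree N"
        "w0 * exp (2 * UU q) / 128 \<le> (\<Sum>n=1..nm. ?f n N * real_of_int (jac (int n) N))" by blast
      note Nb = memN[OF N(1)]
      let ?S = "\<Sum>n=1..X. real_of_int (jac (int n) N)"
      have "100 \<le> real N" "real N < real (2 * nm + 2)" using Nb nm elim(6) by auto
      then have "100 \<le> N" "N \<le> 2 * nm + 1" by linarith+
      then have "(\<Sum>n=1..nm. ?f n N * real_of_int (jac (int n) N)) \<le> sqrt (real N) * (?S + real W + 1) + (real N)\<^sup>2 / (2 * real W * Z)"
        using N W(3) WX Z1 by (intro dual_lower) auto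
      moreover have "(real N)\<^sup>2 / (2 * real W * Z) \<le> 4 * sqrt q * r"
      proof -
        have "(real N)\<^sup>2 / (2 * real W * Z) \<le> (2 * q)\<^sup>2 / (r * Z)"
          using Nb W(1) Z1 r4 by (intro frac_le mult_right_mono power_mono mult_pos_pos) auto
        also have "\<dots> = (q\<^sup>2 * 4 / q powr 1.53) * r"
          unfolding Z_def rr[symmetric] using r4 by (simp add: power2_eq_square)
        also have "\<dots> \<le> 4 * sqrt q * r" using elim(11) r4 by (intro mult_right_mono) auto
        finally show ?thesis .
      qed
      ultimately have T: "w0 * exp (2 * UU q) / 128 - 4 * sqrt q * r \<le> sqrt (real N) * (?S + real W + 1)"
        using N(4) by linarith
      define e where "e = exp (2 * UU q) / (26542080 * ln q ^ 3)"
      have Te: "w0 * exp (2 * UU q) / 128 - 4 * sqrt q * r = (e - 4) * r * sqrt q"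
        unfolding w0_def e_def by (simp add: algebra_simps)
      have e4: "4 \<le> e" unfolding e_def by (rule elim(12))
      have T0: "0 \<le> (e - 4) * r * sqrt q" using e4 r4 q1 by simp
      have S0: "0 \<le> ?S + real W + 1"
      proof (rule ccontr)
        assume "\<not> 0 \<le> ?S + real W + 1"
        then have "sqrt (real N) * (?S + real W + 1) < 0" using Nb by (intro mult_pos_neg) auto
        then show False using T Te T0 by linarith
      qed
      have "sqrt (real N) \<le> sqrt (4 * q)" using Nb q1 by simp
      then have "sqrt (real N) \<le> 2 * sqrt q" by (simp add: real_sqrt_mult)
      then have "sqrt (real N) * (?S + real W + 1) \<le> 2 * sqrt q * (?S + real W + 1)" using S0 by (intro mult_right_mono)
      then have "(e - 4) * r * sqrt q \<le> (2 * (?S + real W + 1)) * sqrt q" using T Te by (simp add: mult_ac)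
      then have "(e - 4) * r \<le> 2 * (?S + real W + 1)" using q1 by simp
      \<comment> \<open>The truncation costs 2 r after halving; W <= r and 1 <= r account for the
        rest.\<close>
      then have "e * r / 2 - 4 * r \<le> ?S" using W(2) r4 by (simp add: algebra_simps)
      moreover have "e * r / 2 - 4 * r = sqrt (real X) * (exp (2 * UU q) / (53084160 * ln q ^ 3) - 4)"
        unfolding e_def r_def by (simp add: algebra_simps)
      ultimately show "\<exists>N\<in>{lo q..hi q}. N mod 16 = 7 \<and> squarefree N \<and>
        sqrt (real X) * (exp (2 * UU q) / (53084160 * ln q ^ 3) - 4) \<le> (\<Sum>n=1..X. real_of_int (jac (int n) N))"
        using N by auto
    qed
  qed
qed

lemma fundamental_discriminant_minus:
  assumes "N mod 16 = 7" "squarefree N" shows "fundamental_discriminant (- int N)"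
proof -
  have "int N mod 16 = 7" using assms(1) by presburger
  then have "(- int N) mod 4 = 1" by presburger
  moreover have "squarefree (- int N)"
  proof (rule squarefreeI)
    fix x :: int assume "x\<^sup>2 dvd - int N"
    moreover have "int (nat \<bar>x\<bar> ^ 2) = x\<^sup>2" by simp
    ultimately have "int (nat \<bar>x\<bar> ^ 2) dvd int N" by (simp only: dvd_minus_iff)
    then have "nat \<bar>x\<bar> ^ 2 dvd N" by (simp only: int_dvd_int_iff)
    then have "nat \<bar>x\<bar> dvd 1" using assms(2) by (simp add: squarefree_def)
    then show "is_unit x" by simp
  qed
  ultimately show ?thesis by (simp add: fundamental_discriminant_def)
qed

theorem theorem10:
  shows "\<exists>\<epsilon> :: real \<Rightarrow> real. (\<epsilon> \<longlongrightarrow> 0) at_top \<and>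
    (\<exists>C :: real. C > 0 \<and> ( \<forall>\<^sub>F q :: real in at_top. \<forall>x :: real.
       exp (sqrt (ln q)) \<le> x \<longrightarrow> x \<le> q / exp (sqrt (ln q)) \<longrightarrow>
       (\<exists>D :: int. fundamental_discriminant D \<and>
          q \<le> real_of_int \<bar>D\<bar> \<and> real_of_int \<bar>D\<bar> \<le> 2 * q \<and>
          1 / sqrt x * (\<Sum>n = 1..nat \<lfloor>x\<rfloor>. real_of_int (kronecker D n))
            \<ge> C * exp ((1 + \<epsilon> q) * (sqrt (ln q) / ln (ln q))))))"
proof (intro exI conjI)
  show "((\<lambda>_::real. 0::real) \<longlongrightarrow> 0) at_top" by simp
  show "(0::real) < 1" by simp
  \<comment> \<open>\<open>exp (UU q)\<close> outgrows every power of ln q. The factor 2 on the left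
    compensates for rounding x down to X, where sqrt x <= 2 sqrt X.\<close>
  have "eventually (\<lambda>q::real. 2 * exp (UU q) \<le> exp (2 * UU q) / (1536 * ln q)) at_top" by real_asymp
  moreover have "eventually (\<lambda>q::real. 2 * exp (UU q) \<le> exp (2 * UU q) / (53084160 * ln q ^ 3) - 4) at_top" by real_asymp
  moreover have "eventually (\<lambda>q::real. 1 \<le> ln q) at_top" by real_asymp
  moreover have "eventually (\<lambda>q::real. 2 \<le> q) at_top" by real_asymp
  moreover note direct_range dual_range
  ultimately show "\<forall>\<^sub>F q :: real in at_top. \<forall>x :: real.
       exp (sqrt (ln q)) \<le> x \<longrightarrow> x \<le> q / exp (sqrt (ln q)) \<longrightarrow>
       (\<exists>D :: int. fundamental_discriminant D \<and>
          q \<le> real_of_int \<bar>D\<bar> \<and> real_of_int \<bar>D\<bar> \<le> 2 * q \<and>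
          1 / sqrt x * (\<Sum>n = 1..nat \<lfloor>x\<rfloor>. real_of_int (kronecker D n))
            \<ge> 1 * exp ((1 + 0) * (sqrt (ln q) / ln (ln q))))"
  proof eventually_elim
    case (elim q)
    note lh = lo_hi[OF elim(4)]
    show ?case
    proof (intro allI impI)
      fix x :: real assume x: "exp (LL q) \<le> x" "x \<le> q / exp (LL q)"
      have "1 \<le> exp (LL q)" using elim(3) by simp
      then have x1: "1 \<le> x" using x(1) by linarith
      define X where "X = nat \<lfloor>x\<rfloor>"
      have X: "x / 2 \<le> real X" "real X \<le> x" using nat_floor_half[OF x1] unfolding X_def by blast+
      let ?S = "\<lambda>N. \<Sum>n=1..X. real_of_int (jac (int n) N)"
      have "\<exists>N\<in>{lo q..hi q}. N mod 16 = 7 \<and> squarefree N \<and> sqrt (real X) * (2 * exp (UU q)) \<le> ?S N"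
      proof (cases "real X \<le> q powr 0.93")
        case True
        have "exp (LL q) / 2 \<le> real X" using x(1) X(1) by linarith
        from elim(5)[rule_format, OF this True] obtain N
          where N: "N \<in> {lo q..hi q}" "N mod 16 = 7" "squarefree N"
            "sqrt (real X) * exp (2 * UU q) / (1536 * ln q) \<le> ?S N" by blast
        have "sqrt (real X) * (2 * exp (UU q)) \<le> sqrt (real X) * (exp (2 * UU q) / (1536 * ln q))"
          using elim(1) by (intro mult_left_mono) auto
        then have "sqrt (real X) * (2 * exp (UU q)) \<le> ?S N" using N(4) by simp
        then show ?thesis using N by blast
      next
        case False
        then have F: "q powr 0.93 \<le> real X" by linarith
        have "real X \<le> q / exp (LL q)" using x(2) X(2) by linarith
        from elim(6)[rule_format, OF F this] obtain N
          where N: "N \<in> {lo q..hi q}" "N mod 16 = 7" "squarefree N"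
            "sqrt (real X) * (exp (2 * UU q) / (53084160 * ln q ^ 3) - 4) \<le> ?S N" by blast
        have "sqrt (real X) * (2 * exp (UU q)) \<le> sqrt (real X) * (exp (2 * UU q) / (53084160 * ln q ^ 3) - 4)"
          using elim(2) by (intro mult_left_mono) auto
        then have "sqrt (real X) * (2 * exp (UU q)) \<le> ?S N" using N(4) by linarith
        then show ?thesis using N by blast
      qed
      then obtain N where N: "N \<in> {lo q..hi q}" "N mod 16 = 7" "squarefree N"
        "sqrt (real X) * (2 * exp (UU q)) \<le> ?S N" by blast
      have "lo q \<le> N" "N \<le> hi q" using N(1) unfolding atLeastAtMost_iff by blast+
      then have "real (lo q) \<le> real N" "real N \<le> real (hi q)" by linarith+
      then have Nq: "q \<le> real N" "real N \<le> 2 * q" using lh(5,6) by linarith+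
      have "x \<le> 4 * real X" using X(1) x1 by linarith
      then have "sqrt x \<le> sqrt (4 * real X)" by simp
      then have "sqrt x \<le> 2 * sqrt (real X)" by (simp add: real_sqrt_mult)
      then have "sqrt x * exp (UU q) \<le> (2 * sqrt (real X)) * exp (UU q)" by (intro mult_right_mono) auto
      then have "sqrt x * exp (UU q) \<le> ?S N" using N(4) by argo
      moreover have "?S N = (\<Sum>n=1..nat \<lfloor>x\<rfloor>. real_of_int (kronecker (- int N) n))"
        unfolding X_def[symmetric] using N(2) by (intro sum.cong refl) (simp add: kronecker_eq_jac)
      ultimately have "exp (UU q) \<le> 1 / sqrt x * (\<Sum>n=1..nat \<lfloor>x\<rfloor>. real_of_int (kronecker (- int N) n))"
        using x1 by (simp add: field_simps)
      then have "1 * exp ((1 + 0) * UU q) \<le> 1 / sqrt x * (\<Sum>n=1..nat \<lfloor>x\<rfloor>. real_of_int (kronecker (- int N) n))" by simp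
      moreover have "fundamental_discriminant (- int N)" by (rule fundamental_discriminant_minus) (rule N)+
      moreover have "q \<le> real_of_int \<bar>- int N\<bar>" "real_of_int \<bar>- int N\<bar> \<le> 2 * q" using Nq by simp_all
      ultimately show "\<exists>D :: int. fundamental_discriminant D \<and>
          q \<le> real_of_int \<bar>D\<bar> \<and> real_of_int \<bar>D\<bar> \<le> 2 * q \<and>
          1 / sqrt x * (\<Sum>n = 1..nat \<lfloor>x\<rfloor>. real_of_int (kronecker D n))
            \<ge> 1 * exp ((1 + 0) * (sqrt (ln q) / ln (ln q)))" by blast
    qed
  qed
qed

end
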